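(* Let $N\ge2$ and $0<s<1$. Then there is a constant $C>0$ (independent of $f$) such that for all $f\in H^1(\mathbb{B}^N)$, $$[f]_s^2\le C\int_{\mathbb{B}^N}|\nabla_{\mathbb{B}^N}f|^2\,dV_{\mathbb{B}^N}.$$ In particular, there is a continuous embedding $H^1(\mathbb{B}^N)\hookrightarrow H^s(\mathbb{B}^N)$ for $0<s<1$.
   Context: $\mathbb{B}^N$ is the ball model of hyperbolic space: the Euclidean unit ball $\{x\in\mathbb{R}^N:|x|<1\}$ with Riemannian metric $\left(\frac{2}{1-|x|^2}\right)^2dx^2$ and volume element $dV_{\mathbb{B}^N}=\left(\frac{2}{1-|x|^2}\right)^N dx$. $\nabla_{\mathbb{B}^N}$ is the Riemannian gradient, with norm taken in the hyperbolic metric. The hyperbolic distance is $d(x,y)=\log\frac{1+|T_x(y)|}{1-|T_x(y)|}$, where $T_a(x)=\frac{|x-a|^2a-(1-|a|^2)(x-a)}{1-2x\cdot a+|x|^2|a|^2}$. $H^1(\mathbb{B}^N)$ is the Sobolev space on $\mathbb{B}^N$ with norm $\|u\|=\left(\int_{\mathbb{B}^N}|\nabla_{\mathbb{B}^N}u|^2dV_{\mathbb{B}^N}\right)^{1/2}$ (completion of $C_0^\infty(\mathbb{B}^N)$; it embeds in $L^2$ because the bottom of the $L^2$-spectrum of $-\Delta_{\mathbb{B}^N}$ is $\frac{(N-1)^2}{4}$). Kernel: for $0<s<1$, $\mathcal{K}_s(\rho)$, $\rho>0$, is given, with $K_\nu$ the modified Bessel function of the second kind, by $$\mathcal{K}_s(\rho)=C(N,s)\left(\frac{-\partial_\rho}{\sinh\rho}\right)^{\frac{N-1}{2}}\left(\rho^{-\frac{1+2s}{2}}K_{\frac{1+2s}{2}}\left(\tfrac{N-1}{2}\rho\right)\right)$$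 if $N\ge3$ is odd, and $$\mathcal{K}_s(\rho)=C(N,s)\int_\rho^\infty\frac{\sinh r}{\sqrt{\pi}\sqrt{\cosh r-\cosh\rho}}\left(\frac{-\partial_r}{\sinh r}\right)^{\frac N2}\left(r^{-\frac{1+2s}{2}}K_{\frac{1+2s}{2}}\left(\tfrac{N-1}{2}r\right)\right)dr$$ if $N\ge2$ is even, where $$C(N,s)=\frac{\sqrt{\pi}\,2^{2s}\,\Gamma\left(\frac{N+2s}{2}\right)}{2\Gamma(\frac32)\pi^{N/2}|\Gamma(-s)|}\cdot\frac{1}{2^{\frac{N-2+2s}{2}}\Gamma\left(\frac{N+2s}{2}\right)}\left(\frac{N-1}{2}\right)^{\frac{1+2s}{2}}>0.$$ Seminorm: $[f]_s=\left(\int_{\mathbb{B}^N}\int_{\mathbb{B}^N}|f(x)-f(y)|^2\mathcal{K}_s(d(x,y))\,dV_{\mathbb{B}^N}(x)dV_{\mathbb{B}^N}(y)\right)^{1/2}$. The fractional Sobolev space $H^s(\mathbb{B}^N)$ consists of all $f\in L^2(\mathbb{B}^N)$ with $[f]_s<\infty$, with norm $\|f\|_{H^s(\mathbb{B}^N)}=\left(\int_{\mathbb{B}^N}|f|^2dV_{\mathbb{B}^N}+[f]_s^2\right)^{1/2}$. *)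

theory Defs
  imports "HOL-Analysis.Analysis"
begin

text \<open>
  Hyperbolic space in the ball model.  The ambient Euclidean space is an arbitrary type
  \<open>'a :: euclidean_space\<close>, so that the dimension \<open>N\<close> is \<open>DIM('a)\<close>.  Functions on the ball are
  total functions on \<open>'a\<close> whose values outside the open unit ball never matter; as usual for
  Sobolev spaces, two functions that agree almost everywhere represent the same element.
\<close>

section \<open>Geometry of the ball model\<close>

definition hyp_vol :: "'a::euclidean_space measure" where
  "hyp_vol = density (lebesgue_on (ball 0 1))
     (\<lambda>x. ennreal ((2 / (1 - (norm x)\<^sup>2)) ^ DIM('a)))"

definition hyp_T :: "'a::euclidean_space \<Rightarrow> 'a \<Rightarrow> 'a" where
  "hyp_T a x = (1 / (1 - 2 * (x \<bullet> a) + (norm x)\<^sup>2 * (norm a)\<^sup>2)) *\<^sub>R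
     ((norm (x - a))\<^sup>2 *\<^sub>R a - (1 - (norm a)\<^sup>2) *\<^sub>R (x - a))"

definition hyp_dist :: "'a::euclidean_space \<Rightarrow> 'a \<Rightarrow> real" where
  "hyp_dist x y = ln ((1 + norm (hyp_T x y)) / (1 - norm (hyp_T x y)))"

text \<open>Length, in the hyperbolic metric, of a tangent vector \<open>v\<close> at the point \<open>x\<close>.\<close>

definition hyp_norm :: "'a::euclidean_space \<Rightarrow> 'a \<Rightarrow> real" where
  "hyp_norm x v = 2 / (1 - (norm x)\<^sup>2) * norm v"

text \<open>
  The Riemannian gradient at \<open>x\<close> of a function with Euclidean gradient \<open>v\<close> at \<open>x\<close>: the
  differential is raised with the inverse metric \<open>((1 - |x|\<^sup>2) / 2)\<^sup>2\<close>.
\<close>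

definition hyp_raise :: "'a::euclidean_space \<Rightarrow> 'a \<Rightarrow> 'a" where
  "hyp_raise x v = ((1 - (norm x)\<^sup>2) / 2)\<^sup>2 *\<^sub>R v"

section \<open>Test functions and weak gradients\<close>

fun C_k :: "nat \<Rightarrow> ('a::euclidean_space \<Rightarrow> real) \<Rightarrow> bool" where
  "C_k 0 f \<longleftrightarrow> continuous_on UNIV f"
| "C_k (Suc k) f \<longleftrightarrow> (\<forall>x. f differentiable (at x)) \<and>
     (\<forall>b\<in>Basis. C_k k (\<lambda>x. frechet_derivative f (at x) b))"

text \<open>\<open>C\<^sub>0\<^sup>\<infinity>\<close> of the ball; its elements are extended by zero to the whole space.\<close>

definition test_functions :: "('a::euclidean_space \<Rightarrow> real) set" where
  "test_functions = {\<phi>. (\<forall>k. C_k k \<phi>) \<and>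
     compact (closure {x. \<phi> x \<noteq> 0}) \<and> closure {x. \<phi> x \<noteq> 0} \<subseteq> ball 0 1}"

definition euclid_grad :: "('a::euclidean_space \<Rightarrow> real) \<Rightarrow> 'a \<Rightarrow> 'a" where
  "euclid_grad \<phi> x = (\<Sum>b\<in>Basis. frechet_derivative \<phi> (at x) b *\<^sub>R b)"

definition has_weak_grad :: "('a::euclidean_space \<Rightarrow> real) \<Rightarrow> ('a \<Rightarrow> 'a) \<Rightarrow> bool" where
  "has_weak_grad f g \<longleftrightarrow>
     (\<forall>K. compact K \<and> K \<subseteq> ball 0 1 \<longrightarrow>
        f absolutely_integrable_on K \<and> g absolutely_integrable_on K) \<and>
     (\<forall>\<phi>\<in>test_functions.
        (LINT x:ball 0 1|lebesgue. f x *\<^sub>R euclid_grad \<phi> x) =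
        - (LINT x:ball 0 1|lebesgue. \<phi> x *\<^sub>R g x))"

text \<open>
  The weak gradient is unique almost everywhere on the ball; \<open>weak_grad\<close> picks a representative.
  It is meaningful only for functions that have a weak gradient.
\<close>

definition weak_grad :: "('a::euclidean_space \<Rightarrow> real) \<Rightarrow> 'a \<Rightarrow> 'a" where
  "weak_grad f = (SOME g. has_weak_grad f g)"

definition hyp_grad :: "('a::euclidean_space \<Rightarrow> real) \<Rightarrow> 'a \<Rightarrow> 'a" where
  "hyp_grad f x = hyp_raise x (weak_grad f x)"

section \<open>The spaces \<open>L\<^sup>2\<close> and \<open>H\<^sup>1\<close>\<close>

definition hyp_L2 :: "('a::euclidean_space \<Rightarrow> real) set" where
  "hyp_L2 = {f. f \<in> borel_measurable hyp_vol \<and> integrable hyp_vol (\<lambda>x. (f x)\<^sup>2)}"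

definition hyp_dirichlet :: "('a::euclidean_space \<Rightarrow> real) \<Rightarrow> ennreal" where
  "hyp_dirichlet f = (\<integral>\<^sup>+x. ennreal ((hyp_norm x (hyp_grad f x))\<^sup>2) \<partial>hyp_vol)"

text \<open>
  The completion of the test functions in the norm \<open>(\<integral> |\<nabla>u|\<^sup>2 dV)\<^bsup>1/2\<^esup>\<close>.  By the Poincare
  inequality a Cauchy sequence for this norm also converges in \<open>L\<^sup>2\<close>, so the completion is
  realised inside \<open>L\<^sup>2\<close> by taking the \<open>L\<^sup>2\<close>-limits; the gradients then converge to the weak
  gradient of the limit.
\<close>

definition hyp_H1 :: "('a::euclidean_space \<Rightarrow> real) set" where
  "hyp_H1 = {f \<in> hyp_L2. (\<exists>g. has_weak_grad f g) \<and>
     (\<exists>\<phi>. (\<forall>n::nat. \<phi> n \<in> test_functions) \<and>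
        (\<lambda>n. \<integral>\<^sup>+x. ennreal ((\<phi> n x - f x)\<^sup>2) \<partial>hyp_vol) \<longlonglongrightarrow> 0 \<and>
        (\<lambda>n. \<integral>\<^sup>+x. ennreal ((hyp_norm x
               (hyp_raise x (euclid_grad (\<phi> n) x) - hyp_grad f x))\<^sup>2) \<partial>hyp_vol) \<longlonglongrightarrow> 0)}"

definition hyp_H1_norm :: "('a::euclidean_space \<Rightarrow> real) \<Rightarrow> real" where
  "hyp_H1_norm f = sqrt (enn2real (hyp_dirichlet f))"

section \<open>The kernel of the fractional Laplacian\<close>

text \<open>
  Modified Bessel function of the second kind, for \<open>x > 0\<close>, by the integral formula
  \<open>K\<^sub>\<nu>(x) = \<integral>\<^sub>0\<^sup>\<infinity> exp (- x cosh t) cosh (\<nu> t) dt\<close>, which is valid for every real order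
  \<open>\<nu>\<close>, integers included.
\<close>

definition bessel_K :: "real \<Rightarrow> real \<Rightarrow> real" where
  "bessel_K \<nu> x = (LINT t:{0..}|lborel. exp (- x * cosh t) * cosh (\<nu> * t))"

definition kernel_profile :: "nat \<Rightarrow> real \<Rightarrow> real \<Rightarrow> real" where
  "kernel_profile N s r =
     r powr (- ((1 + 2 * s) / 2)) * bessel_K ((1 + 2 * s) / 2) ((real N - 1) / 2 * r)"

text \<open>The operator \<open>- \<partial>\<^sub>r / sinh r\<close>.\<close>

definition sinh_deriv :: "(real \<Rightarrow> real) \<Rightarrow> real \<Rightarrow> real" where
  "sinh_deriv g r = - deriv g r / sinh r"

definition kernel_const :: "nat \<Rightarrow> real \<Rightarrow> real" where
  "kernel_const N s =
     sqrt pi * 2 powr (2 * s) * Gamma ((real N + 2 * s) / 2) /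
       (2 * Gamma (3 / 2) * pi powr (real N / 2) * \<bar>Gamma (- s)\<bar>) *
     (1 / (2 powr ((real N - 2 + 2 * s) / 2) * Gamma ((real N + 2 * s) / 2))) *
     ((real N - 1) / 2) powr ((1 + 2 * s) / 2)"

definition frac_kernel :: "nat \<Rightarrow> real \<Rightarrow> real \<Rightarrow> real" where
  "frac_kernel N s \<rho> =
     (if odd N
      then kernel_const N s * (sinh_deriv ^^ ((N - 1) div 2)) (kernel_profile N s) \<rho>
      else kernel_const N s *
        (LINT r:{\<rho><..}|lborel. sinh r / (sqrt pi * sqrt (cosh r - cosh \<rho>)) *
           (sinh_deriv ^^ (N div 2)) (kernel_profile N s) r))"

section \<open>Fractional Sobolev spaces\<close>

text \<open>The square \<open>[f]\<^sub>s\<^sup>2\<close> of the seminorm, possibly infinite.\<close>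

definition frac_seminorm_sq :: "real \<Rightarrow> ('a::euclidean_space \<Rightarrow> real) \<Rightarrow> ennreal" where
  "frac_seminorm_sq s f = (\<integral>\<^sup>+y. (\<integral>\<^sup>+x.
     ennreal (\<bar>f x - f y\<bar>\<^sup>2 * frac_kernel DIM('a) s (hyp_dist x y)) \<partial>hyp_vol) \<partial>hyp_vol)"

definition hyp_Hs :: "real \<Rightarrow> ('a::euclidean_space \<Rightarrow> real) set" where
  "hyp_Hs s = {f \<in> hyp_L2. frac_seminorm_sq s f < \<infinity>}"

definition hyp_Hs_norm :: "real \<Rightarrow> ('a::euclidean_space \<Rightarrow> real) \<Rightarrow> real" where
  "hyp_Hs_norm s f = sqrt ((\<integral>x. \<bar>f x\<bar>\<^sup>2 \<partial>hyp_vol) + enn2real (frac_seminorm_sq s f))"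

end

theory Submission
  imports Defs "HOL-Complex_Analysis.Complex_Analysis" "HOL-Real_Asymp.Real_Asymp"
begin

text \<open>
  In the variable \<open>u = cosh \<rho>\<close> the operator \<open>- \<partial>\<^sub>\<rho> / sinh \<rho>\<close> is \<open>- d/du\<close>, and the kernel profile
  extends holomorphically to \<open>Re u > 1\<close>; Cauchy's inequality on the disc of radius \<open>(u - 1)/2\<close>
  bounds all iterates at once.  With \<open>q = sinh\<^sup>2 (\<rho>/2) = |x - y|\<^sup>2 / ((1 - |x|\<^sup>2) (1 - |y|\<^sup>2))\<close> the kernel
  is of order at most \<open>q\<^bsup>-(N+2s)/2\<^esup>\<close> for \<open>q \<le> 1/8\<close> and \<open>q\<^bsup>1-N\<^esup> (ln (1 + q))\<^bsup>-1-s\<^esup>\<close> for \<open>q > 1/8\<close>.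

  Near the diagonal the weights at \<open>x\<close>, \<open>y\<close> and all points of the segment between them are comparable,
  so that \<open>|\<phi>(y + h) - \<phi>(y)|\<^sup>2 \<le> |h|\<^sup>2 \<integral>\<^sub>0\<^sup>1 |\<nabla>\<phi>(y + \<tau> h)|\<^sup>2 d\<tau>\<close> and translation invariance of Lebesgue
  measure suffice.  Away from the diagonal the kernel is integrable in \<open>x\<close> uniformly in \<open>y\<close> (polar
  coordinates about \<open>0\<close>; the exponent \<open>-1-s\<close> of the logarithm is what makes the radial integral
  converge), and the Poincare inequality controls the \<open>L\<^sup>2\<close> norm.  This settles test functions;
  Fatou's lemma carries the estimate over to \<open>H\<^sup>1\<close>.
\<close>

section \<open>The Bessel function\<close>

text \<open>All estimates are made for the explicit majorant \<open>kernel_bound\<close>, not for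
  the kernel: passing to it uses only monotonicity of the nonnegative integral, and Tonelli and
  Fatou are then applied to a measurable weight. The threshold 1/8 serves both regions:
  \<open>q \<le> 1/8\<close> forces comparable weights along the segment, because sqrt (1/8) <
  36/100, and \<open>q > 1/8\<close> forces \<open>|x - y|\<close> to be at least a quarter of
  \<open>1 - |x|^2\<close>. Near the diagonal the powers balance: with \<open>W = 1 - |w|^2\<close>
  at an intermediate point, the integral of \<open>|h| powr (2 - N - 2s)\<close> over
  \<open>|h| < 2W\<close> is of order \<open>W powr (2 - 2s)\<close> since s < 1, and the remaining
  factor \<open>W powr (2s - N)\<close> turns it into the Dirichlet weight
  \<open>W powr (2 - N)\<close>. Away from the diagonal the obstacle is uniformity as
  \<open>y\<close> approaches the sphere. On the ray through \<open>\<theta>\<close>, with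
  \<open>v = 1 - t\<close> and \<open>M = |\<theta> - y|\<close>, the logarithmic part is at most a
  constant times \<open>(1 + |ln (v / M)|) powr (-1-s) / v\<close>, whose integral does not depend
  on \<open>M\<close>; the factor left over is a power of \<open>(1 - |y|^2) / M^2\<close>, the
  Poisson kernel of the ball model, whose spherical integral is bounded in \<open>y\<close>.\<close>

text \<open>Covers integrands that are singular at a finite endpoint, as in the Abel integral and,
  near 0, in the logarithmic one.\<close>

lemma nn_integral_FTC_einterval:
  fixes f F :: "real \<Rightarrow> real" and a b :: ereal
  assumes "a < b"
    and F: "\<And>x. a < ereal x \<Longrightarrow> ereal x < b \<Longrightarrow> DERIV F x :> f x"
    and f: "\<And>x. a < ereal x \<Longrightarrow> ereal x < b \<Longrightarrow> isCont f x"
    and nonneg: "\<And>x. a < ereal x \<Longrightarrow> ereal x < b \<Longrightarrow> 0 \<le> f x"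
    and A: "((F \<circ> real_of_ereal) \<longlongrightarrow> A) (at_right a)"
    and B: "((F \<circ> real_of_ereal) \<longlongrightarrow> B) (at_left b)"
  shows "(\<integral>\<^sup>+x. ennreal (f x) * indicator (einterval a b) x \<partial>lborel) = ennreal (B - A)"
proof -
  have int: "set_integrable lborel (einterval a b) f"
    and eq: "(LBINT x=a..b. f x) = B - A"
    using interval_integral_FTC_nonneg[OF assms(1) F f _ A B] nonneg by auto
  have "(\<integral>\<^sup>+x. ennreal (f x) * indicator (einterval a b) x \<partial>lborel)
      = (\<integral>\<^sup>+x. ennreal (indicator (einterval a b) x *\<^sub>R f x) \<partial>lborel)"
    by (intro nn_integral_cong) (auto simp: indicator_def)
  also have "\<dots> = ennreal (\<integral>x. indicator (einterval a b) x *\<^sub>R f x \<partial>lborel)"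
    using int nonneg unfolding set_integrable_def
    by (intro nn_integral_eq_integral) (auto simp: indicator_def einterval_def)
  also have "(\<integral>x. indicator (einterval a b) x *\<^sub>R f x \<partial>lborel) = B - A"
    using eq assms(1) by (simp add: interval_lebesgue_integral_def set_lebesgue_integral_def less_imp_le)
  finally show ?thesis .
qed

definition bessel_integrand :: "real \<Rightarrow> real \<Rightarrow> real \<Rightarrow> real" where
  "bessel_integrand \<nu> x t = exp (- x * cosh t) * cosh (\<nu> * t)"

text \<open>With values in \<open>ennreal\<close> the integral can be bounded before integrability
  is known; the bound then yields integrability.\<close>

definition bessel_nn :: "real \<Rightarrow> real \<Rightarrow> ennreal" where
  "bessel_nn \<nu> x = (\<integral>\<^sup>+t. ennreal (bessel_integrand \<nu> x t) * indicator {0..} t \<partial>lborel)"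

text \<open>The factor \<open>(1 + y powr \<nu>)\<close> squared is the denominator for which the
  Bessel integrand, after \<open>y = x exp t\<close>, gets a majorant with an elementary
  primitive.\<close>

lemma exp_neg_powr_bounded:
  fixes \<nu> :: real assumes "\<nu> > 0"
  shows "\<exists>C>0. \<forall>y>0. exp (- (y/2)) * (1 + y powr \<nu>)\<^sup>2 \<le> C"
proof -
  have "((\<lambda>y. exp (- (y/2)) * (1 + y powr \<nu>)\<^sup>2) \<longlongrightarrow> 0) at_top"
    using assms by real_asymp
  then have "eventually (\<lambda>y. exp (- (y/2)) * (1 + y powr \<nu>)\<^sup>2 < 1) at_top"
    by (rule order_tendstoD) simp
  then obtain Y where Y: "\<And>y. y \<ge> Y \<Longrightarrow> exp (- (y/2)) * (1 + y powr \<nu>)\<^sup>2 < 1"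
    unfolding eventually_at_top_linorder by auto
  define C where "C = 1 + (1 + \<bar>Y\<bar> powr \<nu>)\<^sup>2"
  have "exp (- (y/2)) * (1 + y powr \<nu>)\<^sup>2 \<le> C" if "y > 0" for y
  proof (cases "y \<ge> Y")
    case True
    then show ?thesis using Y[OF True] unfolding C_def by (smt (verit) zero_le_power2)
  next
    case False
    then have "y powr \<nu> \<le> \<bar>Y\<bar> powr \<nu>" using that assms by (intro powr_mono2) auto
    then have "(1 + y powr \<nu>)\<^sup>2 \<le> (1 + \<bar>Y\<bar> powr \<nu>)\<^sup>2" by (intro power_mono) auto
    moreover have "exp (- (y/2)) * (1 + y powr \<nu>)\<^sup>2 \<le> 1 * (1 + y powr \<nu>)\<^sup>2"
      using that by (intro mult_right_mono) auto
    ultimately show ?thesis unfolding C_def by linarith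
  qed
  moreover have "C > 0" unfolding C_def by (smt (verit) zero_le_power2)
  ultimately show ?thesis by blast
qed

lemma cosh_le_exp: "x \<ge> 0 \<Longrightarrow> cosh x \<le> exp (x::real)"
proof -
  assume "x \<ge> 0"
  then have "exp (-x) \<le> exp x" by simp
  then show ?thesis unfolding cosh_def by simp
qed

lemma cosh_ge_half_exp: "cosh x \<ge> exp (x::real) / 2"
  unfolding cosh_def by simp

lemma cosh_ge_square: "cosh x \<ge> 1 + (x::real)\<^sup>2 / 2"
proof -
  have "\<exists>t. \<bar>t\<bar> \<le> \<bar>y\<bar> \<and> exp y = (\<Sum>m<4. y ^ m / fact m) + exp t / fact 4 * y ^ 4" for y :: real
    using Maclaurin_exp_le[of y 4] by auto
  from this[of x] this[of "-x"] obtain s t where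
    "exp x = (\<Sum>m<4. x ^ m / fact m) + exp s / fact 4 * x ^ 4"
    "exp (-x) = (\<Sum>m<4. (-x) ^ m / fact m) + exp t / fact 4 * (-x) ^ 4" by auto
  moreover have "exp s / fact 4 * x ^ 4 \<ge> 0" "exp t / fact 4 * (-x) ^ 4 \<ge> 0" by auto
  ultimately have "exp x + exp (-x) \<ge> (\<Sum>m<4. x ^ m / fact m) + (\<Sum>m<4. (-x) ^ m / fact m)"
    by linarith
  also have "(\<Sum>m<4. x ^ m / fact m) + (\<Sum>m<4. (-x) ^ m / fact m) = 2 + x\<^sup>2"
    by (simp add: eval_nat_numeral field_simps)
  finally show ?thesis unfolding cosh_def by simp
qed

text \<open>With \<open>y = x exp t\<close> one has
  \<open>exp (- x cosh t) \<le> exp (- y / 2)\<close> and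
  \<open>y powr \<nu> = A exp (\<nu> t)\<close>, where \<open>A = x powr \<nu>\<close>. The majorant
  \<open>f\<close> is the derivative of a multiple of \<open>1 / (1 + A exp (\<nu> t))\<close>, so
  its integral is at most \<open>C / (\<nu> A)\<close>, for large \<open>x\<close> as well as for
  small.\<close>

lemma bessel_nn_small:
  fixes \<nu> :: real assumes \<nu>: "\<nu> > 0"
  shows "\<exists>C>0. \<forall>x>0. bessel_nn \<nu> x
    \<le> ennreal (C * x powr (-\<nu>))"
proof -
  obtain C where C: "C > 0" "\<And>y. y > 0 \<Longrightarrow> exp (- (y/2)) * (1 + y powr \<nu>)\<^sup>2 \<le> C"
    using exp_neg_powr_bounded[OF \<nu>] by blast
  have "bessel_nn \<nu> x
    \<le> ennreal (C/\<nu> * x powr (-\<nu>))" if x: "x > 0" for x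
  proof -
    define A where "A = x powr \<nu>"
    have A: "A > 0" using x by (simp add: A_def)
    define f where "f t = C * (exp (\<nu> * t) / (1 + A * exp (\<nu> * t))\<^sup>2)" for t
    define F where "F t = - (C / (\<nu> * A)) * inverse (1 + A * exp (\<nu> * t))" for t
    have pos: "1 + A * exp (\<nu> * t) > 0" for t using A by (simp add: add_pos_pos)
    have "bessel_integrand \<nu> x t \<le> f t" if t: "t \<ge> 0" for t
    proof -
      define y where "y = x * exp t"
      have y: "y > 0" "y powr \<nu> = A * exp (\<nu> * t)"
        using x by (auto simp: y_def A_def powr_mult) (simp add: powr_def)
      have "bessel_integrand \<nu> x t \<le> exp (- (y/2)) * exp (\<nu> * t)"
        unfolding bessel_integrand_def y_def
        using x t \<nu> cosh_ge_half_exp[of t] by (intro mult_mono cosh_le_exp) auto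
      also have "exp (- (y/2)) \<le> C / (1 + A * exp (\<nu> * t))\<^sup>2"
        using C(2)[OF y(1)] pos[of t] y(2) by (simp add: field_simps)
      finally show ?thesis by (simp add: f_def mult_right_mono)
    qed
    then have "bessel_nn \<nu> x
      \<le> (\<integral>\<^sup>+t. ennreal (f t) * indicator {0..} t \<partial>lborel)"
      unfolding bessel_nn_def by (intro nn_integral_mono) (auto simp: indicator_def ennreal_leI)
    also have "\<dots> = ennreal (0 - F 0)"
    proof (rule nn_integral_FTC_atLeast)
      show "f \<in> borel_measurable borel" unfolding f_def by measurable
      show "DERIV F t :> f t" for t
        unfolding F_def f_def using pos[of t] A \<nu>
        by (auto intro!: derivative_eq_intros simp: power2_eq_square inverse_eq_divide less_imp_neq[THEN not_sym])
      show "0 \<le> f t" for t unfolding f_def using C by auto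
      show "(F \<longlongrightarrow> 0) at_top" unfolding F_def using A \<nu> C(1) by real_asymp
    qed
    also have "\<dots> \<le> ennreal (C/\<nu> * x powr (-\<nu>))"
    proof (rule ennreal_leI)
      have "C / (\<nu> * A * (1 + A)) \<le> C / (\<nu> * A)"
        using A C \<nu> by (intro divide_left_mono) auto
      then show "0 - F 0 \<le> C / \<nu> * x powr - \<nu>"
        using x by (simp add: F_def A_def powr_minus field_simps)
    qed
    finally show ?thesis .
  qed
  moreover have "C / \<nu> > 0" using C \<nu> by simp
  ultimately show ?thesis by blast
qed

text \<open>From \<open>cosh t \<ge> 1 + t^2 / 2\<close> a Gaussian factor
  \<open>exp (- x t^2 / 2)\<close> splits off. One half of its exponent absorbs
  \<open>exp (\<nu> t)\<close> by completing the square, at the cost of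
  \<open>exp (\<nu>^2 / x)\<close>, which is where \<open>x\<close> must stay above
  \<open>x\<^sub>0\<close>. The other half is bounded by \<open>1 / (1 + (c t)^2)\<close> with
  \<open>c = sqrt x / 2\<close>, and the arctangent supplies the decay
  \<open>x powr (-1/2)\<close>.\<close>

lemma bessel_nn_large:
  fixes \<nu> x\<^sub>0 :: real assumes \<nu>: "\<nu> > 0" and x0: "x\<^sub>0 > 0"
  shows "\<exists>C>0. \<forall>x\<ge>x\<^sub>0. bessel_nn \<nu> x
    \<le> ennreal (C * x powr (-1/2) * exp (-x))"
proof -
  define D where "D = exp (\<nu>\<^sup>2 / x\<^sub>0)"
  have "bessel_nn \<nu> x
    \<le> ennreal (pi * D * x powr (-1/2) * exp (-x))" if x: "x \<ge> x\<^sub>0" for x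
  proof -
    have xp: "x > 0" using x x0 by simp
    define c where "c = sqrt x / 2"
    have c: "c > 0" "c\<^sup>2 = x / 4" using xp by (auto simp: c_def power_divide)
    define f where "f t = D * exp (-x) * (1 / (1 + (c * t)\<^sup>2))" for t
    define F where "F t = D * exp (-x) * (arctan (c * t) / c)" for t
    have "bessel_integrand \<nu> x t \<le> f t" if t: "t \<ge> 0" for t
    proof -
      have sq: "0 \<le> (x * t / 2 - \<nu>)\<^sup>2" by simp
      have "x * (\<nu> * t - x * t\<^sup>2 / 4) \<le> \<nu>\<^sup>2"
        using sq by (simp add: power2_eq_square algebra_simps)
      then have "\<nu> * t - x * t\<^sup>2 / 4 \<le> \<nu>\<^sup>2 / x" using xp by (simp add: field_simps)
      also have "\<dots> \<le> \<nu>\<^sup>2 / x\<^sub>0" using x x0 by (intro divide_left_mono) auto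
      finally have e1: "\<nu> * t - x * t\<^sup>2 / 4 \<le> \<nu>\<^sup>2 / x\<^sub>0" .
      have e2: "x * cosh t \<ge> x * (1 + t\<^sup>2/2)"
        using cosh_ge_square[of t] xp by (intro mult_left_mono) auto
      have e3: "- x * cosh t + \<nu> * t \<le> \<nu>\<^sup>2 / x\<^sub>0 + (- x) + (- (x * t\<^sup>2 / 4))"
        using e1 e2 by (simp add: algebra_simps)
      have "bessel_integrand \<nu> x t \<le> exp (- x * cosh t) * exp (\<nu> * t)"
        unfolding bessel_integrand_def using \<nu> t by (intro mult_left_mono cosh_le_exp) auto
      also have "\<dots> \<le> exp (\<nu>\<^sup>2 / x\<^sub>0 + (- x) + (- (x * t\<^sup>2 / 4)))"
        using e3 by (simp add: exp_add[symmetric])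
      also have "\<dots> = D * exp (-x) * exp (- (x * t\<^sup>2 / 4))" by (simp only: D_def exp_add)
      also have "exp (- (x * t\<^sup>2 / 4)) = inverse (exp ((c * t)\<^sup>2))"
        using c by (simp add: exp_minus power_mult_distrib)
      also have "\<dots> \<le> 1 / (1 + (c * t)\<^sup>2)"
        using exp_ge_add_one_self[of "(c * t)\<^sup>2"]
        by (simp add: inverse_eq_divide frac_le add_pos_nonneg)
      finally show ?thesis unfolding f_def by (simp add: D_def mult_left_mono)
    qed
    then have "bessel_nn \<nu> x
      \<le> (\<integral>\<^sup>+t. ennreal (f t) * indicator {0..} t \<partial>lborel)"
      unfolding bessel_nn_def by (intro nn_integral_mono) (auto simp: indicator_def ennreal_leI)
    also have "\<dots> = ennreal (D * exp (-x) * ((pi/2) / c) - F 0)"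
    proof (rule nn_integral_FTC_atLeast)
      show "f \<in> borel_measurable borel" unfolding f_def by measurable
      show "DERIV F t :> f t" for t
        unfolding F_def f_def using c
        by (auto intro!: derivative_eq_intros simp: field_simps add_nonneg_eq_0_iff)
      show "0 \<le> f t" for t unfolding f_def D_def by auto
      have "filterlim (\<lambda>t. c * t) at_top at_top"
        using c by real_asymp
      then have "((\<lambda>t. arctan (c * t)) \<longlongrightarrow> pi/2) at_top"
        by (rule filterlim_compose[OF tendsto_arctan_at_top])
      then show "(F \<longlongrightarrow> D * exp (-x) * ((pi/2) / c)) at_top" unfolding F_def
        using c by (intro tendsto_intros) auto
    qed
    also have "\<dots> = ennreal (pi * D * x powr (-1/2) * exp (-x))"
      using xp by (simp add: F_def c_def powr_minus powr_half_sqrt field_simps)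
    finally show ?thesis .
  qed
  moreover have "pi * D > 0" by (simp add: D_def)
  ultimately show ?thesis by blast
qed

lemma bessel_integrand_nonneg: "bessel_integrand \<nu> x t \<ge> 0"
  by (simp add: bessel_integrand_def)

lemma bessel_integrand_measurable [measurable]: "bessel_integrand \<nu> x \<in> borel_measurable borel"
  unfolding bessel_integrand_def by (intro borel_measurable_continuous_onI continuous_intros)

lemma bessel_set_integrable:
  assumes "\<nu> > 0" "x > 0"
  shows "set_integrable lborel {0..} (bessel_integrand \<nu> x)"
  unfolding set_integrable_def
proof (rule integrableI_nonneg)
  obtain C where "\<And>x. x > 0 \<Longrightarrow> bessel_nn \<nu> x
    \<le> ennreal (C * x powr (-\<nu>))" using bessel_nn_small[OF assms(1)] by blast
  from this[OF assms(2)] have "bessel_nn \<nu> x < \<infinity>"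
    by (simp add: order_le_less_trans)
  also have "bessel_nn \<nu> x =
     (\<integral>\<^sup>+t. ennreal (indicator {0..} t *\<^sub>R bessel_integrand \<nu> x t) \<partial>lborel)"
    unfolding bessel_nn_def by (intro nn_integral_cong) (auto simp: indicator_def)
  finally show "(\<integral>\<^sup>+t. ennreal (indicator {0..} t *\<^sub>R bessel_integrand \<nu> x t) \<partial>lborel) < \<infinity>" .
qed (auto simp: bessel_integrand_nonneg)

lemma bessel_K_eq_nn_integral:
  assumes "\<nu> > 0" "x > 0"
  shows "ennreal (bessel_K \<nu> x) = bessel_nn \<nu> x"
proof -
  have "bessel_nn \<nu> x =
     (\<integral>\<^sup>+t. ennreal (indicator {0..} t *\<^sub>R bessel_integrand \<nu> x t) \<partial>lborel)"
    unfolding bessel_nn_def by (intro nn_integral_cong) (auto simp: indicator_def)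
  also have "\<dots> = ennreal (\<integral>t. indicator {0..} t *\<^sub>R bessel_integrand \<nu> x t \<partial>lborel)"
    using bessel_set_integrable[OF assms] unfolding set_integrable_def
    by (intro nn_integral_eq_integral) (auto simp: bessel_integrand_nonneg)
  finally show ?thesis
    by (simp add: bessel_K_def set_lebesgue_integral_def bessel_integrand_def)
qed

lemma bessel_K_nonneg: "bessel_K \<nu> x \<ge> 0"
  unfolding bessel_K_def set_lebesgue_integral_def by (intro integral_nonneg_AE) auto

lemma bessel_K_antimono:
  assumes "\<nu> > 0" "0 < x" "x \<le> y"
  shows "bessel_K \<nu> y \<le> bessel_K \<nu> x"
proof -
  have "ennreal (bessel_K \<nu> y) \<le> ennreal (bessel_K \<nu> x)"
    using assms
    by (simp add: bessel_K_eq_nn_integral bessel_nn_def)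
       (intro nn_integral_mono, auto simp: indicator_def bessel_integrand_def intro!: ennreal_leI)
  then show ?thesis by (simp add: bessel_K_nonneg)
qed

lemma bessel_K_small:
  assumes "\<nu> > 0" shows "\<exists>C>0. \<forall>x>0. bessel_K \<nu> x \<le> C * x powr (-\<nu>)"
proof -
  obtain C where "C > 0" "\<And>x. x > 0 \<Longrightarrow> bessel_nn \<nu> x
    \<le> ennreal (C * x powr (-\<nu>))" using bessel_nn_small[OF assms(1)] by blast
  then have "\<forall>x>0. bessel_K \<nu> x \<le> C * x powr (-\<nu>)"
    using bessel_K_eq_nn_integral[OF assms] by (simp flip: ennreal_le_iff)
  then show ?thesis using \<open>C > 0\<close> by blast
qed

lemma bessel_K_large:
  assumes "\<nu> > 0" "x\<^sub>0 > 0" shows "\<exists>C>0. \<forall>x\<ge>x\<^sub>0. bessel_K \<nu> x \<le> C * x powr (-1/2) * exp (-x)"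
proof -
  obtain C where C: "C > 0" "\<And>x. x \<ge> x\<^sub>0 \<Longrightarrow> bessel_nn \<nu> x
    \<le> ennreal (C * x powr (-1/2) * exp (-x))" using bessel_nn_large[OF assms] by blast
  have "bessel_K \<nu> x \<le> C * x powr (-1/2) * exp (-x)" if "x \<ge> x\<^sub>0" for x
    using bessel_K_eq_nn_integral[OF assms(1), of x] C(2)[OF that] that assms(2) C(1)
    by (simp flip: ennreal_le_iff)
  then show ?thesis using \<open>C > 0\<close> by blast
qed

section \<open>Holomorphic extension of the kernel profile\<close>

lemma cosh_real_gt_1: "x > 0 \<Longrightarrow> cosh (x::real) > 1"
  using cosh_ge_square[of x] by (smt (verit) half_gt_zero zero_less_power)

definition bessel_complex :: "real \<Rightarrow> complex \<Rightarrow> complex" where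
  "bessel_complex \<nu> w = (LINT t:{0..}|lborel. exp (- w * of_real (cosh t)) * of_real (cosh (\<nu> * t)))"

lemma norm_bessel_complex_integrand:
  "norm (exp (- w * of_real (cosh t)) * of_real (cosh (\<nu> * t))) = bessel_integrand \<nu> (Re w) t"
  by (simp add: norm_mult bessel_integrand_def)

lemma bessel_complex_integrand_measurable [measurable]:
  "(\<lambda>t. exp (- w * of_real (cosh t)) * of_real (cosh (\<nu> * t)) :: complex) \<in> borel_measurable borel"
  by (intro borel_measurable_continuous_onI continuous_intros)

lemma bessel_complex_set_integrable:
  assumes "\<nu> > 0" "Re w > 0"
  shows "set_integrable lborel {0..} (\<lambda>t. exp (- w * of_real (cosh t)) * of_real (cosh (\<nu> * t)) :: complex)"
  unfolding set_integrable_def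
proof (rule Bochner_Integration.integrable_bound)
  show "integrable lborel (\<lambda>t. indicator {0..} t *\<^sub>R bessel_integrand \<nu> (Re w) t)"
    using bessel_set_integrable[OF assms] by (simp add: set_integrable_def)
  show "(\<lambda>t. indicator {0..} t *\<^sub>R (exp (- w * of_real (cosh t)) * of_real (cosh (\<nu> * t)) :: complex)) \<in> borel_measurable lborel"
    using borel_measurable_scaleR[OF borel_measurable_indicator[of "{0..}" borel] bessel_complex_integrand_measurable[of w \<nu>]]
    by simp
qed (auto simp: norm_mult bessel_integrand_def)

lemma bessel_complex_of_real: "bessel_complex \<nu> (of_real x) = of_real (bessel_K \<nu> x)"
proof -
  have "bessel_complex \<nu> (of_real x) =
    (LINT t|lborel. complex_of_real (indicator {0..} t *\<^sub>R (exp (- x * cosh t) * cosh (\<nu> * t))))"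
    unfolding bessel_complex_def set_lebesgue_integral_def
    by (intro Bochner_Integration.integral_cong) (auto simp: exp_of_real indicator_def simp flip: of_real_mult of_real_minus)
  then show ?thesis
    unfolding bessel_K_def set_lebesgue_integral_def by (simp only: integral_complex_of_real)
qed

lemma norm_bessel_complex_le:
  assumes "\<nu> > 0" "Re w > 0"
  shows "norm (bessel_complex \<nu> w) \<le> bessel_K \<nu> (Re w)"
proof -
  have "norm (bessel_complex \<nu> w) \<le> (LINT t|lborel. indicator {0..} t *\<^sub>R bessel_integrand \<nu> (Re w) t)"
    unfolding bessel_complex_def set_lebesgue_integral_def
    using bessel_set_integrable[OF assms] bessel_complex_set_integrable[OF assms]
    by (intro Bochner_Integration.integral_norm_bound_integral)
       (auto simp: set_integrable_def norm_mult bessel_integrand_def)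
  also have "\<dots> = bessel_K \<nu> (Re w)"
    by (simp add: bessel_K_def set_lebesgue_integral_def bessel_integrand_def)
  finally show ?thesis .
qed

lemma holomorphic_bessel_truncated:
  "(\<lambda>w. integral {0..real n} (\<lambda>t. exp (- w * of_real (cosh t)) * of_real (cosh (\<nu> * t)) :: complex))
     holomorphic_on UNIV"
proof -
  have "(\<lambda>w. integral (cbox 0 (real n)) (\<lambda>t. exp (- w * of_real (cosh t)) * of_real (cosh (\<nu> * t)) :: complex))
     holomorphic_on UNIV"
  proof (rule leibniz_rule_holomorphic)
    show "((\<lambda>w. exp (- w * of_real (cosh t)) * of_real (cosh (\<nu> * t)) :: complex) has_field_derivative
       (- of_real (cosh t)) * exp (- w * of_real (cosh t)) * of_real (cosh (\<nu> * t))) (at w within UNIV)" for w t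
      by (auto intro!: derivative_eq_intros)
    show "(\<lambda>t. exp (- w * of_real (cosh t)) * of_real (cosh (\<nu> * t)) :: complex) integrable_on cbox 0 (real n)" for w
      by (intro integrable_continuous continuous_intros)
    show "continuous_on (UNIV \<times> cbox 0 (real n)) (\<lambda>(w, t). (- of_real (cosh t)) * exp (- w * of_real (cosh t)) * of_real (cosh (\<nu> * t)) :: complex)"
      unfolding case_prod_unfold by (intro continuous_intros)
  qed auto
  then show ?thesis by simp
qed

text \<open>The integrals over \<open>{0..n}\<close> are entire, by differentiation under the
  integral sign, and converge locally uniformly: the modulus of the integrand depends only on
  \<open>Re w\<close> and decreases in it.\<close>

lemma holomorphic_bessel_complex:
  assumes \<nu>: "\<nu> > 0"
  shows "bessel_complex \<nu> holomorphic_on {w. Re w > 0}"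
proof (rule holomorphic_uniform_sequence)
  let ?h = "\<lambda>w t. exp (- w * of_real (cosh t)) * of_real (cosh (\<nu> * t)) :: complex"
  show "open {w. Re w > 0}" by (rule open_halfspace_Re_gt)
  show "(\<lambda>w. integral {0..real n} (?h w)) holomorphic_on {w. Re w > 0}" for n
    using holomorphic_bessel_truncated by (rule holomorphic_on_subset) auto
  fix z assume z: "z \<in> {w. Re w > 0}"
  define c where "c = Re z / 2"
  have c: "c > 0" using z by (simp add: c_def)
  have Re: "Re w \<ge> c" if "w \<in> cball z c" for w
  proof -
    have "\<bar>Re z - Re w\<bar> \<le> c" using that abs_Re_le_cmod[of "z - w"] by (simp add: dist_norm)
    then show ?thesis unfolding c_def by (simp only: abs_le_iff) argo
  qed
  \<comment> \<open>The tail beyond \<open>n\<close> at the smallest real part \<open>c\<close> on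
    the disc; it bounds the truncation error for all \<open>w\<close> in the disc at once.\<close>
  define b where "b n = (LINT t|lborel. indicator {real n<..} t *\<^sub>R (indicator {0..} t *\<^sub>R bessel_integrand \<nu> c t))" for n
  have int: "integrable lborel (\<lambda>t. indicator {0..} t *\<^sub>R bessel_integrand \<nu> c t)"
    using bessel_set_integrable[OF \<nu> c] by (simp add: set_integrable_def)
  have b0: "b \<longlonglongrightarrow> 0"
  proof -
    have "b \<longlonglongrightarrow> (LINT t|(lborel::real measure). 0)"
      unfolding b_def
    proof (rule integral_dominated_convergence[where w="\<lambda>t. indicator {0..} t *\<^sub>R bessel_integrand \<nu> c t"])
      show "AE t in lborel. (\<lambda>n. indicator {real n<..} t *\<^sub>R (indicator {0..} t *\<^sub>R bessel_integrand \<nu> c t)) \<longlonglongrightarrow> 0"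
      proof (rule AE_I2)
        fix t :: real
        have "eventually (\<lambda>n. indicator {real n<..} t *\<^sub>R (indicator {0..} t *\<^sub>R bessel_integrand \<nu> c t) = 0) sequentially"
          using eventually_ge_at_top[of "nat \<lceil>t\<rceil>"] by eventually_elim (auto simp: indicator_def)
        then show "(\<lambda>n. indicator {real n<..} t *\<^sub>R (indicator {0..} t *\<^sub>R bessel_integrand \<nu> c t)) \<longlonglongrightarrow> 0"
          by (rule tendsto_eventually)
      qed
    qed (use int in \<open>auto simp: bessel_integrand_nonneg split: split_indicator\<close>)
    then show ?thesis by simp
  qed
  have diff: "norm (integral {0..real n} (?h w) - bessel_complex \<nu> w) \<le> b n" if w: "w \<in> cball z c" for w n
  proof -
    have Rw: "Re w \<ge> c" "Re w > 0" using Re[OF w] c by auto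
    have I: "integrable lborel (\<lambda>t. indicator {0..} t *\<^sub>R ?h w t)"
      using bessel_complex_set_integrable[OF \<nu> Rw(2)] by (simp add: set_integrable_def)
    have I1: "integrable lborel (\<lambda>t. indicator {0..real n} t *\<^sub>R ?h w t)"
      by (intro borel_integrable_compact compact_Icc continuous_intros)
    have "integral {0..real n} (?h w) = (LINT t|lborel. indicator {0..real n} t *\<^sub>R ?h w t)"
      using set_borel_integral_eq_integral(2)[of "{0..real n}" "?h w"] I1
      by (simp add: set_integrable_def set_lebesgue_integral_def)
    then have "integral {0..real n} (?h w) - bessel_complex \<nu> w
      = (LINT t|lborel. indicator {0..real n} t *\<^sub>R ?h w t - indicator {0..} t *\<^sub>R ?h w t)"
      using I I1 by (simp add: bessel_complex_def set_lebesgue_integral_def)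
    also have "norm \<dots> \<le> b n"
      unfolding b_def
    proof (rule Bochner_Integration.integral_norm_bound_integral)
      show "integrable lborel (\<lambda>t. indicator {real n<..} t *\<^sub>R (indicator {0..} t *\<^sub>R bessel_integrand \<nu> c t))"
        by (rule Bochner_Integration.integrable_bound[OF int]) (auto simp: bessel_integrand_nonneg split: split_indicator)
      have "norm (?h w t) \<le> bessel_integrand \<nu> c t" for t
        unfolding norm_bessel_complex_integrand bessel_integrand_def using Rw
        by (intro mult_right_mono) auto
      then show "norm (indicator {0..real n} t *\<^sub>R ?h w t - indicator {0..} t *\<^sub>R ?h w t)
        \<le> indicator {real n<..} t *\<^sub>R (indicator {0..} t *\<^sub>R bessel_integrand \<nu> c t)" for t
        by (auto split: split_indicator)
    qed (use I I1 in auto)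
    finally show ?thesis .
  qed
  have "cball z c \<subseteq> {w. Re w > 0}" using Re c by force
  moreover have "uniform_limit (cball z c) (\<lambda>n w. integral {0..real n} (?h w)) (bessel_complex \<nu>) sequentially"
  proof (rule uniform_limitI)
    fix e :: real assume "e > 0"
    with b0 have "\<forall>\<^sub>F n in sequentially. b n < e" by (rule order_tendstoD(2))
    then show "\<forall>\<^sub>F n in sequentially. \<forall>w\<in>cball z c. dist (integral {0..real n} (?h w)) (bessel_complex \<nu> w) < e"
    proof eventually_elim
      case (elim n)
      then show ?case using diff[of _ n] unfolding dist_norm by (meson order_le_less_trans)
    qed
  qed
  ultimately show "\<exists>d>0. cball z d \<subseteq> {w. Re w > 0} \<and>
     uniform_limit (cball z d) (\<lambda>n w. integral {0..real n} (?h w)) (bessel_complex \<nu>) sequentially"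
    using c by blast
qed

text \<open>On \<open>Re z > 1\<close> this is the inverse of \<open>cosh\<close>: the square of the argument of \<open>Ln\<close> is
  \<open>z + sqrt (z - 1) sqrt (z + 1)\<close>.\<close>

definition Arcosh :: "complex \<Rightarrow> complex" where
  "Arcosh z = 2 * Ln ((csqrt (z + 1) + csqrt (z - 1)) / of_real (sqrt 2))"

lemma Re_csqrt_ge:
  assumes "Re z > 0" shows "Re (csqrt z) \<ge> sqrt (Re z)"
proof -
  have "Re z = (Re (csqrt z))\<^sup>2 - (Im (csqrt z))\<^sup>2"
    by (metis Re_power2 power2_csqrt)
  then have "Re z \<le> (Re (csqrt z))\<^sup>2" by (smt (verit) zero_le_power2)
  moreover have "Re (csqrt z) \<ge> 0" by (rule Re_csqrt)
  ultimately show ?thesis by (rule real_le_lsqrt[rotated 1])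
qed

text \<open>The real part of a principal root dominates the root of the real part, because
  \<open>Re z\<close> is the difference of the squares of the real and imaginary parts of the root.
  Since \<open>Re (Ln w) = ln |w|\<close>, a lower bound for \<open>|w|\<close> is enough, whatever
  the argument of \<open>w\<close>.\<close>

lemma Re_Arcosh_ge:
  assumes "Re z > 1"
  shows "Re (Arcosh z) \<ge> 2 * ln ((sqrt (Re z + 1) + sqrt (Re z - 1)) / sqrt 2)"
proof -
  let ?w = "(csqrt (z + 1) + csqrt (z - 1)) / of_real (sqrt 2)"
  have p: "0 < sqrt (Re z + 1) + sqrt (Re z - 1)" using assms by (intro add_pos_pos) auto
  have "sqrt (Re z + 1) + sqrt (Re z - 1) \<le> Re (csqrt (z + 1)) + Re (csqrt (z - 1))"
    using assms by (intro add_mono order.trans[OF _ Re_csqrt_ge]) auto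
  also have "\<dots> \<le> norm (csqrt (z + 1) + csqrt (z - 1))"
    using complex_Re_le_cmod[of "csqrt (z + 1) + csqrt (z - 1)"] by simp
  finally have *: "(sqrt (Re z + 1) + sqrt (Re z - 1)) / sqrt 2 \<le> norm ?w"
    by (simp add: norm_divide divide_right_mono)
  moreover have q: "(sqrt (Re z + 1) + sqrt (Re z - 1)) / sqrt 2 > 0" using p by simp
  ultimately have "norm ?w > 0" by linarith
  then have "?w \<noteq> 0" by auto
  then have "Re (Arcosh z) = 2 * ln (norm ?w)" unfolding Arcosh_def by simp
  with * q show ?thesis by (simp add: ln_mono)
qed

lemma Re_Arcosh_pos: assumes "Re z > 1" shows "Re (Arcosh z) > 0"
proof -
  have "sqrt (Re z + 1) > sqrt 2" "sqrt (Re z - 1) > 0" using assms by auto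
  then have "sqrt 2 < sqrt (Re z + 1) + sqrt (Re z - 1)" by linarith
  then have "(sqrt (Re z + 1) + sqrt (Re z - 1)) / sqrt 2 > 1" by simp
  then show ?thesis using Re_Arcosh_ge[OF assms] by (smt (verit) ln_gt_zero)
qed

text \<open>Both \<open>z + 1\<close> and \<open>z - 1\<close> have positive real part, hence so
  have their roots and the sum of these, which keeps the argument of \<open>Ln\<close> off the
  cut.\<close>

lemma holomorphic_Arcosh: "Arcosh holomorphic_on {z. Re z > 1}"
proof -
  have "(csqrt (z + 1) + csqrt (z - 1)) / of_real (sqrt 2) \<notin> \<real>\<^sub>\<le>\<^sub>0" if "Re z > 1" for z
  proof -
    have "0 < sqrt (Re z + 1)" "0 < sqrt (Re z - 1)" using that by auto
    then have "Re (csqrt (z + 1)) > 0" "Re (csqrt (z - 1)) > 0"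
      using Re_csqrt_ge[of "z+1"] Re_csqrt_ge[of "z-1"] that by auto
    then have "Re ((csqrt (z + 1) + csqrt (z - 1)) / of_real (sqrt 2)) > 0"
      by (simp add: add_pos_pos)
    then show ?thesis by (metis complex_nonpos_Reals_iff not_le)
  qed
  then show ?thesis unfolding Arcosh_def
    by (intro holomorphic_intros) (auto simp: complex_nonpos_Reals_iff)
qed

text \<open>Half-angle formulas: \<open>cosh r + 1\<close> and \<open>cosh r - 1\<close> are twice
  the squares of \<open>cosh (r/2)\<close> and \<open>sinh (r/2)\<close>. This evaluates the
  argument of \<open>Ln\<close> in \<open>Arcosh\<close> on the real axis.\<close>

lemma ln_sqrt_cosh:
  fixes r :: real assumes "r > 0"
  shows "(sqrt (cosh r + 1) + sqrt (cosh r - 1)) / sqrt 2 = exp (r/2)"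
proof -
  have "cosh r = 2 * (cosh (r/2))\<^sup>2 - 1" "cosh r = 1 + 2 * (sinh (r/2))\<^sup>2"
    using cosh_double_cosh[of "r/2"] cosh_square_eq[of "r/2"] by auto
  moreover have "sinh (r/2) \<ge> 0" using assms by simp
  ultimately have s: "sqrt (cosh r + 1) = sqrt 2 * cosh (r/2)" "sqrt (cosh r - 1) = sqrt 2 * sinh (r/2)"
    by (auto simp: real_sqrt_mult)
  have e: "cosh (r/2) + sinh (r/2) = exp (r/2)" by (simp add: cosh_plus_sinh)
  show ?thesis unfolding s e[symmetric] by (simp add: add_divide_distrib)
qed

lemma Arcosh_cosh:
  assumes "r > 0" shows "Arcosh (of_real (cosh r)) = of_real r"
proof -
  have "csqrt (of_real (cosh r) + 1) = of_real (sqrt (cosh r + 1))"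
    "csqrt (of_real (cosh r) - 1) = of_real (sqrt (cosh r - 1))"
    using csqrt_of_real_nonneg[of "cosh r + 1"] csqrt_of_real_nonneg[of "cosh r - 1"]
      cosh_real_ge_1[of r] by auto
  then have "(csqrt (of_real (cosh r) + 1) + csqrt (of_real (cosh r) - 1)) / of_real (sqrt 2)
     = complex_of_real ((sqrt (cosh r + 1) + sqrt (cosh r - 1)) / sqrt 2)"
    by simp
  then have "Arcosh (of_real (cosh r)) = 2 * Ln (of_real (exp (r/2)))"
    unfolding Arcosh_def by (simp only: ln_sqrt_cosh[OF assms])
  also have "\<dots> = of_real r" by (simp add: Ln_of_real)
  finally show ?thesis .
qed

lemma Re_Arcosh_ge_cosh:
  assumes "r > 0" "cosh r \<le> Re z" shows "Re (Arcosh z) \<ge> r"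
proof -
  have c: "cosh r > 1" using assms(1) by (simp add: cosh_real_gt_1)
  have "exp (r/2) \<le> (sqrt (Re z + 1) + sqrt (Re z - 1)) / sqrt 2"
    unfolding ln_sqrt_cosh[OF assms(1), symmetric] using assms c
    by (intro divide_right_mono add_mono) auto
  then have "r/2 \<le> ln ((sqrt (Re z + 1) + sqrt (Re z - 1)) / sqrt 2)"
    by (smt (verit) exp_gt_zero ln_exp ln_mono)
  then show ?thesis using Re_Arcosh_ge[of z] assms c by linarith
qed

section \<open>The profile as a function of cosh r\<close>

definition bessel_profile :: "real \<Rightarrow> real \<Rightarrow> real \<Rightarrow> real" where
  "bessel_profile \<nu> a r = r powr (-\<nu>) * bessel_K \<nu> (a * r)"

text \<open>The profile after the substitution \<open>z = cosh r\<close>. The power is written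
  through \<open>Ln\<close>, which is holomorphic here because \<open>Arcosh\<close> takes values in
  the right half-plane.\<close>

definition bessel_profile_ext :: "real \<Rightarrow> real \<Rightarrow> complex \<Rightarrow> complex" where
  "bessel_profile_ext \<nu> a z = exp (- of_real \<nu> * Ln (Arcosh z)) * bessel_complex \<nu> (of_real a * Arcosh z)"

lemma bessel_profile_nonneg: "bessel_profile \<nu> a r \<ge> 0"
  by (simp add: bessel_profile_def bessel_K_nonneg)

lemma holomorphic_bessel_profile_ext:
  assumes "\<nu> > 0" "a > 0"
  shows "bessel_profile_ext \<nu> a holomorphic_on {z. Re z > 1}"
proof -
  have 1: "Arcosh z \<notin> \<real>\<^sub>\<le>\<^sub>0" if "Re z > 1" for z
    using Re_Arcosh_pos[OF that] by (metis complex_nonpos_Reals_iff not_le)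
  have "(\<lambda>z. of_real a * Arcosh z) holomorphic_on {z. Re z > 1}"
    by (intro holomorphic_intros holomorphic_Arcosh)
  moreover have "(\<lambda>z. of_real a * Arcosh z) ` {z. Re z > 1} \<subseteq> {w. Re w > 0}"
    using Re_Arcosh_pos assms by auto
  ultimately have "(bessel_complex \<nu> \<circ> (\<lambda>z. of_real a * Arcosh z)) holomorphic_on {z. Re z > 1}"
    by (intro holomorphic_on_compose_gen[OF _ holomorphic_bessel_complex[OF assms(1)]])
  then have "(\<lambda>z. bessel_complex \<nu> (of_real a * Arcosh z)) holomorphic_on {z. Re z > 1}"
    by (simp add: o_def)
  moreover have "(\<lambda>z. exp (- of_real \<nu> * Ln (Arcosh z))) holomorphic_on {z. Re z > 1}"
    using 1 by (intro holomorphic_intros holomorphic_Arcosh) auto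
  ultimately show ?thesis unfolding bessel_profile_ext_def
    by (rule holomorphic_on_mult[rotated])
qed

lemma bessel_profile_ext_cosh:
  assumes "r > 0"
  shows "bessel_profile_ext \<nu> a (of_real (cosh r)) = of_real (bessel_profile \<nu> a r)"
proof -
  have "bessel_complex \<nu> (of_real a * of_real r) = of_real (bessel_K \<nu> (a * r))"
    using bessel_complex_of_real[of \<nu> "a * r"] by simp
  moreover have "exp (- of_real \<nu> * Ln (of_real r)) = complex_of_real (r powr (-\<nu>))"
    using assms by (simp add: Ln_of_real powr_def exp_of_real[symmetric])
  ultimately show ?thesis
    by (simp add: bessel_profile_ext_def bessel_profile_def Arcosh_cosh[OF assms])
qed

text \<open>Both factors are controlled by the real part of \<open>Arcosh z\<close>, which is at
  least \<open>r\<close>, and their bounds decrease in it. Thus the supremum over a whole Cauchy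
  circle is replaced by one value of the real profile.\<close>

lemma norm_bessel_profile_ext_le:
  assumes "\<nu> > 0" "a > 0" "r > 0" "cosh r \<le> Re z"
  shows "norm (bessel_profile_ext \<nu> a z) \<le> bessel_profile \<nu> a r"
proof -
  define w where "w = Arcosh z"
  have w: "Re w \<ge> r" using Re_Arcosh_ge_cosh[OF assms(3,4)] by (simp add: w_def)
  then have nz: "w \<noteq> 0" using assms(3) by auto
  have "norm (exp (- of_real \<nu> * Ln w)) = norm w powr (-\<nu>)"
    using nz by (simp add: powr_def)
  also have "\<dots> \<le> r powr (-\<nu>)"
    using w complex_Re_le_cmod[of w] assms by (intro powr_mono2') auto
  finally have 1: "norm (exp (- of_real \<nu> * Ln w)) \<le> r powr (-\<nu>)" .
  have "norm (bessel_complex \<nu> (of_real a * w)) \<le> bessel_K \<nu> (Re (of_real a * w))"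
    using assms w by (intro norm_bessel_complex_le) auto
  also have "\<dots> \<le> bessel_K \<nu> (a * r)"
    using assms w by (intro bessel_K_antimono) auto
  finally have 2: "norm (bessel_complex \<nu> (of_real a * w)) \<le> bessel_K \<nu> (a * r)" .
  show ?thesis unfolding bessel_profile_ext_def bessel_profile_def w_def[symmetric] norm_mult
    by (intro mult_mono 1 2) auto
qed

lemma sinh_deriv_funpow_bessel_profile:
  assumes "\<nu> > 0" "a > 0" "r > 0"
  shows "(sinh_deriv ^^ k) (bessel_profile \<nu> a) r =
    Re ((-1) ^ k * (deriv ^^ k) (bessel_profile_ext \<nu> a) (of_real (cosh r)))"
  using assms(3)
proof (induction k arbitrary: r)
  case 0
  then show ?case by (simp add: bessel_profile_ext_cosh)
next
  case (Suc k)
  let ?F = "(deriv ^^ k) (bessel_profile_ext \<nu> a)"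
  let ?S = "{z. Re z > 1}"
  have S: "open ?S" by (rule open_halfspace_Re_gt)
  have "?F holomorphic_on ?S"
    using holomorphic_bessel_profile_ext[OF assms(1,2)] S by (intro holomorphic_higher_deriv)
  moreover have "of_real (cosh r) \<in> ?S" using Suc.prems by (simp add: cosh_real_gt_1)
  ultimately have F: "(?F has_field_derivative deriv ?F (of_real (cosh r))) (at (of_real (cosh r)))"
    using S holomorphic_derivI by blast
  have c: "((\<lambda>t. complex_of_real (cosh t)) has_vector_derivative of_real (sinh r)) (at r)"
    by (intro has_vector_derivative_of_real)
       (auto simp: has_real_derivative_iff_has_vector_derivative[symmetric] intro!: derivative_eq_intros)
  have "((?F \<circ> (\<lambda>t. complex_of_real (cosh t))) has_vector_derivative of_real (sinh r) * deriv ?F (of_real (cosh r))) (at r)"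
    by (rule field_vector_diff_chain_at[OF c F])
  then have "((\<lambda>t. (-1) ^ k * ?F (of_real (cosh t))) has_vector_derivative
      (-1) ^ k * (of_real (sinh r) * deriv ?F (of_real (cosh r)))) (at r)"
    unfolding o_def by (rule has_vector_derivative_mult_right)
  then have "((\<lambda>t. Re ((-1) ^ k * ?F (of_real (cosh t)))) has_real_derivative
      Re ((-1) ^ k * (of_real (sinh r) * deriv ?F (of_real (cosh r))))) (at r)"
    unfolding has_real_derivative_iff_has_vector_derivative
    by (rule bounded_linear.has_vector_derivative[OF bounded_linear_Re])
  \<comment> \<open>The operator applies \<open>deriv\<close>, so the inductive identity is needed
    in a neighbourhood of \<open>r\<close> and not only at \<open>r\<close>; hence the induction
    with \<open>r\<close> arbitrary.\<close>
  moreover have "\<forall>\<^sub>F t in nhds r. Re ((-1) ^ k * ?F (of_real (cosh t))) = (sinh_deriv ^^ k) (bessel_profile \<nu> a) t"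
    using eventually_nhds_in_open[of "{0<..}" r] Suc.prems
    by (auto elim!: eventually_mono simp: Suc.IH)
  ultimately have "((sinh_deriv ^^ k) (bessel_profile \<nu> a) has_real_derivative
      Re ((-1) ^ k * (of_real (sinh r) * deriv ?F (of_real (cosh r))))) (at r)"
    by (rule DERIV_cong_ev[OF refl _ refl, THEN iffD1, rotated])
  then have "(sinh_deriv ^^ Suc k) (bessel_profile \<nu> a) r =
      - Re ((-1) ^ k * (of_real (sinh r) * deriv ?F (of_real (cosh r)))) / sinh r"
    by (simp add: sinh_deriv_def DERIV_imp_deriv)
  also have "(-1) ^ k * (of_real (sinh r) * deriv ?F (of_real (cosh r)))
     = of_real (sinh r) * ((-1) ^ k * deriv ?F (of_real (cosh r)))" by (simp add: mult_ac)
  also have "Re \<dots> = sinh r * Re ((-1) ^ k * deriv ?F (of_real (cosh r)))"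
    by simp
  finally show ?case using Suc.prems by simp
qed

text \<open>Cauchy's inequality on the disc about \<open>u = cosh r\<close> of radius \<open>(u - 1)/2\<close>.\<close>

lemma sinh_deriv_funpow_bessel_profile_le:
  assumes "\<nu> > 0" "a > 0" "r > 0" "t > 0" "cosh t \<le> (cosh r + 1) / 2"
  shows "\<bar>(sinh_deriv ^^ k) (bessel_profile \<nu> a) r\<bar> \<le>
     fact k * 2 ^ k * bessel_profile \<nu> a t / (cosh r - 1) ^ k"
proof -
  define R where "R = (cosh r - 1) / 2"
  have R: "R > 0" using assms by (simp add: R_def cosh_real_gt_1)
  \<comment> \<open>The leftmost point of the disc is \<open>(cosh r + 1) / 2\<close>, the midpoint
    of 1 and \<open>cosh r\<close>; this is the bound imposed on \<open>cosh t\<close>.\<close>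
  have Re: "Re z \<ge> (cosh r + 1) / 2" if "z \<in> cball (of_real (cosh r)) R" for z
  proof -
    have "\<bar>cosh r - Re z\<bar> \<le> R" using that abs_Re_le_cmod[of "of_real (cosh r) - z"] by (simp add: dist_norm)
    then show ?thesis unfolding R_def abs_le_iff by argo
  qed
  have "cosh r > 1" using assms by (simp add: cosh_real_gt_1)
  then have sub: "cball (of_real (cosh r)) R \<subseteq> {z. Re z > 1}" using Re by force
  have hol: "bessel_profile_ext \<nu> a holomorphic_on cball (of_real (cosh r)) R"
    using holomorphic_bessel_profile_ext[OF assms(1,2)] sub by (rule holomorphic_on_subset)
  have "norm ((deriv ^^ k) (bessel_profile_ext \<nu> a) (of_real (cosh r))) \<le>
     fact k * bessel_profile \<nu> a t / R ^ k"
  proof (rule Cauchy_inequality)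
    show "bessel_profile_ext \<nu> a holomorphic_on ball (of_real (cosh r)) R"
      using hol by (rule holomorphic_on_subset) auto
    show "continuous_on (cball (of_real (cosh r)) R) (bessel_profile_ext \<nu> a)"
      using hol by (rule holomorphic_on_imp_continuous_on)
    show "norm (bessel_profile_ext \<nu> a z) \<le> bessel_profile \<nu> a t" if "norm (of_real (cosh r) - z) = R" for z
      using Re[of z] that assms by (intro norm_bessel_profile_ext_le) (auto simp: dist_norm)
  qed (rule R)
  then have "\<bar>(sinh_deriv ^^ k) (bessel_profile \<nu> a) r\<bar> \<le> fact k * bessel_profile \<nu> a t / R ^ k"
    unfolding sinh_deriv_funpow_bessel_profile[OF assms(1-3)]
    using abs_Re_le_cmod[of "(-1) ^ k * (deriv ^^ k) (bessel_profile_ext \<nu> a) (of_real (cosh r))"]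
    by (simp add: norm_mult norm_power)
  then show ?thesis by (simp add: R_def power_divide mult_ac)
qed

section \<open>Pointwise bounds for the kernel\<close>

lemma kernel_profile_eq: "kernel_profile N s = bessel_profile ((1 + 2 * s) / 2) ((real N - 1) / 2)"
  by (rule ext) (simp add: kernel_profile_def bessel_profile_def)

text \<open>With \<open>b = cosh \<rho> - 1\<close>, the substitution
  \<open>v^2 = (cosh r - cosh \<rho>) / b\<close> turns the integral into \<open>2 / sqrt b\<close>
  times that of \<open>1 / (1 + v^2)\<close> over the half-line.\<close>

lemma nn_integral_abel_sinh:
  fixes \<rho> :: real assumes \<rho>: "\<rho> > 0"
  shows "(\<integral>\<^sup>+r. ennreal (sinh r / ((cosh r - 1) * sqrt (cosh r - cosh \<rho>))) * indicator {\<rho><..} r \<partial>lborel)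
    = ennreal (pi / sqrt (cosh \<rho> - 1))"
proof -
  define b where "b = cosh \<rho> - 1"
  have b: "b > 0" using \<rho> by (simp add: b_def cosh_real_gt_1)
  define F where "F r = 2 / sqrt b * arctan (sqrt ((cosh r - cosh \<rho>) / b))" for r
  have "(\<integral>\<^sup>+r. ennreal (sinh r / ((cosh r - 1) * sqrt (cosh r - cosh \<rho>))) * indicator (einterval \<rho> \<infinity>) r \<partial>lborel)
    = ennreal (2 / sqrt b * (pi / 2) - 0)"
  proof (rule nn_integral_FTC_einterval[where F=F])
    fix r :: real assume "ereal \<rho> < ereal r"
    then have r: "r > \<rho>" by simp
    have c: "cosh r > cosh \<rho>" using r \<rho> by (simp add: cosh_real_strict_mono)
    have c1: "cosh \<rho> > 1" using \<rho> by (simp add: cosh_real_gt_1)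
    have v0: "(cosh r - cosh \<rho>) / b > 0" using c b by simp
    define w where "w = sqrt (cosh r - cosh \<rho>)"
    have w: "w > 0" "w\<^sup>2 = cosh r - cosh \<rho>" using c by (auto simp: w_def)
    define v where "v = sqrt b"
    have v: "v > 0" "v\<^sup>2 = b" using b by (auto simp: v_def)
    have cr: "cosh r - 1 = w\<^sup>2 + v\<^sup>2" using w v by (simp add: b_def)
    have "DERIV F r :> 2 / sqrt b * (inverse (1 + (sqrt ((cosh r - cosh \<rho>) / b))\<^sup>2) *
       (inverse (sqrt ((cosh r - cosh \<rho>) / b)) / 2 * (sinh r / b)))"
      unfolding F_def
    proof (intro DERIV_cmult DERIV_chain2[OF DERIV_arctan] DERIV_chain2[OF DERIV_real_sqrt])
      show "(cosh r - cosh \<rho>) / b > 0" by (rule v0)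
      show "((\<lambda>r. (cosh r - cosh \<rho>) / b) has_real_derivative sinh r / b) (at r)"
        using b by (auto intro!: derivative_eq_intros)
    qed
    also have "2 / sqrt b * (inverse (1 + (sqrt ((cosh r - cosh \<rho>) / b))\<^sup>2) *
       (inverse (sqrt ((cosh r - cosh \<rho>) / b)) / 2 * (sinh r / b))) =
       2 / v * (inverse (1 + (w / v)\<^sup>2) * (inverse (w / v) / 2 * (sinh r / v\<^sup>2)))"
      by (simp add: real_sqrt_divide w_def[symmetric] v_def[symmetric] v)
    also have "\<dots> = sinh r / ((w\<^sup>2 + v\<^sup>2) * w)"
    proof -
      define W where "W = w\<^sup>2 + v\<^sup>2"
      have W: "W > 0" using w(1) by (simp add: W_def add_pos_nonneg)
      have "inverse (1 + (w / v)\<^sup>2) = v\<^sup>2 / W"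
        using w(1) v(1) W by (simp add: W_def field_simps)
      then show ?thesis unfolding W_def[symmetric]
        using w(1) v(1) W by (simp add: power2_eq_square)
    qed
    finally show "DERIV F r :> sinh r / ((cosh r - 1) * sqrt (cosh r - cosh \<rho>))"
      unfolding cr w_def .
    have "cosh r - 1 \<noteq> 0" "\<bar>r\<bar> \<noteq> \<bar>\<rho>\<bar>" using c c1 r \<rho> by auto
    then show "isCont (\<lambda>r. sinh r / ((cosh r - 1) * sqrt (cosh r - cosh \<rho>))) r"
      by (intro continuous_intros) auto
    show "0 \<le> sinh r / ((cosh r - 1) * sqrt (cosh r - cosh \<rho>))"
      using r \<rho> c c1 by auto
  next
    have "isCont F \<rho>" unfolding F_def using b by (intro continuous_intros) auto
    moreover have "F \<rho> = 0" by (simp add: F_def)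
    ultimately have "(F \<longlongrightarrow> 0) (at_right \<rho>)"
      by (metis continuous_within filterlim_at_split isCont_def)
    then show "((F \<circ> real_of_ereal) \<longlongrightarrow> 0) (at_right (ereal \<rho>))"
      by (simp add: ereal_tendsto_simps)
    have "filterlim (cosh :: real \<Rightarrow> real) at_top at_top" by (rule cosh_real_at_top)
    then have "filterlim (\<lambda>r. (1/b) * (- cosh \<rho> + cosh r)) at_top at_top"
      using b by (intro filterlim_tendsto_pos_mult_at_top[OF tendsto_const] filterlim_tendsto_add_at_top[OF tendsto_const]) auto
    then have "filterlim (\<lambda>r. sqrt ((cosh r - cosh \<rho>) / b)) at_top at_top"
      by (intro filterlim_compose[OF sqrt_at_top]) (simp add: field_simps)
    then have "((\<lambda>r. arctan (sqrt ((cosh r - cosh \<rho>) / b))) \<longlongrightarrow> pi / 2) at_top"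
      by (rule filterlim_compose[OF tendsto_arctan_at_top])
    then have "(F \<longlongrightarrow> 2 / sqrt b * (pi / 2)) at_top" unfolding F_def by (intro tendsto_intros)
    then show "((F \<circ> real_of_ereal) \<longlongrightarrow> 2 / sqrt b * (pi / 2)) (at_left \<infinity>)"
      by (simp add: ereal_tendsto_simps)
  qed auto
  moreover have "einterval \<rho> \<infinity> = {\<rho><..}" by (auto simp: einterval_def)
  ultimately show ?thesis by (simp add: b_def)
qed

text \<open>The point \<open>t\<close> is left free so that small and large distances can choose it
  differently. In odd dimension the number of derivatives is exactly \<open>(N - 1) / 2\<close>; in
  even dimension it is larger by 1/2, and the Abel integral gives the surplus half power
  back.\<close>

lemma frac_kernel_le_profile:
  fixes s :: real
  assumes N: "N \<ge> 2" and s: "0 < s"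
  shows "\<exists>C>0. \<forall>\<rho> t. 0 < \<rho> \<longrightarrow> 0 < t \<longrightarrow> cosh t \<le> (cosh \<rho> + 1) / 2 \<longrightarrow>
     frac_kernel N s \<rho> \<le> C * (cosh \<rho> - 1) powr (- ((real N - 1) / 2)) *
       bessel_profile ((1 + 2 * s) / 2) ((real N - 1) / 2) t"
proof -
  define \<nu> where "\<nu> = (1 + 2 * s) / 2"
  define a where "a = (real N - 1) / 2"
  have \<nu>: "\<nu> > 0" using s by (simp add: \<nu>_def)
  have a: "a > 0" using N by (simp add: a_def)
  let ?P = "bessel_profile \<nu> a"
  \<comment> \<open>Taking the absolute value, and \<open>K + 1\<close> below, yields a positive
    constant without evaluating the Gamma factors.\<close>
  define K where "K = \<bar>kernel_const N s\<bar>"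
  show ?thesis
  proof (cases "odd N")
    case True
    define k where "k = (N - 1) div 2"
    have k: "real k = a" using True N by (auto simp: k_def a_def elim!: oddE)
    have "frac_kernel N s \<rho> \<le> ((K + 1) * fact k * 2 ^ k) * (cosh \<rho> - 1) powr (-a) * ?P t"
      if "0 < \<rho>" "0 < t" "cosh t \<le> (cosh \<rho> + 1) / 2" for \<rho> t
    proof -
      have c: "cosh \<rho> - 1 > 0" using that by (simp add: cosh_real_gt_1)
      have pw: "(cosh \<rho> - 1) powr (-a) = 1 / (cosh \<rho> - 1) ^ k"
        using c by (simp add: k[symmetric] powr_minus powr_realpow inverse_eq_divide)
      have "frac_kernel N s \<rho> = kernel_const N s * (sinh_deriv ^^ k) ?P \<rho>"
        using True by (simp add: frac_kernel_def k_def kernel_profile_eq \<nu>_def a_def)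
      also have "\<dots> \<le> \<bar>kernel_const N s\<bar> * \<bar>(sinh_deriv ^^ k) ?P \<rho>\<bar>"
        by (metis abs_ge_self abs_mult)
      also have "\<dots> \<le> (K + 1) * (fact k * 2 ^ k * ?P t / (cosh \<rho> - 1) ^ k)"
        using that \<nu> a by (intro mult_mono sinh_deriv_funpow_bessel_profile_le) (auto simp: K_def)
      finally show ?thesis by (simp add: pw)
    qed
    moreover have "(K + 1) * fact k * 2 ^ k > 0" by (auto simp: K_def intro!: mult_pos_pos)
    ultimately show ?thesis unfolding \<nu>_def a_def by blast
  next
    case False
    define k where "k = N div 2"
    have k: "real k = a + 1/2" "k \<ge> 1" using False N by (auto simp: k_def a_def field_simps elim!: evenE)
    have "frac_kernel N s \<rho> \<le> ((K + 1) * fact k * 2 ^ k * sqrt pi) * (cosh \<rho> - 1) powr (-a) * ?P t"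
      if \<rho>: "0 < \<rho>" and t: "0 < t" "cosh t \<le> (cosh \<rho> + 1) / 2" for \<rho> t
    proof -
      define b where "b = cosh \<rho> - 1"
      have b: "b > 0" using \<rho> by (simp add: b_def cosh_real_gt_1)
      define h where "h r = sinh r / (sqrt pi * sqrt (cosh r - cosh \<rho>)) * (sinh_deriv ^^ k) ?P r" for r
      \<comment> \<open>Of the \<open>k\<close> powers of \<open>1 / (cosh r - 1)\<close> coming
        from Cauchy's inequality, \<open>k - 1\<close> are bounded by their value at
        \<open>\<rho>\<close>; the last one stays under the integral and makes it converge at
        infinity.\<close>
      define M where "M = fact k * 2 ^ k * ?P t / (sqrt pi * b ^ (k - 1))"
      have M: "M \<ge> 0" using b by (simp add: M_def bessel_profile_nonneg)
      have le: "\<bar>h r\<bar> \<le> M * (sinh r / ((cosh r - 1) * sqrt (cosh r - cosh \<rho>)))" if r: "r > \<rho>" for r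
      proof -
        have cr: "cosh r > cosh \<rho>" using r \<rho> by (simp add: cosh_real_strict_mono)
        then have cb: "cosh r - 1 \<ge> b" "cosh r - 1 > 0" using b by (auto simp: b_def)
        have "b ^ (k - 1) * (cosh r - 1) \<le> (cosh r - 1) ^ (k - 1) * (cosh r - 1)"
          using cb b by (intro mult_right_mono power_mono) auto
        also have "\<dots> = (cosh r - 1) ^ k" using k(2) by (metis One_nat_def Suc_pred less_eq_Suc_le power_Suc2)
        finally have pk: "b ^ (k - 1) * (cosh r - 1) \<le> (cosh r - 1) ^ k" .
        have "\<bar>(sinh_deriv ^^ k) ?P r\<bar> \<le> fact k * 2 ^ k * ?P t / (cosh r - 1) ^ k"
          using t r \<rho> cr \<nu> a by (intro sinh_deriv_funpow_bessel_profile_le) auto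
        also have "\<dots> \<le> fact k * 2 ^ k * ?P t / (b ^ (k - 1) * (cosh r - 1))"
          using pk cb b by (intro divide_left_mono) (auto simp: bessel_profile_nonneg)
        finally have D: "\<bar>(sinh_deriv ^^ k) ?P r\<bar> \<le> fact k * 2 ^ k * ?P t / (b ^ (k - 1) * (cosh r - 1))" .
        have "sinh r > 0" using r \<rho> by simp
        then have "\<bar>h r\<bar> = sinh r / (sqrt pi * sqrt (cosh r - cosh \<rho>)) * \<bar>(sinh_deriv ^^ k) ?P r\<bar>"
          unfolding h_def abs_mult using cr by simp
        also have "\<dots> \<le> sinh r / (sqrt pi * sqrt (cosh r - cosh \<rho>)) * (fact k * 2 ^ k * ?P t / (b ^ (k - 1) * (cosh r - 1)))"
          using D \<open>sinh r > 0\<close> cr by (intro mult_left_mono) auto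
        finally show ?thesis by (simp add: M_def mult_ac)
      qed
      \<comment> \<open>A Bochner integral of a non-integrable function is 0 by convention, so the
        bound holds in that case too and integrability of the iterated derivative need not be
        established.\<close>
      have I: "\<bar>LINT r:{\<rho><..}|lborel. h r\<bar> \<le> M * (pi / sqrt b)"
      proof (cases "set_integrable lborel {\<rho><..} h")
        case False
        then have "(LINT r:{\<rho><..}|lborel. h r) = 0"
          unfolding set_lebesgue_integral_def set_integrable_def by (rule not_integrable_integral_eq)
        then show ?thesis using M b by simp
      next
        case True
        have "ennreal (norm (LINT r:{\<rho><..}|lborel. h r)) \<le> (\<integral>\<^sup>+r. ennreal (norm (indicator {\<rho><..} r *\<^sub>R h r)) \<partial>lborel)"
          using True unfolding set_lebesgue_integral_def set_integrable_def
          by (rule integral_norm_bound_ennreal)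
        also have "\<dots> \<le> (\<integral>\<^sup>+r. ennreal M * (ennreal (sinh r / ((cosh r - 1) * sqrt (cosh r - cosh \<rho>))) * indicator {\<rho><..} r) \<partial>lborel)"
          using le M by (intro nn_integral_mono) (auto simp: indicator_def ennreal_mult'[symmetric] intro!: ennreal_leI)
        also have "\<dots> = ennreal M * ennreal (pi / sqrt b)"
        proof (subst nn_integral_cmult)
          have [measurable]: "(sinh :: real \<Rightarrow> real) \<in> borel_measurable borel" "(cosh :: real \<Rightarrow> real) \<in> borel_measurable borel"
            by (auto intro!: borel_measurable_continuous_onI continuous_intros)
          show "(\<lambda>r. ennreal (sinh r / ((cosh r - 1) * sqrt (cosh r - cosh \<rho>))) * indicator {\<rho><..} r) \<in> borel_measurable lborel"
            by measurable
        qed (simp add: nn_integral_abel_sinh[OF \<rho>] b_def)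
        also have "\<dots> = ennreal (M * (pi / sqrt b))" using M b by (simp add: ennreal_mult'[symmetric])
        finally have "norm (LINT r:{\<rho><..}|lborel. h r) \<le> M * (pi / sqrt b)"
          using M b by (simp add: ennreal_le_iff)
        then show ?thesis by simp
      qed
      have "M * (pi / sqrt b) = fact k * 2 ^ k * ?P t * (pi / sqrt pi) / (b ^ (k - 1) * sqrt b)"
        by (simp add: M_def mult_ac)
      also have "pi / sqrt pi = sqrt pi" by (rule real_div_sqrt) simp
      finally have Mv: "M * (pi / sqrt b) = fact k * 2 ^ k * sqrt pi * ?P t / (b ^ (k - 1) * sqrt b)"
        by (simp add: mult_ac)
      have "b ^ (k - 1) * sqrt b = b powr (real (k - 1)) * b powr (1/2)"
        using b by (simp add: powr_realpow powr_half_sqrt)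
      also have "\<dots> = b powr a" using k by (simp add: powr_add[symmetric] of_nat_diff)
      finally have pw: "b powr (-a) = 1 / (b ^ (k - 1) * sqrt b)"
        by (simp add: powr_minus inverse_eq_divide)
      have "frac_kernel N s \<rho> = kernel_const N s * (LINT r:{\<rho><..}|lborel. h r)"
        using False by (simp add: frac_kernel_def k_def kernel_profile_eq \<nu>_def a_def h_def)
      also have "\<dots> \<le> \<bar>kernel_const N s\<bar> * \<bar>LINT r:{\<rho><..}|lborel. h r\<bar>"
        by (metis abs_ge_self abs_mult)
      also have "\<dots> \<le> (K + 1) * (M * (pi / sqrt b))"
        using I by (intro mult_mono) (auto simp: K_def)
      finally show ?thesis unfolding Mv pw b_def[symmetric] by simp
    qed
    moreover have "(K + 1) * fact k * 2 ^ k * sqrt pi > 0" by (auto simp: K_def intro!: mult_pos_pos)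
    ultimately show ?thesis unfolding \<nu>_def a_def by blast
  qed
qed

text \<open>In terms of \<open>q = sinh\<^sup>2 (\<rho>/2)\<close>.\<close>

definition kernel_bound :: "nat \<Rightarrow> real \<Rightarrow> real \<Rightarrow> real" where
  "kernel_bound N s q =
     (if q \<le> 1/8 then q powr (- ((real N + 2 * s) / 2)) else q powr (- (real N - 1)) * ln (1 + q) powr (- 1 - s))"

lemma kernel_bound_nonneg: "kernel_bound N s q \<ge> 0"
  by (simp add: kernel_bound_def)

lemma kernel_bound_measurable [measurable]: "kernel_bound N s \<in> borel_measurable borel"
  unfolding kernel_bound_def by measurable

text \<open>The constraint on \<open>t\<close> reads \<open>cosh t \<le> 1 + q\<close>. For small
  \<open>q\<close> take \<open>t = sqrt q\<close>, as \<open>cosh t \<le> 1 + t^2\<close> for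
  \<open>t \<le> 1\<close>, and the Bessel bound at the origin; the exponents \<open>-a\<close> and
  \<open>-\<nu>\<close> add up to \<open>-(N + 2s) / 2\<close>. For large \<open>q\<close> take
  \<open>t = ln (1 + q)\<close> and the bound at infinity: \<open>exp (- a t)\<close> supplies a
  second \<open>q powr (-a)\<close>, and the powers of \<open>t\<close> combine to
  \<open>-\<nu> - 1/2 = -1 - s\<close>.\<close>

lemma frac_kernel_le:
  fixes s :: real
  assumes N: "N \<ge> 2" and s: "0 < s"
  shows "\<exists>C>0. \<forall>\<rho> q. 0 < \<rho> \<longrightarrow> cosh \<rho> = 1 + 2 * q \<longrightarrow> frac_kernel N s \<rho> \<le> C * kernel_bound N s q"
proof -
  define \<nu> where "\<nu> = (1 + 2 * s) / 2"
  define a where "a = (real N - 1) / 2"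
  have \<nu>: "\<nu> > 0" using s by (simp add: \<nu>_def)
  have a: "a > 0" using N by (simp add: a_def)
  let ?P = "bessel_profile \<nu> a"
  obtain C0 where C0: "C0 > 0" and ker: "\<And>\<rho> t. \<lbrakk>0 < \<rho>; 0 < t; cosh t \<le> (cosh \<rho> + 1) / 2\<rbrakk> \<Longrightarrow>
     frac_kernel N s \<rho> \<le> C0 * (cosh \<rho> - 1) powr (- a) * ?P t"
    using frac_kernel_le_profile[OF assms] unfolding \<nu>_def a_def by metis
  obtain C1 where C1: "C1 > 0" "\<And>x. x > 0 \<Longrightarrow> bessel_K \<nu> x \<le> C1 * x powr (-\<nu>)"
    using bessel_K_small[OF \<nu>] by blast
  \<comment> \<open>The number 9/8 is \<open>1 + q\<close> at the threshold
    \<open>q = 1/8\<close>.\<close>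
  have x0: "a * ln (9/8) > 0" using a by simp
  obtain C2 where C2: "C2 > 0" "\<And>x. x \<ge> a * ln (9/8) \<Longrightarrow> bessel_K \<nu> x \<le> C2 * x powr (-1/2) * exp (-x)"
    using bessel_K_large[OF \<nu> x0] by blast
  define A where "A = C0 * 2 powr (-a) * C1 * a powr (-\<nu>)"
  define B where "B = C0 * 2 powr (-a) * C2 * a powr (-1/2)"
  have AB: "A > 0" "B > 0" using C0 C1 C2 a by (auto simp: A_def B_def)
  have "frac_kernel N s \<rho> \<le> (A + B) * kernel_bound N s q" if \<rho>: "0 < \<rho>" and q: "cosh \<rho> = 1 + 2 * q" for \<rho> q
  proof -
    have q0: "q > 0" using cosh_real_gt_1[OF \<rho>] q by simp
    have c2: "(cosh \<rho> - 1) powr (-a) = 2 powr (-a) * q powr (-a)" using q q0 by (simp add: powr_mult)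
    show ?thesis
    proof (cases "q \<le> 1/8")
      case True
      define t where "t = sqrt q"
      have t: "t > 0" "t\<^sup>2 = q" "t \<le> 1" using q0 True by (auto simp: t_def)
      have "cosh t \<le> 1 + t\<^sup>2"
      proof -
        have "exp t \<le> 1 + t + t\<^sup>2" using t by (intro exp_bound) auto
        moreover have "exp (-t) \<le> 1 - t + t\<^sup>2"
        proof -
          have "(1 - t + t\<^sup>2) * exp t \<ge> (1 - t + t\<^sup>2) * (1 + t)"
            using t by (intro mult_left_mono exp_ge_add_one_self) auto
          moreover have "(1 - t + t\<^sup>2) * (1 + t) = 1 + t ^ 3" by (simp add: algebra_simps power2_eq_square power3_eq_cube)
          ultimately have "(1 - t + t\<^sup>2) * exp t \<ge> 1" using t by (smt (verit) zero_less_power)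
          then show ?thesis by (simp add: exp_minus field_simps)
        qed
        ultimately show ?thesis unfolding cosh_def by simp
      qed
      then have ct: "cosh t \<le> (cosh \<rho> + 1) / 2" using t q by simp
      have "?P t \<le> t powr (-\<nu>) * (C1 * (a * t) powr (-\<nu>))"
        unfolding bessel_profile_def using t a C1 by (intro mult_left_mono) auto
      also have "\<dots> = C1 * a powr (-\<nu>) * (t powr (-\<nu>) * t powr (-\<nu>))" using t a by (simp add: powr_mult)
      also have "t powr (-\<nu>) * t powr (-\<nu>) = q powr (-\<nu>)"
        using t(1) unfolding t(2)[symmetric] by (simp add: power2_eq_square powr_mult)
      finally have P: "?P t \<le> C1 * a powr (-\<nu>) * q powr (-\<nu>)" .
      have "frac_kernel N s \<rho> \<le> C0 * (2 powr (-a) * q powr (-a)) * ?P t"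
        using ker[OF \<rho> t(1) ct] by (simp add: c2)
      also have "\<dots> \<le> C0 * (2 powr (-a) * q powr (-a)) * (C1 * a powr (-\<nu>) * q powr (-\<nu>))"
        using C0 P by (intro mult_left_mono) auto
      also have "\<dots> = A * (q powr (-a) * q powr (-\<nu>))" by (simp add: A_def mult_ac)
      also have "q powr (-a) * q powr (-\<nu>) = kernel_bound N s q"
      proof -
        have "- a + - \<nu> = - ((real N + 2 * s) / 2)" by (simp add: a_def \<nu>_def field_simps)
        then show ?thesis using True by (simp only: kernel_bound_def powr_add[symmetric] if_True)
      qed
      also have "A * kernel_bound N s q \<le> (A + B) * kernel_bound N s q"
        using AB by (intro mult_right_mono kernel_bound_nonneg) auto
      finally show ?thesis .
    next
      case False
      define t where "t = ln (1 + q)"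
      have t: "t > 0" "exp t = 1 + q" using q0 by (auto simp: t_def)
      have tl: "t \<ge> ln (9/8)" using False by (simp add: t_def)
      have "cosh t \<le> 1 + q" using cosh_le_exp[of t] t by simp
      then have ct: "cosh t \<le> (cosh \<rho> + 1) / 2" using q by simp
      have "?P t \<le> t powr (-\<nu>) * (C2 * (a * t) powr (-1/2) * exp (-(a * t)))"
        unfolding bessel_profile_def using t a tl by (intro mult_left_mono C2) auto
      also have "\<dots> = C2 * a powr (-1/2) * (t powr (-\<nu>) * t powr (-1/2)) * exp (-(a * t))" using t a by (simp add: powr_mult)
      also have "t powr (-\<nu>) * t powr (-1/2) = t powr (-1-s)"
      proof -
        have "- \<nu> + - 1 / 2 = - 1 - s" by (simp add: \<nu>_def field_simps)
        then show ?thesis by (simp only: powr_add[symmetric])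
      qed
      also have "exp (-(a * t)) = (1 + q) powr (-a)" using q0 by (simp add: powr_def t_def)
      also have "C2 * a powr (-1/2) * t powr (-1-s) * (1 + q) powr (-a) \<le> C2 * a powr (-1/2) * t powr (-1-s) * q powr (-a)"
        using C2 a q0 by (intro mult_left_mono powr_mono2') auto
      finally have P: "?P t \<le> C2 * a powr (-1/2) * t powr (-1-s) * q powr (-a)" .
      have "frac_kernel N s \<rho> \<le> C0 * (2 powr (-a) * q powr (-a)) * ?P t"
        using ker[OF \<rho> t(1) ct] by (simp add: c2)
      also have "\<dots> \<le> C0 * (2 powr (-a) * q powr (-a)) * (C2 * a powr (-1/2) * t powr (-1-s) * q powr (-a))"
        using C0 P by (intro mult_left_mono) auto
      also have "\<dots> = B * ((q powr (-a) * q powr (-a)) * t powr (-1-s))" by (simp add: B_def mult_ac)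
      also have "q powr (-a) * q powr (-a) = q powr (- (real N - 1))"
      proof -
        have "- a + - a = - (real N - 1)" by (simp add: a_def field_simps)
        then show ?thesis by (simp only: powr_add[symmetric])
      qed
      also have "q powr (- (real N - 1)) * t powr (-1-s) = kernel_bound N s q"
        using False by (simp add: kernel_bound_def t_def)
      also have "B * kernel_bound N s q \<le> (A + B) * kernel_bound N s q"
        using AB by (intro mult_right_mono kernel_bound_nonneg) auto
      finally show ?thesis .
    qed
  qed
  moreover have "A + B > 0" using AB by simp
  ultimately show ?thesis by blast
qed

section \<open>Polar coordinates\<close>

lemma sets_borel_ball [measurable]: "ball (x::'a::metric_space) r \<in> sets borel"
  by simp

lemma nn_integral_lborel_affine:
  fixes c :: real and t :: "'a::euclidean_space"
  assumes [measurable]: "f \<in> borel_measurable borel" and "c \<noteq> 0"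
  shows "(\<integral>\<^sup>+x. f x \<partial>lborel) = ennreal (\<bar>c\<bar> ^ DIM('a)) * (\<integral>\<^sup>+x. f (t + c *\<^sub>R x) \<partial>lborel)"
  by (subst lborel_affine[OF assms(2), of t])
     (simp add: nn_integral_density nn_integral_distr nn_integral_cmult)

lemma nn_integral_lborel_translation:
  fixes t :: "'a::euclidean_space"
  assumes "f \<in> borel_measurable borel"
  shows "(\<integral>\<^sup>+x. f (t + x) \<partial>lborel) = (\<integral>\<^sup>+x. f x \<partial>lborel)"
  using nn_integral_lborel_affine[OF assms, of 1 t] by simp

lemma nn_integral_powr_atLeast:
  fixes p c :: real assumes "p > 0" "c > 0"
  shows "(\<integral>\<^sup>+t. ennreal (t powr (-1-p)) * indicator {c..} t \<partial>lborel) = ennreal (c powr (-p) / p)"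
proof -
  have "(\<integral>\<^sup>+t. ennreal (t powr (-1-p)) * indicator {c..} t \<partial>lborel) = ennreal (0 - (- (c powr (-p) / p)))"
  proof (rule nn_integral_FTC_atLeast)
    show "((\<lambda>t. - (t powr (-p) / p)) has_real_derivative t powr (-1-p)) (at t)" if "c \<le> t" for t
    proof -
      have e: "-1 - p = -p - 1" by simp
      show ?thesis unfolding e using assms that by (auto intro!: derivative_eq_intros)
    qed
    show "((\<lambda>t. - (t powr (-p) / p)) \<longlongrightarrow> 0) at_top" using assms by real_asymp
  qed auto
  then show ?thesis by simp
qed

lemma nn_integral_powr_atMost:
  fixes p c :: real assumes "p > 0" "c > 0"
  shows "(\<integral>\<^sup>+t. ennreal (t powr (p-1)) * indicator {0<..<c} t \<partial>lborel) = ennreal (c powr p / p)"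
proof -
  have "(\<integral>\<^sup>+t. ennreal (t powr (p-1)) * indicator (einterval 0 c) t \<partial>lborel) = ennreal (c powr p / p - 0)"
  proof (rule nn_integral_FTC_einterval)
    fix t assume "0 < ereal t" then have t: "t > 0" by simp
    show "((\<lambda>t. t powr p / p) has_real_derivative t powr (p-1)) (at t)"
      using assms t by (auto intro!: derivative_eq_intros)
    show "isCont (\<lambda>t. t powr (p-1)) t" using t by (intro continuous_intros) auto
  next
    have "((\<lambda>t. t powr p / p) \<longlongrightarrow> 0) (at_right 0)" using assms by real_asymp
    then show "(((\<lambda>t. t powr p / p) \<circ> real_of_ereal) \<longlongrightarrow> 0) (at_right 0)"
      by (simp add: ereal_tendsto_simps zero_ereal_def)
    have "((\<lambda>t. t powr p / p) \<longlongrightarrow> c powr p / p) (at_left c)"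
      using assms by (intro tendsto_intros) auto
    then show "(((\<lambda>t. t powr p / p) \<circ> real_of_ereal) \<longlongrightarrow> c powr p / p) (at_left (ereal c))"
      by (simp add: ereal_tendsto_simps)
  qed (use assms in auto)
  moreover have "einterval 0 (ereal c) = {0<..<c}" by (auto simp: einterval_def)
  ultimately show ?thesis by simp
qed

text \<open>Both sides integrate \<open>F (\<tau> z) N \<tau>\<^sup>N\<^sup>-\<^sup>1 |z|\<^sup>N\<close> over \<open>|z| < 1\<close> and \<open>\<tau> > 0\<close>, in the two possible orders.\<close>

lemma nn_integral_polar_scaled:
  fixes F :: "'a::euclidean_space \<Rightarrow> ennreal"
  assumes [measurable]: "F \<in> borel_measurable borel"
  shows "(\<integral>\<^sup>+x. F x \<partial>lborel) = (\<integral>\<^sup>+z. indicator (ball 0 1) z * ennreal (norm z ^ DIM('a)) *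
     (\<integral>\<^sup>+\<tau>. F (\<tau> *\<^sub>R z) * ennreal (DIM('a) * \<tau> ^ (DIM('a) - 1)) * indicator {0<..} \<tau> \<partial>lborel) \<partial>lborel)"
proof -
  let ?N = "DIM('a)"
  let ?L = "\<lambda>z (\<tau>::real). indicator (ball 0 1) z * ennreal (norm z ^ ?N) *
    (F (\<tau> *\<^sub>R z) * ennreal (?N * \<tau> ^ (?N - 1)) * indicator {0<..} \<tau>)"
  let ?G = "\<lambda>(\<tau>::real) x. F x * ennreal (norm x ^ ?N) *
    (ennreal (?N * \<tau> powr (-1 - ?N)) * (if norm x < \<tau> then 1 else 0))"
  have N: "?N \<ge> 1" by simp
  have "(\<integral>\<^sup>+z. indicator (ball 0 1) z * ennreal (norm z ^ ?N) *
     (\<integral>\<^sup>+\<tau>. F (\<tau> *\<^sub>R z) * ennreal (?N * \<tau> ^ (?N - 1)) * indicator {0<..} \<tau> \<partial>lborel) \<partial>lborel)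
   = (\<integral>\<^sup>+z. (\<integral>\<^sup>+\<tau>. ?L z \<tau> \<partial>lborel) \<partial>lborel)"
    by (intro nn_integral_cong nn_integral_cmult[symmetric]) measurable
  also have "\<dots> = (\<integral>\<^sup>+\<tau>. (\<integral>\<^sup>+z. ?L z \<tau> \<partial>lborel) \<partial>lborel)"
    by (rule lborel_pair.Fubini') measurable
  also have "\<dots> = (\<integral>\<^sup>+\<tau>. (\<integral>\<^sup>+x. ?G \<tau> x \<partial>lborel) \<partial>lborel)"
  proof (rule nn_integral_cong)
    fix \<tau> :: real
    show "(\<integral>\<^sup>+z. ?L z \<tau> \<partial>lborel)
     = (\<integral>\<^sup>+x. ?G \<tau> x \<partial>lborel)"
    proof (cases "\<tau> > 0")
      case False
      then have "\<not> norm x < \<tau>" for x :: 'a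
        using norm_ge_zero[of x] by linarith
      then show ?thesis using False by simp
    next
      case True
      \<comment> \<open>The substitution \<open>x = \<tau> z\<close> contributes the Jacobian
        \<open>\<tau>^N\<close> and turns \<open>|z| < 1\<close> into
        \<open>|x| < \<tau>\<close>.\<close>
      define G where "G x = ?G \<tau> x" for x
      have "G \<in> borel_measurable borel" unfolding G_def by measurable
      then have "(\<integral>\<^sup>+x. G x \<partial>lborel) = ennreal (\<bar>\<tau>\<bar> ^ ?N) * (\<integral>\<^sup>+z. G (0 + \<tau> *\<^sub>R z) \<partial>lborel)"
        using True by (intro nn_integral_lborel_affine) auto
      also have "\<dots> = (\<integral>\<^sup>+z. ennreal (\<bar>\<tau>\<bar> ^ ?N) * (?G \<tau> (0 + \<tau> *\<^sub>R z)) \<partial>lborel)"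
        unfolding G_def by (rule nn_integral_cmult[symmetric]) measurable
      also have "\<dots> = (\<integral>\<^sup>+z. ?L z \<tau> \<partial>lborel)"
      proof (rule nn_integral_cong)
        fix z :: 'a
        have i: "(if norm (0 + \<tau> *\<^sub>R z) < \<tau> then 1 else 0) = (indicator (ball 0 1) z :: ennreal)"
          using True by (auto simp: indicator_def)
        have "\<tau> ^ ?N * (norm (\<tau> *\<^sub>R z) ^ ?N * (?N * \<tau> powr (-1 - ?N))) = norm z ^ ?N * (?N * \<tau> ^ (?N - 1))"
        proof -
          have "\<tau> powr (-1 - ?N) = inverse (\<tau> ^ Suc ?N)"
            using True by (simp add: powr_realpow[symmetric] powr_minus[symmetric] del: power_Suc)
          moreover have "\<tau> ^ ?N = \<tau> * \<tau> ^ (?N - 1)" using N by (metis Suc_pred' le_simps(3) One_nat_def power_Suc)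
          ultimately show ?thesis using True by (simp add: power_mult_distrib field_simps)
        qed
        then have e: "ennreal (\<tau> ^ ?N) * (ennreal (norm (\<tau> *\<^sub>R z) ^ ?N) * ennreal (?N * \<tau> powr (-1 - ?N)))
           = ennreal (norm z ^ ?N) * ennreal (?N * \<tau> ^ (?N - 1))"
          using True by (simp add: ennreal_mult'[symmetric])
        have "ennreal (\<bar>\<tau>\<bar> ^ ?N) * (?G \<tau> (0 + \<tau> *\<^sub>R z))
          = indicator (ball 0 1) z * F (\<tau> *\<^sub>R z) * (ennreal (\<tau> ^ ?N) * (ennreal (norm (\<tau> *\<^sub>R z) ^ ?N) * ennreal (?N * \<tau> powr (-1 - ?N))))"
          unfolding i using True by (simp only: add_0_left abs_of_pos mult_ac)
        also have "\<dots> = ?L z \<tau>"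
          unfolding e using True by (simp add: mult_ac)
        finally show "ennreal (\<bar>\<tau>\<bar> ^ ?N) * (?G \<tau> (0 + \<tau> *\<^sub>R z))
          = ?L z \<tau>" .
      qed
      finally show ?thesis unfolding G_def by simp
    qed
  qed
  also have "\<dots> = (\<integral>\<^sup>+x. (\<integral>\<^sup>+\<tau>. ?G \<tau> x \<partial>lborel) \<partial>lborel)"
    by (rule lborel_pair.Fubini') measurable
  also have "\<dots> = (\<integral>\<^sup>+x. F x \<partial>lborel)"
  proof (rule nn_integral_cong_AE)
    have "AE x in lborel. x \<noteq> (0::'a)" by (rule AE_lborel_singleton)
    then show "AE x in lborel. (\<integral>\<^sup>+\<tau>. ?G \<tau> x \<partial>lborel) = F x"
    proof eventually_elim
      fix x :: 'a assume x: "x \<noteq> 0"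
      have "(\<integral>\<^sup>+\<tau>. ?G \<tau> x \<partial>lborel)
        = F x * ennreal (norm x ^ ?N) * (\<integral>\<^sup>+\<tau>. (ennreal (?N * \<tau> powr (-1 - ?N)) * (if norm x < \<tau> then 1 else 0)) \<partial>lborel)"
        by (rule nn_integral_cmult) measurable
      \<comment> \<open>The ranges \<open>|x| < \<tau>\<close> and \<open>|x| \<le> \<tau>\<close>
        differ by one point. The integral over \<open>\<tau>\<close> is
        \<open>|x| powr (-N)\<close>, which cancels the factor \<open>|x|^N\<close>.\<close>
      also have "(\<integral>\<^sup>+\<tau>. (ennreal (?N * \<tau> powr (-1 - ?N)) * (if norm x < \<tau> then 1 else 0)) \<partial>lborel)
        = (\<integral>\<^sup>+\<tau>. ennreal ?N * (ennreal (\<tau> powr (-1 - ?N)) * indicator {norm x..} \<tau>) \<partial>lborel)"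
        by (intro nn_integral_cong_AE eventually_mono[OF AE_lborel_singleton[of "norm x"]])
           (auto simp: indicator_def ennreal_mult')
      also have "\<dots> = ennreal ?N * ennreal (norm x powr (-?N) / ?N)"
        using x by (subst nn_integral_cmult) (auto simp: nn_integral_powr_atLeast)
      also have "\<dots> = ennreal (norm x powr (-?N))" by (simp add: ennreal_mult'[symmetric])
      also have "F x * ennreal (norm x ^ ?N) * \<dots> = F x * ennreal (norm x ^ ?N * norm x powr (-?N))"
        by (simp add: ennreal_mult' mult.assoc)
      also have "norm x ^ ?N * norm x powr (-?N) = 1"
        using x by (simp add: powr_minus powr_realpow)
      finally show "(\<integral>\<^sup>+\<tau>. ?G \<tau> x \<partial>lborel) = F x" by simp
    qed
  qed
  finally show ?thesis by simp
qed

text \<open>Directions are sampled by \<open>sgn z\<close> for \<open>z\<close> in the solid ball,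
  which stands in for the surface measure of the sphere. The substitution
  \<open>t = |z| \<tau>\<close> in the radial integral absorbs the factor \<open>|z|^N\<close> of
  the scaled form.\<close>

lemma nn_integral_polar:
  fixes F :: "'a::euclidean_space \<Rightarrow> ennreal"
  assumes [measurable]: "F \<in> borel_measurable borel"
  shows "(\<integral>\<^sup>+x. F x \<partial>lborel) = (\<integral>\<^sup>+z. indicator (ball 0 1) z *
     (\<integral>\<^sup>+t. F (t *\<^sub>R sgn z) * ennreal (DIM('a) * t ^ (DIM('a) - 1)) * indicator {0<..} t \<partial>lborel) \<partial>lborel)"
proof -
  let ?N = "DIM('a)"
  let ?S = "\<lambda>z (t::real). F (t *\<^sub>R sgn z) * ennreal (?N * t ^ (?N - 1)) * indicator {0<..} t"
  let ?P = "\<lambda>z (\<tau>::real). F (\<tau> *\<^sub>R z) * ennreal (?N * \<tau> ^ (?N - 1)) * indicator {0<..} \<tau>"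
  have N: "?N \<ge> 1" by simp
  show ?thesis
  proof (subst nn_integral_polar_scaled[OF assms], rule nn_integral_cong_AE)
    have "AE z in lborel. z \<noteq> (0::'a)" by (rule AE_lborel_singleton)
    then show "AE z in lborel. indicator (ball 0 1) z * ennreal (norm z ^ ?N) *
       (\<integral>\<^sup>+\<tau>. ?P z \<tau> \<partial>lborel) =
       indicator (ball 0 1) z * (\<integral>\<^sup>+t. ?S z t \<partial>lborel)"
    proof eventually_elim
      fix z :: 'a assume z: "z \<noteq> 0"
      have "(\<integral>\<^sup>+t. ?S z t \<partial>lborel)
        = ennreal \<bar>norm z\<bar> * (\<integral>\<^sup>+\<tau>. ?S z (0 + norm z * \<tau>) \<partial>lborel)"
        using z by (intro nn_integral_real_affine) auto
      also have "\<dots> = (\<integral>\<^sup>+\<tau>. ennreal \<bar>norm z\<bar> * (?S z (0 + norm z * \<tau>)) \<partial>lborel)"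
        by (intro nn_integral_cmult[symmetric]) measurable
      also have "\<dots> = (\<integral>\<^sup>+\<tau>. ennreal (norm z ^ ?N) * (?P z \<tau>) \<partial>lborel)"
      proof (rule nn_integral_cong)
        fix \<tau> :: real
        have i: "indicator {0<..} (0 + norm z * \<tau>) = (indicator {0<..} \<tau> :: ennreal)"
          using z by (auto simp: indicator_def zero_less_mult_iff)
        have sg: "(0 + norm z * \<tau>) *\<^sub>R sgn z = \<tau> *\<^sub>R z" using z by (simp add: sgn_div_norm)
        have pw: "norm z * (?N * (0 + norm z * \<tau>) ^ (?N - 1)) = norm z ^ ?N * (?N * \<tau> ^ (?N - 1))"
        proof -
          have "norm z ^ ?N = norm z * norm z ^ (?N - 1)" using N by (metis Suc_pred' le_simps(3) One_nat_def power_Suc)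
          then show ?thesis by (simp add: power_mult_distrib)
        qed
        have "ennreal \<bar>norm z\<bar> * (?S z (0 + norm z * \<tau>))
          = F (\<tau> *\<^sub>R z) * ennreal (norm z * (?N * (0 + norm z * \<tau>) ^ (?N - 1))) * indicator {0<..} \<tau>"
          unfolding i sg by (simp add: ennreal_mult' mult_ac)
        also have "\<dots> = ennreal (norm z ^ ?N) * (?P z \<tau>)"
          unfolding pw by (simp add: ennreal_mult' mult_ac)
        finally show "ennreal \<bar>norm z\<bar> * (?S z (0 + norm z * \<tau>))
          = ennreal (norm z ^ ?N) * (?P z \<tau>)" .
      qed
      also have "\<dots> = ennreal (norm z ^ ?N) * (\<integral>\<^sup>+\<tau>. (?P z \<tau>) \<partial>lborel)"
        by (intro nn_integral_cmult) measurable
      finally show "indicator (ball 0 1) z * ennreal (norm z ^ ?N) *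
       (\<integral>\<^sup>+\<tau>. ?P z \<tau> \<partial>lborel) =
       indicator (ball 0 1) z * (\<integral>\<^sup>+t. ?S z t \<partial>lborel)"
        by (simp add: mult.assoc)
    qed
  qed
qed

lemma nn_integral_radial:
  fixes G :: "real \<Rightarrow> ennreal"
  assumes [measurable]: "G \<in> borel_measurable borel"
  shows "(\<integral>\<^sup>+x. G (norm (x::'a::euclidean_space)) \<partial>lborel) = ennreal (DIM('a) * measure lborel (ball (0::'a) 1)) *
    (\<integral>\<^sup>+t. G t * ennreal (t ^ (DIM('a) - 1)) * indicator {0<..} t \<partial>lborel)"
    (is "_ = ennreal (_ * ?V) * ?I")
proof -
  let ?N = "DIM('a)"
  have inner: "(\<integral>\<^sup>+t. G (norm (t *\<^sub>R sgn z)) * ennreal (?N * t ^ (?N - 1)) * indicator {0<..} t \<partial>lborel) = ennreal ?N * ?I"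
    if "z \<noteq> 0" for z :: 'a
    using that by (subst nn_integral_cmult[symmetric], measurable, intro nn_integral_cong)
      (auto simp: indicator_def norm_sgn ennreal_mult' mult_ac)
  have "(\<integral>\<^sup>+x. G (norm (x::'a)) \<partial>lborel) = (\<integral>\<^sup>+z. indicator (ball (0::'a) 1) z *
    (\<integral>\<^sup>+t. G (norm (t *\<^sub>R sgn z)) * ennreal (?N * t ^ (?N - 1)) * indicator {0<..} t \<partial>lborel) \<partial>lborel)"
    by (rule nn_integral_polar) measurable
  also have "\<dots> = (\<integral>\<^sup>+z. (ennreal ?N * ?I) * indicator (ball (0::'a) 1) z \<partial>lborel)"
    by (intro nn_integral_cong_AE eventually_mono[OF AE_lborel_singleton[of 0]])
       (subst inner, assumption, simp only: mult.commute)
  also have "\<dots> = (ennreal ?N * ?I) * emeasure lborel (ball (0::'a) 1)"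
    by (subst nn_integral_cmult_indicator) auto
  also have "emeasure lborel (ball (0::'a) 1) = ennreal ?V"
    using emeasure_lborel_ball_finite[of "0::'a" 1] by (intro emeasure_eq_ennreal_measure) auto
  finally show ?thesis by (simp add: ennreal_mult' mult_ac)
qed

lemma nn_integral_norm_powr_ball:
  fixes p R :: real assumes p: "p < DIM('a::euclidean_space)" and R: "R > 0"
  shows "(\<integral>\<^sup>+x. ennreal (norm x powr (-p)) * indicator (ball (0::'a) R) x \<partial>lborel) =
    ennreal (DIM('a) / (DIM('a) - p) * measure lborel (ball (0::'a) 1) * R powr (DIM('a) - p))"
proof -
  let ?N = "DIM('a)"
  define G where "G t = ennreal (t powr (-p)) * indicator {..<R} t" for t
  have "t powr (-p) * t ^ (?N - 1) = t powr ((?N - p) - 1)" if "t > 0" for t :: real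
    using that by (simp add: powr_realpow[symmetric] powr_add[symmetric] of_nat_diff algebra_simps)
  then have "(\<integral>\<^sup>+t. G t * ennreal (t ^ (?N - 1)) * indicator {0<..} t \<partial>lborel) = ennreal (R powr (?N - p) / (?N - p))"
    using p R by (subst nn_integral_powr_atMost[symmetric], simp, simp, intro nn_integral_cong)
      (auto simp: G_def indicator_def ennreal_mult'[symmetric])
  moreover have "G \<in> borel_measurable borel" unfolding G_def by measurable
  moreover have "indicator (ball (0::'a) R) x = (indicator {..<R} (norm x) :: ennreal)" for x
    by (simp add: indicator_def)
  ultimately show ?thesis
    using nn_integral_radial[of G, where 'a='a] p by (simp add: G_def ennreal_mult'[symmetric] mult_ac)
qed

lemma nn_integral_norm_powr_outside:
  fixes p R :: real assumes p: "p > DIM('a::euclidean_space)" and R: "R > 0"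
  shows "(\<integral>\<^sup>+x. ennreal (norm x powr (-p)) * indicator (- ball (0::'a) R) x \<partial>lborel) =
    ennreal (DIM('a) / (p - DIM('a)) * measure lborel (ball (0::'a) 1) * R powr (DIM('a) - p))"
proof -
  let ?N = "DIM('a)"
  define G where "G t = ennreal (t powr (-p)) * indicator {R..} t" for t
  have "t powr (-p) * t ^ (?N - 1) = t powr (- 1 - (p - ?N))" if "t > 0" for t :: real
    using that by (simp add: powr_realpow[symmetric] powr_add[symmetric] of_nat_diff algebra_simps)
  then have "(\<integral>\<^sup>+t. G t * ennreal (t ^ (?N - 1)) * indicator {0<..} t \<partial>lborel) = ennreal (R powr (-(p - ?N)) / (p - ?N))"
    using p R by (subst nn_integral_powr_atLeast[symmetric], simp, simp, intro nn_integral_cong)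
      (auto simp: G_def indicator_def ennreal_mult'[symmetric])
  moreover have "G \<in> borel_measurable borel" unfolding G_def by measurable
  moreover have "indicator (- ball (0::'a) R) x = (indicator {R..} (norm x) :: ennreal)" for x
    by (auto simp: indicator_def)
  ultimately show ?thesis
    using nn_integral_radial[of G, where 'a='a] p by (simp add: G_def ennreal_mult'[symmetric] mult_ac)
qed

section \<open>The kernel away from the diagonal\<close>

definition hyp_q :: "'a::euclidean_space \<Rightarrow> 'a \<Rightarrow> real" where
  "hyp_q x y = (norm (x - y))\<^sup>2 / ((1 - (norm x)\<^sup>2) * (1 - (norm y)\<^sup>2))"

lemma hyp_q_measurable [measurable (raw)]:
  assumes [measurable]: "f \<in> borel_measurable M" "g \<in> borel_measurable M"
  shows "(\<lambda>x. hyp_q (f x) (g x)) \<in> borel_measurable M"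
  unfolding hyp_q_def by measurable

lemma one_minus_norm_sq_pos: "x \<in> ball 0 1 \<Longrightarrow> 1 - (norm x)\<^sup>2 > 0"
  by (simp add: power_less_one_iff)

text \<open>For \<open>n = |y - x|^2\<close> the denominator \<open>D\<close> of
  \<open>hyp_T x y\<close> equals \<open>n + (1 - |x|^2) (1 - |y|^2)\<close>, and the squared norm
  of the numerator is \<open>n D\<close>. Hence \<open>\<tau>^2 = n / D\<close> lies strictly
  between 0 and 1, and \<open>\<tau>^2 / (1 - \<tau>^2) = n / (D - n)\<close> is
  \<open>hyp_q x y\<close>.\<close>

lemma cosh_hyp_dist:
  fixes x y :: "'a::euclidean_space"
  assumes x: "x \<in> ball 0 1" and y: "y \<in> ball 0 1" and ne: "x \<noteq> y"
  shows "hyp_dist x y > 0" "cosh (hyp_dist x y) = 1 + 2 * hyp_q x y"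
proof -
  define A where "A = (norm x)\<^sup>2"
  define B where "B = (norm y)\<^sup>2"
  define c where "c = y \<bullet> x"
  define D where "D = 1 - 2 * c + B * A"
  define n where "n = (norm (y - x))\<^sup>2"
  have AB: "A < 1" "B < 1" using one_minus_norm_sq_pos[OF x] one_minus_norm_sq_pos[OF y] by (auto simp: A_def B_def)
  have n: "n = B - 2 * c + A"
    by (simp add: n_def A_def B_def c_def power2_norm_eq_inner inner_diff inner_commute)
  have n0: "n > 0" using ne by (simp add: n_def)
  have D: "D = n + (1 - B) * (1 - A)" by (simp add: D_def n algebra_simps)
  have P: "(1 - B) * (1 - A) > 0" using AB by simp
  have D0: "D > 0" using D P n0 by linarith
  define z where "z = y - x"
  have "(norm (n *\<^sub>R x - (1 - A) *\<^sub>R z))\<^sup>2 = n\<^sup>2 * (x \<bullet> x) - 2 * n * (1 - A) * (x \<bullet> z) + (1 - A)\<^sup>2 * (z \<bullet> z)"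
    unfolding power2_norm_eq_inner by (simp add: inner_diff inner_commute algebra_simps power2_eq_square)
  also have "x \<bullet> x = A" by (simp add: A_def power2_norm_eq_inner)
  also have "x \<bullet> z = c - A" by (simp add: A_def power2_norm_eq_inner z_def c_def inner_diff_right inner_commute)
  also have "z \<bullet> z = n" by (simp add: z_def n_def power2_norm_eq_inner)
  finally have "(norm (n *\<^sub>R x - (1 - A) *\<^sub>R (y - x)))\<^sup>2 = n\<^sup>2 * A - 2 * n * (1 - A) * (c - A) + (1 - A)\<^sup>2 * n"
    by (simp add: z_def)
  also have "\<dots> = n * D" by (simp add: n D_def algebra_simps power2_eq_square)
  finally have sq: "(norm (n *\<^sub>R x - (1 - A) *\<^sub>R (y - x)))\<^sup>2 = n * D" .
  have T: "hyp_T x y = (1 / D) *\<^sub>R (n *\<^sub>R x - (1 - A) *\<^sub>R (y - x))"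
    by (simp add: hyp_T_def D_def A_def B_def c_def n_def)
  define \<tau> where "\<tau> = norm (hyp_T x y)"
  have t2: "\<tau>\<^sup>2 = n / D"
    using D0 unfolding \<tau>_def T norm_scaleR power_mult_distrib sq by (simp add: power2_eq_square)
  have tn: "\<tau> \<ge> 0" by (simp add: \<tau>_def)
  have "\<tau>\<^sup>2 < 1" unfolding t2 using D P D0 by simp
  then have t1: "\<tau> < 1" using tn by (metis abs_of_nonneg abs_square_less_1)
  have "\<tau>\<^sup>2 > 0" unfolding t2 using n0 D0 by simp
  then have t0: "\<tau> > 0" using tn by (metis less_eq_real_def zero_less_power2)
  have hd: "hyp_dist x y = ln ((1 + \<tau>) / (1 - \<tau>))" by (simp add: hyp_dist_def \<tau>_def)
  have g1: "(1 + \<tau>) / (1 - \<tau>) > 1" using t0 t1 by simp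
  then show "hyp_dist x y > 0" unfolding hd by (rule ln_gt_zero)
  have "cosh (hyp_dist x y) = ((1 + \<tau>) / (1 - \<tau>) + inverse ((1 + \<tau>) / (1 - \<tau>))) / 2"
    using g1 unfolding hd by (simp add: cosh_ln_real)
  also have "\<dots> = (1 + \<tau>\<^sup>2) / (1 - \<tau>\<^sup>2)"
  proof -
    have "1 - \<tau>\<^sup>2 = (1 - \<tau>) * (1 + \<tau>)" by (simp add: algebra_simps power2_eq_square)
    moreover have "((1 + \<tau>) / (1 - \<tau>) + inverse ((1 + \<tau>) / (1 - \<tau>))) / 2
      = ((1 + \<tau>) * (1 + \<tau>) + (1 - \<tau>) * (1 - \<tau>)) / 2 / ((1 - \<tau>) * (1 + \<tau>))"
      using t0 t1 by (simp add: add_frac_eq)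
    moreover have "((1 + \<tau>) * (1 + \<tau>) + (1 - \<tau>) * (1 - \<tau>)) / 2 = 1 + \<tau>\<^sup>2"
      by (simp add: algebra_simps power2_eq_square)
    ultimately show ?thesis by (simp only:)
  qed
  also have "\<dots> = 1 + 2 * (\<tau>\<^sup>2 / (1 - \<tau>\<^sup>2))"
    using \<open>\<tau>\<^sup>2 < 1\<close> by (simp add: field_simps)
  also have "\<tau>\<^sup>2 / (1 - \<tau>\<^sup>2) = n / (D - n)" unfolding t2 using D0 by (simp add: field_simps)
  also have "\<dots> = hyp_q x y"
    using D by (simp add: hyp_q_def n_def A_def B_def norm_minus_commute mult.commute)
  finally show "cosh (hyp_dist x y) = 1 + 2 * hyp_q x y" .
qed

section \<open>Radial integration of the logarithmic weight\<close>

text \<open>Converts \<open>q \<ge> w / 100\<close> with \<open>w = exp |ln (v / M)|\<close> into a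
  bound by \<open>1 + |ln (v / M)|\<close>. The difference of the two sides is nondecreasing on
  \<open>w \<ge> 1\<close>, and at \<open>w = 1\<close> it is at least
  \<open>1/101 - 1/200\<close>.\<close>

lemma ln_one_plus_ge:
  fixes w :: real assumes "w \<ge> 1" shows "ln (1 + w/100) \<ge> (1 + ln w) / 200"
proof -
  define f where "f w = ln (1 + w/100) - (1 + ln w) / 200" for w :: real
  have "f 1 \<le> f w"
  proof (rule DERIV_nonneg_imp_nondecreasing[OF assms])
    fix x :: real assume x: "1 \<le> x" "x \<le> w"
    have "(f has_real_derivative (1/100) / (1 + x/100) - (1 / x) / 200) (at x)"
      unfolding f_def using x by (auto intro!: derivative_eq_intros)
    moreover have "(1/100) / (1 + x/100) - (1 / x) / 200 \<ge> 0" using x by (simp add: field_simps)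
    ultimately show "\<exists>d. (f has_real_derivative d) (at x) \<and> 0 \<le> d" by blast
  qed
  moreover have "f 1 \<ge> 0"
  proof -
    have "ln (1 / (1 + 1/100)) \<le> 1 / (1 + 1/100) - (1::real)" by (rule ln_le_minus_one) simp
    then have "ln (1 + 1/100::real) \<ge> 1/101" by (simp add: ln_div)
    then show ?thesis by (simp add: f_def)
  qed
  ultimately have "0 \<le> f w" by (rule order.trans[rotated])
  then show ?thesis unfolding f_def by simp
qed

text \<open>In the variable \<open>ln (v / M)\<close> this is the integral of
  \<open>(1 + |u|) powr (-1-s)\<close> over the line, finite for s > 0 and independent of
  \<open>M\<close>; each of the ranges \<open>v < M\<close> and \<open>v \<ge> M\<close> contributes
  \<open>1 / s\<close>.\<close>

lemma nn_integral_log_kernel: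
  fixes s M :: real assumes s: "s > 0" and M: "M > 0"
  shows "(\<integral>\<^sup>+v. ennreal (1 / v * (1 + \<bar>ln (v / M)\<bar>) powr (-1-s)) * indicator {0<..} v \<partial>lborel) = ennreal (2 / s)"
proof -
  let ?f = "\<lambda>v. ennreal (1 / v * (1 + \<bar>ln (v / M)\<bar>) powr (-1-s))"
  have "(\<integral>\<^sup>+v. ?f v * indicator {0<..<M} v \<partial>lborel) =
     (\<integral>\<^sup>+v. ennreal (1 / v * (1 + (ln M - ln v)) powr (-1-s)) * indicator (einterval 0 (ereal M)) v \<partial>lborel)"
    using M by (intro nn_integral_cong) (auto simp: indicator_def einterval_def ln_div)
  also have "\<dots> = ennreal (1 / s - 0)"
  proof (rule nn_integral_FTC_einterval[where F="\<lambda>v. (1 + (ln M - ln v)) powr (-s) / s"])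
    fix v assume "0 < ereal v" "ereal v < ereal M"
    then have v: "v > 0" "ln v < ln M" using M by auto
    show "((\<lambda>v. (1 + (ln M - ln v)) powr - s / s) has_real_derivative 1 / v * (1 + (ln M - ln v)) powr (-1-s)) (at v)"
    proof -
      have e: "-1 - s = -s - 1" by simp
      show ?thesis unfolding e using v s by (auto intro!: derivative_eq_intros)
    qed
    show "isCont (\<lambda>v. 1 / v * (1 + (ln M - ln v)) powr (-1-s)) v"
      using v by (intro continuous_intros) auto
    show "0 \<le> 1 / v * (1 + (ln M - ln v)) powr (-1-s)" using v by simp
  next
    have "((\<lambda>v. (1 + (ln M - ln v)) powr - s / s) \<longlongrightarrow> 0) (at_right 0)"
      using s by real_asymp
    then show "(((\<lambda>v. (1 + (ln M - ln v)) powr - s / s) \<circ> real_of_ereal) \<longlongrightarrow> 0) (at_right 0)"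
      by (simp add: ereal_tendsto_simps zero_ereal_def)
    have "((\<lambda>v. (1 + (ln M - ln v)) powr - s / s) \<longlongrightarrow> (1 + (ln M - ln M)) powr - s / s) (at_left M)"
      using s M by (intro tendsto_intros) auto
    then show "(((\<lambda>v. (1 + (ln M - ln v)) powr - s / s) \<circ> real_of_ereal) \<longlongrightarrow> 1 / s) (at_left (ereal M))"
      by (simp add: ereal_tendsto_simps)
  qed (use M in auto)
  finally have 1: "(\<integral>\<^sup>+v. ?f v * indicator {0<..<M} v \<partial>lborel) = ennreal (1 / s)" by simp
  have "(\<integral>\<^sup>+v. ?f v * indicator {M..} v \<partial>lborel) =
     (\<integral>\<^sup>+v. ennreal (1 / v * (1 + (ln v - ln M)) powr (-1-s)) * indicator {M..} v \<partial>lborel)"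
    using M by (intro nn_integral_cong) (auto simp: indicator_def ln_div)
  also have "\<dots> = ennreal (0 - (- ((1 + (ln M - ln M)) powr (-s) / s)))"
  proof (rule nn_integral_FTC_atLeast[where F="\<lambda>v. - ((1 + (ln v - ln M)) powr (-s) / s)"])
    fix v assume "M \<le> v"
    then have v: "v > 0" "ln v \<ge> ln M" using M by auto
    show "((\<lambda>v. - ((1 + (ln v - ln M)) powr - s / s)) has_real_derivative 1 / v * (1 + (ln v - ln M)) powr (-1-s)) (at v)"
    proof -
      have e: "-1 - s = -s - 1" by simp
      show ?thesis unfolding e using v s by (auto intro!: derivative_eq_intros)
    qed
    show "0 \<le> 1 / v * (1 + (ln v - ln M)) powr (-1-s)" using v by simp
  next
    show "((\<lambda>v. - ((1 + (ln v - ln M)) powr - s / s)) \<longlongrightarrow> 0) at_top"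
      using s by real_asymp
  qed measurable
  finally have 2: "(\<integral>\<^sup>+v. ?f v * indicator {M..} v \<partial>lborel) = ennreal (1 / s)" by simp
  have "(\<integral>\<^sup>+v. ?f v * indicator {0<..} v \<partial>lborel) = (\<integral>\<^sup>+v. ?f v * indicator {0<..<M} v + ?f v * indicator {M..} v \<partial>lborel)"
    using M by (intro nn_integral_cong) (auto simp: indicator_def)
  also have "\<dots> = (\<integral>\<^sup>+v. ?f v * indicator {0<..<M} v \<partial>lborel) + (\<integral>\<^sup>+v. ?f v * indicator {M..} v \<partial>lborel)"
    by (rule nn_integral_add) measurable
  also have "\<dots> = ennreal (1 / s) + ennreal (1 / s)" by (simp only: 1 2)
  also have "\<dots> = ennreal (2 / s)" using s by (simp add: ennreal_plus[symmetric] del: ennreal_plus)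
  finally show ?thesis .
qed

text \<open>With \<open>r = |x - y|\<close>, \<open>\<delta> = 1 - |x|^2\<close>,
  \<open>\<epsilon> = 1 - |y|^2\<close>, the key is \<open>r \<ge> \<delta> / 4\<close>. Since
  \<open>v \<le> \<delta>\<close>, it gives \<open>r \<ge> v / 4\<close> and, through
  \<open>M \<le> r + v\<close>, also \<open>r \<ge> M / 5\<close>. As
  \<open>\<delta> \<epsilon> \<le> 4 v M\<close>, the quotient
  \<open>q = r^2 / (\<delta> \<epsilon>)\<close> is at least \<open>M / (100 v)\<close> and
  \<open>v / (64 M)\<close>.\<close>

lemma hyp_q_radial_ge:
  fixes \<theta> y :: "'a::euclidean_space"
  assumes \<theta>: "norm \<theta> = 1" and y: "norm y < 1" and t: "0 < t" "t < 1"
    and q: "hyp_q (t *\<^sub>R \<theta>) y > 1/8"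
  shows "norm (t *\<^sub>R \<theta> - y) \<ge> norm (\<theta> - y) / 5"
    "hyp_q (t *\<^sub>R \<theta>) y \<ge> norm (\<theta> - y) / (1 - t) / 100"
    "hyp_q (t *\<^sub>R \<theta>) y \<ge> (1 - t) / norm (\<theta> - y) / 100"
proof -
  define v where "v = 1 - t"
  define x where "x = t *\<^sub>R \<theta>"
  define M where "M = norm (\<theta> - y)"
  define \<epsilon> where "\<epsilon> = 1 - (norm y)\<^sup>2"
  define \<delta> where "\<delta> = 1 - (norm x)\<^sup>2"
  define r where "r = norm (x - y)"
  have nx: "norm x = t" using t \<theta> by (simp add: x_def)
  have v: "v > 0" "v < 1" using t by (auto simp: v_def)
  have \<delta>: "\<delta> = v * (1 + t)" by (simp add: \<delta>_def nx v_def algebra_simps power2_eq_square)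
  have dv: "v \<le> \<delta>" "\<delta> \<le> 2 * v" unfolding \<delta> using v t by (auto simp: mult_le_cancel_left1)
  have e0: "\<epsilon> > 0" using y by (simp add: \<epsilon>_def power_less_one_iff)
  have M1: "M \<ge> 1 - norm y" using norm_triangle_ineq2[of \<theta> y] \<theta> by (simp add: M_def)
  have "\<epsilon> = (1 - norm y) * (1 + norm y)" by (simp add: \<epsilon>_def algebra_simps power2_eq_square)
  also have "\<dots> \<le> (1 - norm y) * 2" using y by (intro mult_left_mono) auto
  also have "\<dots> \<le> M * 2" using M1 by (intro mult_right_mono) auto
  finally have eM: "\<epsilon> \<le> 2 * M" by (simp add: mult.commute)
  have M0: "M > 0" using eM e0 by linarith
  have q_eq: "hyp_q x y = r\<^sup>2 / (\<delta> * \<epsilon>)" by (simp add: hyp_q_def r_def \<delta>_def \<epsilon>_def)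
  \<comment> \<open>On the ball the function \<open>1 - |z|^2\<close> changes by at most twice the
    distance. So \<open>r < \<delta> / 4\<close> would leave
    \<open>\<epsilon> \<ge> \<delta> / 2\<close>, and then
    \<open>r^2 \<le> \<delta> \<epsilon> / 8\<close> contradicts \<open>q > 1/8\<close>.\<close>
  have rd: "r \<ge> \<delta> / 4"
  proof (rule ccontr)
    assume "\<not> r \<ge> \<delta> / 4"
    then have r: "r < \<delta> / 4" by simp
    have "norm y \<le> t + r" using norm_triangle_ineq2[of y x] nx by (simp add: r_def norm_minus_commute)
    then have "(norm y)\<^sup>2 - t\<^sup>2 \<le> r * (norm y + t)"
    proof -
      have "(norm y)\<^sup>2 - t\<^sup>2 = (norm y - t) * (norm y + t)" by (simp add: algebra_simps power2_eq_square)
      also have "\<dots> \<le> r * (norm y + t)" using \<open>norm y \<le> t + r\<close> t by (intro mult_right_mono) auto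
      finally show ?thesis .
    qed
    also have "\<dots> \<le> r * 2" using y t by (intro mult_left_mono) (auto simp: r_def)
    finally have "\<delta> - \<epsilon> \<le> 2 * r" by (simp add: \<delta>_def \<epsilon>_def nx)
    then have e2: "\<epsilon> \<ge> \<delta> / 2" using r by linarith
    have "r\<^sup>2 \<le> (\<delta> / 4)\<^sup>2" using r by (intro power_mono) (auto simp: r_def)
    also have "\<dots> = \<delta> * (\<delta> / 2) / 8" by (simp add: power2_eq_square)
    also have "\<dots> \<le> \<delta> * \<epsilon> / 8" using e2 dv v by (intro divide_right_mono mult_left_mono) auto
    finally have "hyp_q x y \<le> 1/8" unfolding q_eq using dv v e0 by (simp add: field_simps)
    then show False using q by (simp add: x_def)
  qed
  have "\<theta> - y = (x - y) + v *\<^sub>R \<theta>" by (simp add: x_def v_def algebra_simps)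
  then have "M = norm ((x - y) + v *\<^sub>R \<theta>)" by (simp only: M_def)
  also have "\<dots> \<le> r + v" unfolding r_def
    using norm_triangle_ineq[of "x - y" "v *\<^sub>R \<theta>"] \<theta> v by simp
  finally have "M \<le> r + v" .
  then have rM: "r \<ge> M / 5" and rv: "r \<ge> v / 4" using rd dv by auto
  show "norm (t *\<^sub>R \<theta> - y) \<ge> norm (\<theta> - y) / 5" using rM by (simp add: r_def M_def x_def)
  have de: "\<delta> * \<epsilon> \<le> 4 * v * M" using mult_mono[OF dv(2) eM] v e0 by simp
  have de0: "\<delta> * \<epsilon> > 0" using dv v e0 by simp
  have "M / v / 100 = (M / 5)\<^sup>2 / (4 * v * M)" using M0 v by (simp add: field_simps power2_eq_square)
  also have "\<dots> \<le> r\<^sup>2 / (\<delta> * \<epsilon>)" using rM M0 v de de0 by (intro frac_le power_mono) auto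
  finally show "hyp_q (t *\<^sub>R \<theta>) y \<ge> norm (\<theta> - y) / (1 - t) / 100"
    using q_eq by (simp add: x_def M_def v_def)
  have "v / M / 100 \<le> v / M / 64" using v M0 by (intro divide_left_mono) auto
  also have "v / M / 64 = (v / 4)\<^sup>2 / (4 * v * M)" using M0 v by (simp add: field_simps power2_eq_square)
  also have "\<dots> \<le> r\<^sup>2 / (\<delta> * \<epsilon>)" using rv M0 v de de0 by (intro frac_le power_mono) auto
  finally show "hyp_q (t *\<^sub>R \<theta>) y \<ge> (1 - t) / norm (\<theta> - y) / 100"
    using q_eq by (simp add: x_def M_def v_def)
qed

text \<open>With \<open>n = N - 1\<close>, the power \<open>q^(-n)\<close> equals
  \<open>(\<delta> \<epsilon>)^n / r^(2n)\<close>, so the volume density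
  \<open>\<delta>^(-N)\<close> leaves just one factor \<open>1 / \<delta> \<le> 1 / v\<close>. The
  constants come from \<open>r \<ge> M / 5\<close> and from \<open>ln_one_plus_ge\<close>.\<close>

lemma kernel_bound_radial_le:
  fixes \<theta> y :: "'a::euclidean_space"
  assumes \<theta>: "norm \<theta> = 1" and y: "norm y < 1" and t: "0 < t" "t < 1" and s: "s > 0"
    and q: "hyp_q (t *\<^sub>R \<theta>) y > 1/8" and N: "N = Suc n"
  shows "kernel_bound N s (hyp_q (t *\<^sub>R \<theta>) y) / (1 - (norm (t *\<^sub>R \<theta>))\<^sup>2) ^ N \<le>
     25 ^ n * 200 powr (1 + s) * ((1 - (norm y)\<^sup>2) ^ n / norm (\<theta> - y) ^ (2 * n)) *
     (1 / (1 - t) * (1 + \<bar>ln ((1 - t) / norm (\<theta> - y))\<bar>) powr (-1-s))"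
proof -
  define v where "v = 1 - t"
  define x where "x = t *\<^sub>R \<theta>"
  define M where "M = norm (\<theta> - y)"
  define \<epsilon> where "\<epsilon> = 1 - (norm y)\<^sup>2"
  define \<delta> where "\<delta> = 1 - (norm x)\<^sup>2"
  define r where "r = norm (x - y)"
  define Q where "Q = hyp_q x y"
  have nx: "norm x = t" using t \<theta> by (simp add: x_def)
  have v: "v > 0" "v < 1" using t by (auto simp: v_def)
  have "\<delta> = v * (1 + t)" by (simp add: \<delta>_def nx v_def algebra_simps power2_eq_square)
  then have dv: "v \<le> \<delta>" using v t by (auto simp: mult_le_cancel_left1)
  have d0: "\<delta> > 0" using dv v by simp
  have e0: "\<epsilon> > 0" using y by (simp add: \<epsilon>_def power_less_one_iff)
  have "\<theta> \<noteq> y" using \<theta> y by auto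
  then have M0: "M > 0" by (simp add: M_def)
  note geo = hyp_q_radial_ge[OF \<theta> y t q, folded x_def, folded r_def M_def v_def Q_def]
  have r0: "r > 0" using geo(1) M0 by simp
  have Q8: "Q > 1/8" using q by (simp add: Q_def x_def)
  have Qe: "Q = r\<^sup>2 / (\<delta> * \<epsilon>)" by (simp add: Q_def hyp_q_def r_def \<delta>_def \<epsilon>_def)
  \<comment> \<open>The exponential is the larger of \<open>v / M\<close> and \<open>M / v\<close>,
    which joins the two lower bounds for \<open>q\<close> into one.\<close>
  have w: "Q \<ge> exp \<bar>ln (v / M)\<bar> / 100"
  proof (cases "ln (v / M) \<ge> 0")
    case True
    then show ?thesis using geo(3) v M0 by simp
  next
    case False
    then have "exp \<bar>ln (v / M)\<bar> = M / v" using v M0 by (simp add: exp_minus)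
    then show ?thesis using geo(2) by simp
  qed
  have "(1 + \<bar>ln (v / M)\<bar>) / 200 \<le> ln (1 + exp \<bar>ln (v / M)\<bar> / 100)"
    using ln_one_plus_ge[of "exp \<bar>ln (v / M)\<bar>"] by simp
  also have "\<dots> \<le> ln (1 + Q)" using w by (intro ln_mono) (auto intro: add_pos_pos)
  finally have "ln (1 + Q) powr (-1-s) \<le> ((1 + \<bar>ln (v / M)\<bar>) / 200) powr (-1-s)"
    using s by (intro powr_mono2') auto
  also have "\<dots> = 200 powr (1 + s) * (1 + \<bar>ln (v / M)\<bar>) powr (-1-s)"
  proof -
    have "(200::real) powr (-1-s) = 1 / 200 powr (1 + s)"
      using powr_minus_divide[of 200 "1 + s"] by simp
    then show ?thesis by (simp add: powr_divide)
  qed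
  finally have L: "ln (1 + Q) powr (-1-s) \<le> 200 powr (1 + s) * (1 + \<bar>ln (v / M)\<bar>) powr (-1-s)" .
  have "M\<^sup>2 / 25 \<le> r\<^sup>2" using power_mono[OF geo(1), of 2] M0 by (simp add: power_divide)
  then have "(M\<^sup>2 / 25) ^ n \<le> (r\<^sup>2) ^ n" by (intro power_mono) auto
  then have Mr: "M ^ (2 * n) / 25 ^ n \<le> (r\<^sup>2) ^ n" by (simp add: power_divide power_mult)
  have Qn: "Q powr (- (real N - 1)) = (\<delta> * \<epsilon>) ^ n / (r\<^sup>2) ^ n"
  proof -
    have "Q powr (- (real N - 1)) = inverse (Q ^ n)" using Q8 by (simp add: N powr_minus powr_realpow)
    then show ?thesis by (simp add: Qe power_divide)
  qed
  have "kernel_bound N s Q / \<delta> ^ N = (\<delta> * \<epsilon>) ^ n / (r\<^sup>2) ^ n * ln (1 + Q) powr (-1-s) / \<delta> ^ N"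
    using Q8 Qn by (simp add: kernel_bound_def)
  also have "\<dots> = \<epsilon> ^ n / (r\<^sup>2) ^ n * (1 / \<delta> * ln (1 + Q) powr (-1-s))"
    using d0 by (simp add: N power_mult_distrib)
  also have "\<dots> \<le> \<epsilon> ^ n / (M ^ (2 * n) / 25 ^ n) * (1 / v * (200 powr (1 + s) * (1 + \<bar>ln (v / M)\<bar>) powr (-1-s)))"
    using e0 M0 Mr r0 dv d0 v by (intro mult_mono divide_left_mono L mult_pos_pos) auto
  also have "\<dots> = 25 ^ n * 200 powr (1 + s) * (\<epsilon> ^ n / M ^ (2 * n)) * (1 / v * (1 + \<bar>ln (v / M)\<bar>) powr (-1-s))"
    by simp
  finally show ?thesis by (simp add: Q_def x_def \<delta>_def \<epsilon>_def M_def v_def)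
qed

text \<open>With \<open>M = |\<theta> - y|\<close>, the quantity \<open>M\<^sup>-\<^sup>2\<^sup>n\<close> is comparable to the integral of \<open>|t \<theta> - y|\<^sup>-\<^sup>2\<^sup>n\<^sup>-\<^sup>1\<close>
  over \<open>1 \<le> t \<le> 1 + M\<close>, which turns the spherical integral into a volume integral outside the ball.\<close>

lemma sphere_poisson_bound:
  fixes y :: "'a::euclidean_space"
  assumes n: "DIM('a) = Suc n" "n \<ge> 1" and y: "norm y < 1"
  shows "(\<integral>\<^sup>+z. indicator (ball (0::'a) 1) z * ennreal (1 / norm (sgn z - y) ^ (2 * n)) \<partial>lborel)
    \<le> ennreal (2 ^ (3 * n + 1) / n * measure lborel (ball (0::'a) 1) / (1 - (norm y)\<^sup>2) ^ n)"
proof -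
  let ?N = "DIM('a)"
  define \<epsilon> where "\<epsilon> = 1 - (norm y)\<^sup>2"
  have e0: "\<epsilon> > 0" using y by (simp add: \<epsilon>_def power_less_one_iff)
  have "\<epsilon> = (1 - norm y) * (1 + norm y)" by (simp add: \<epsilon>_def algebra_simps power2_eq_square)
  also have "\<dots> \<le> (1 - norm y) * 2" using y by (intro mult_left_mono) auto
  finally have e2: "\<epsilon> / 2 \<le> 1 - norm y" by simp
  \<comment> \<open>Integrating the power \<open>-p\<close> of a length of order \<open>M\<close>
    over an interval of length \<open>M\<close> leaves \<open>M^(-2n)\<close>. The surplus
    \<open>p - N = n\<close> is positive, so the volume integral converges at infinity.\<close>
  define p :: real where "p = 2 * n + 1"
  define G where "G x = ennreal (norm (x - y) powr (-p)) * indicator (- ball 0 1) x" for x :: 'a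
  have [measurable]: "G \<in> borel_measurable borel" unfolding G_def by measurable
  have inner: "ennreal (1 / norm (sgn z - y) ^ (2 * n)) \<le> ennreal (2 ^ (2 * n + 1) / ?N) *
     (\<integral>\<^sup>+t. G (t *\<^sub>R sgn z) * ennreal (?N * t ^ (?N - 1)) * indicator {0<..} t \<partial>lborel)"
    if z: "z \<noteq> 0" for z :: 'a
  proof -
    define \<theta> where "\<theta> = sgn z"
    have \<theta>: "norm \<theta> = 1" using z by (simp add: \<theta>_def norm_sgn)
    define M where "M = norm (\<theta> - y)"
    have "\<theta> \<noteq> y" using \<theta> y by auto
    then have M: "M > 0" by (simp add: M_def)
    \<comment> \<open>Moving from \<open>\<theta>\<close> outwards by at most \<open>M\<close> keeps
      the distance to \<open>y\<close> below \<open>2 M\<close>, while \<open>t \<ge> 1\<close>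
      makes the polar density at least \<open>N\<close>.\<close>
    have "ennreal (?N * (2 * M) powr (-p)) * indicator {1..1+M} t \<le> G (t *\<^sub>R \<theta>) * ennreal (?N * t ^ (?N - 1)) * indicator {0<..} t" for t :: real
    proof (cases "t \<in> {1..1+M}")
      case True
      have "t *\<^sub>R \<theta> - y = (\<theta> - y) + (t - 1) *\<^sub>R \<theta>" by (simp add: algebra_simps)
      then have "norm (t *\<^sub>R \<theta> - y) \<le> norm (\<theta> - y) + norm ((t - 1) *\<^sub>R \<theta>)" by (simp only: norm_triangle_ineq)
      then have le: "norm (t *\<^sub>R \<theta> - y) \<le> 2 * M" using True \<theta> by (simp add: M_def)
      have "t *\<^sub>R \<theta> \<noteq> y" using True \<theta> y by auto
      then have "(2 * M) powr (-p) \<le> norm (t *\<^sub>R \<theta> - y) powr (-p)" using le by (intro powr_mono2') (auto simp: p_def)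
      moreover have "1 \<le> t ^ (?N - 1)" using True by simp
      ultimately have "(2 * M) powr (-p) * (?N * 1) \<le> norm (t *\<^sub>R \<theta> - y) powr (-p) * (?N * t ^ (?N - 1))"
        by (intro mult_mono mult_left_mono) auto
      then show ?thesis using True \<theta> by (auto simp: G_def ennreal_mult'[symmetric] mult.commute intro!: ennreal_leI)
    qed simp
    then have "(\<integral>\<^sup>+t. ennreal (?N * (2 * M) powr (-p)) * indicator {1..1+M} t \<partial>lborel)
       \<le> (\<integral>\<^sup>+t. G (t *\<^sub>R \<theta>) * ennreal (?N * t ^ (?N - 1)) * indicator {0<..} t \<partial>lborel)"
      by (intro nn_integral_mono)
    also have "(\<integral>\<^sup>+t. ennreal (?N * (2 * M) powr (-p)) * indicator {1..1+M} t \<partial>lborel) = ennreal (?N * (2 * M) powr (-p)) * ennreal M"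
      using M by (subst nn_integral_cmult_indicator) auto
    finally have I: "ennreal (?N * (2 * M) powr (-p) * M) \<le> (\<integral>\<^sup>+t. G (t *\<^sub>R \<theta>) * ennreal (?N * t ^ (?N - 1)) * indicator {0<..} t \<partial>lborel)"
      using M by (simp add: ennreal_mult'[symmetric])
    have "(2 * M) powr (-p) = 1 / (2 * M) ^ (2 * n + 1)"
    proof -
      have "p = real (2 * n + 1)" by (simp add: p_def)
      then show ?thesis using M by (simp only: powr_minus powr_realpow) (simp add: powr_realpow inverse_eq_divide del: power_Suc of_nat_add of_nat_mult)
    qed
    then have "1 / M ^ (2 * n) = 2 ^ (2 * n + 1) / ?N * (?N * (2 * M) powr (-p) * M)"
      using M by (simp add: power_mult_distrib)
    then have "ennreal (1 / M ^ (2 * n)) = ennreal (2 ^ (2 * n + 1) / ?N) * ennreal (?N * (2 * M) powr (-p) * M)"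
      using M by (simp add: ennreal_mult'[symmetric])
    also have "\<dots> \<le> ennreal (2 ^ (2 * n + 1) / ?N) * (\<integral>\<^sup>+t. G (t *\<^sub>R \<theta>) * ennreal (?N * t ^ (?N - 1)) * indicator {0<..} t \<partial>lborel)"
      by (intro mult_left_mono I) auto
    finally show ?thesis by (simp add: M_def \<theta>_def)
  qed
  have "(\<integral>\<^sup>+z. indicator (ball (0::'a) 1) z * ennreal (1 / norm (sgn z - y) ^ (2 * n)) \<partial>lborel)
    \<le> (\<integral>\<^sup>+z. ennreal (2 ^ (2 * n + 1) / ?N) * (indicator (ball (0::'a) 1) z *
      (\<integral>\<^sup>+t. G (t *\<^sub>R sgn z) * ennreal (?N * t ^ (?N - 1)) * indicator {0<..} t \<partial>lborel)) \<partial>lborel)"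
    by (intro nn_integral_mono_AE eventually_mono[OF AE_lborel_singleton[of 0]])
       (drule inner, auto simp: indicator_def)
  also have "\<dots> = ennreal (2 ^ (2 * n + 1) / ?N) * (\<integral>\<^sup>+x. G x \<partial>lborel)"
    by (subst nn_integral_polar[of G], measurable, rule nn_integral_cmult) measurable
  also have "(\<integral>\<^sup>+x. G x \<partial>lborel) = (\<integral>\<^sup>+x. G (y + x) \<partial>lborel)"
    by (rule nn_integral_lborel_translation[symmetric]) measurable
  also have "\<dots> \<le> (\<integral>\<^sup>+x. ennreal (norm x powr (-p)) * indicator (- ball (0::'a) (\<epsilon>/2)) x \<partial>lborel)"
  proof (intro nn_integral_mono)
    fix x :: 'a
    \<comment> \<open>The outside of the unit ball lies at distance at least
      \<open>1 - |y| \<ge> \<epsilon> / 2\<close> from \<open>y\<close>; recentring at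
      \<open>y\<close> makes the integrand radial.\<close>
    have "norm x \<ge> \<epsilon> / 2" if "norm (y + x) \<ge> 1"
      using that norm_triangle_ineq[of y x] e2 by linarith
    then show "G (y + x) \<le> ennreal (norm x powr (-p)) * indicator (- ball 0 (\<epsilon>/2)) x"
      by (auto simp: G_def indicator_def)
  qed
  also have "\<dots> = ennreal (?N / (p - ?N) * measure lborel (ball (0::'a) 1) * (\<epsilon>/2) powr (?N - p))"
    using n e0 by (intro nn_integral_norm_powr_outside) (auto simp: p_def)
  also have "p - ?N = n" using n by (simp add: p_def)
  also have "?N - p = - real n" using n by (simp add: p_def)
  also have "(\<epsilon>/2) powr (- real n) = 2 ^ n / \<epsilon> ^ n"
    using e0 by (simp add: powr_minus powr_realpow power_divide)
  finally have "(\<integral>\<^sup>+z. indicator (ball (0::'a) 1) z * ennreal (1 / norm (sgn z - y) ^ (2 * n)) \<partial>lborel)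
    \<le> ennreal (2 ^ (2 * n + 1) / ?N) * ennreal (?N / n * measure lborel (ball (0::'a) 1) * (2 ^ n / \<epsilon> ^ n))"
    by (simp add: mult_left_mono)
  also have "\<dots> = ennreal (2 ^ (2 * n + 1) / ?N * (?N / n * measure lborel (ball (0::'a) 1) * (2 ^ n / \<epsilon> ^ n)))"
    by (rule ennreal_mult'[symmetric]) simp
  also have "2 ^ (2 * n + 1) / ?N * (?N / n * measure lborel (ball (0::'a) 1) * (2 ^ n / \<epsilon> ^ n))
     = 2 ^ (3 * n + 1) / n * measure lborel (ball (0::'a) 1) / \<epsilon> ^ n"
  proof -
    have "(2::real) ^ (3 * n + 1) = 2 ^ (2 * n + 1) * 2 ^ n" by (simp add: power_add[symmetric])
    then show ?thesis by simp
  qed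
  finally show ?thesis by (simp add: \<epsilon>_def)
qed

text \<open>Uniformity in \<open>y\<close> is a cancellation: the radial estimate leaves
  \<open>(1 - |y|^2)^n\<close>, and the spherical integral is at most a constant times its
  reciprocal.\<close>

lemma kernel_far_bound:
  fixes s :: real
  assumes N: "DIM('a::euclidean_space) \<ge> 2" and s: "s > 0"
  shows "\<exists>C>0. \<forall>y::'a. norm y < 1 \<longrightarrow>
    (\<integral>\<^sup>+x. ennreal (kernel_bound DIM('a) s (hyp_q x y) / (1 - (norm x)\<^sup>2) ^ DIM('a)) *
       indicator {x \<in> ball 0 1. hyp_q x y > 1/8} x \<partial>lborel) \<le> ennreal C"
proof -
  let ?N = "DIM('a)"
  define n where "n = ?N - 1"
  have n: "?N = Suc n" "n \<ge> 1" using N by (auto simp: n_def)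
  define K where "K = 25 ^ n * 200 powr (1 + s)"
  have K: "K > 0" by (simp add: K_def)
  define C where "C = ?N * K * (2 / s) * (2 ^ (3 * n + 1) / n * measure lborel (ball (0::'a) 1))"
  have "(\<integral>\<^sup>+x. ennreal (kernel_bound ?N s (hyp_q x y) / (1 - (norm x)\<^sup>2) ^ ?N) *
       indicator {x \<in> ball 0 1. hyp_q x y > 1/8} x \<partial>lborel) \<le> ennreal C" if y: "norm y < 1" for y :: 'a
  proof -
    define \<epsilon> where "\<epsilon> = 1 - (norm y)\<^sup>2"
    have e0: "\<epsilon> > 0" using y by (simp add: \<epsilon>_def power_less_one_iff)
    define G where "G x = ennreal (kernel_bound ?N s (hyp_q x y) / (1 - (norm x)\<^sup>2) ^ ?N) *
       indicator {x \<in> ball 0 1. hyp_q x y > 1/8} x" for x :: 'a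
    have [measurable]: "G \<in> borel_measurable borel" unfolding G_def by measurable
    have inner: "(\<integral>\<^sup>+t. G (t *\<^sub>R sgn z) * ennreal (?N * t ^ (?N - 1)) * indicator {0<..} t \<partial>lborel)
       \<le> ennreal (?N * K * \<epsilon> ^ n * (2 / s)) * ennreal (1 / norm (sgn z - y) ^ (2 * n))" if z: "z \<noteq> 0" for z :: 'a
    proof -
      define \<theta> where "\<theta> = sgn z"
      have \<theta>: "norm \<theta> = 1" using z by (simp add: \<theta>_def norm_sgn)
      define M where "M = norm (\<theta> - y)"
      have "\<theta> \<noteq> y" using \<theta> y by auto
      then have M: "M > 0" by (simp add: M_def)
      \<comment> \<open>Only \<open>0 < v < 1\<close> occurs for \<open>v = 1 - t\<close>, but the
        integral is extended to all \<open>v > 0\<close>, where its value \<open>2 / s\<close> is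
        free of \<open>M\<close>.\<close>
      define L where "L v = ennreal (1 / v * (1 + \<bar>ln (v / M)\<bar>) powr (-1-s)) * indicator {0<..} v" for v
      have [measurable]: "L \<in> borel_measurable borel" unfolding L_def by measurable
      define D where "D = ?N * (K * (\<epsilon> ^ n / M ^ (2 * n)))"
      have D: "D \<ge> 0" using K e0 M by (simp add: D_def)
      have "G (t *\<^sub>R \<theta>) * ennreal (?N * t ^ (?N - 1)) * indicator {0<..} t \<le> ennreal D * L (1 + (-1) * t)" for t :: real
      proof (cases "0 < t \<and> t < 1 \<and> hyp_q (t *\<^sub>R \<theta>) y > 1/8")
        case True
        then have t: "0 < t" "t < 1" and q: "hyp_q (t *\<^sub>R \<theta>) y > 1/8" by auto
        have "kernel_bound ?N s (hyp_q (t *\<^sub>R \<theta>) y) / (1 - (norm (t *\<^sub>R \<theta>))\<^sup>2) ^ ?N * (?N * t ^ (?N - 1)) \<le>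
          K * (\<epsilon> ^ n / M ^ (2 * n)) * (1 / (1 - t) * (1 + \<bar>ln ((1 - t) / M)\<bar>) powr (-1-s)) * (?N * 1)"
          unfolding K_def M_def \<epsilon>_def using \<theta> y t s q n
          by (intro mult_mono kernel_bound_radial_le mult_left_mono power_le_one) (auto simp: kernel_bound_nonneg power_le_one_iff)
        also have "\<dots> = D * (1 / (1 - t) * (1 + \<bar>ln ((1 - t) / M)\<bar>) powr (-1-s))"
          by (simp add: D_def)
        finally show ?thesis using t q \<theta> D
          by (simp add: G_def L_def ennreal_mult'[symmetric] ennreal_mult''[symmetric] ennreal_leI)
      next
        case False
        then have "G (t *\<^sub>R \<theta>) * indicator {0<..} t = 0" using \<theta> by (auto simp: G_def indicator_def)
        then show ?thesis by (metis (no_types, lifting) mult.assoc mult.commute mult_zero_right zero_le)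
      qed
      then have "(\<integral>\<^sup>+t. G (t *\<^sub>R \<theta>) * ennreal (?N * t ^ (?N - 1)) * indicator {0<..} t \<partial>lborel)
        \<le> (\<integral>\<^sup>+t. ennreal D * L (1 + (-1) * t) \<partial>lborel)" by (intro nn_integral_mono)
      also have "\<dots> = ennreal D * (\<integral>\<^sup>+t. L (1 + (-1) * t) \<partial>lborel)" by (rule nn_integral_cmult) measurable
      also have "(\<integral>\<^sup>+t. L (1 + (-1) * t) \<partial>lborel) = (\<integral>\<^sup>+t. L t \<partial>lborel)"
        using nn_integral_real_affine[of L "-1" 1] by simp
      also have "\<dots> = ennreal (2 / s)" unfolding L_def using s M by (rule nn_integral_log_kernel)
      also have "ennreal D * ennreal (2 / s) = ennreal (?N * K * \<epsilon> ^ n * (2 / s)) * ennreal (1 / M ^ (2 * n))"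
        using s K e0 M by (simp add: ennreal_mult'[symmetric] D_def mult_ac)
      finally show ?thesis by (simp add: M_def \<theta>_def)
    qed
    have "(\<integral>\<^sup>+x. G x \<partial>lborel) = (\<integral>\<^sup>+z. indicator (ball 0 1) z *
       (\<integral>\<^sup>+t. G (t *\<^sub>R sgn z) * ennreal (?N * t ^ (?N - 1)) * indicator {0<..} t \<partial>lborel) \<partial>lborel)"
      by (rule nn_integral_polar) measurable
    also have "\<dots> \<le> (\<integral>\<^sup>+z. ennreal (?N * K * \<epsilon> ^ n * (2 / s)) * (indicator (ball 0 1) z * ennreal (1 / norm (sgn z - y) ^ (2 * n))) \<partial>lborel)"
      by (intro nn_integral_mono_AE eventually_mono[OF AE_lborel_singleton[of 0]])
         (drule inner, auto simp: indicator_def)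
    also have "\<dots> = ennreal (?N * K * \<epsilon> ^ n * (2 / s)) * (\<integral>\<^sup>+z. (indicator (ball 0 1) z * ennreal (1 / norm (sgn z - y) ^ (2 * n))) \<partial>lborel)"
    proof (rule nn_integral_cmult)
      have [measurable]: "(sgn :: 'a \<Rightarrow> 'a) \<in> borel_measurable borel"
        unfolding sgn_div_norm[abs_def] by measurable
      show "(\<lambda>z. indicator (ball 0 1) z * ennreal (1 / norm (sgn z - y) ^ (2 * n))) \<in> borel_measurable lborel"
        by measurable
    qed
    also have "\<dots> \<le> ennreal (?N * K * \<epsilon> ^ n * (2 / s)) * ennreal (2 ^ (3 * n + 1) / n * measure lborel (ball (0::'a) 1) / \<epsilon> ^ n)"
      unfolding \<epsilon>_def by (intro mult_left_mono sphere_poisson_bound n y) auto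
    also have "\<dots> = ennreal C" using K e0 s by (simp add: C_def ennreal_mult'[symmetric])
    finally show ?thesis by (simp add: G_def)
  qed
  then have "\<forall>y::'a. norm y < 1 \<longrightarrow>
    (\<integral>\<^sup>+x. ennreal (kernel_bound DIM('a) s (hyp_q x y) / (1 - (norm x)\<^sup>2) ^ DIM('a)) *
       indicator {x \<in> ball 0 1. hyp_q x y > 1/8} x \<partial>lborel) \<le> ennreal (\<bar>C\<bar> + 1)"
    by (meson abs_ge_self ennreal_leI le_add_same_cancel1 order_trans zero_le_one)
  then show ?thesis by (intro exI[of _ "\<bar>C\<bar> + 1"]) auto
qed

section \<open>The seminorm of functions supported in the ball\<close>

text \<open>What is used of a test function: it is of class C^1, and a support radius below 1 keeps
  it away from the sphere, where the weights are singular.\<close>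

locale ball_C1 =
  fixes \<phi> :: "'a::euclidean_space \<Rightarrow> real" and g :: "'a \<Rightarrow> 'a" and R :: real
  assumes deriv: "(\<phi> has_derivative (\<lambda>h. g x \<bullet> h)) (at x)"
    and cont_g: "continuous_on UNIV g"
    and R: "0 < R" "R < 1"
    and supp: "norm x \<ge> R \<Longrightarrow> \<phi> x = 0" "norm x \<ge> R \<Longrightarrow> g x = 0"
begin

lemma cont: "continuous_on UNIV \<phi>"
  using deriv by (meson continuous_at_imp_continuous_on has_derivative_continuous)

lemma measurable_phi [measurable]: "\<phi> \<in> borel_measurable borel"
  by (rule borel_measurable_continuous_onI[OF cont])

lemma measurable_g [measurable]: "g \<in> borel_measurable borel"
  by (rule borel_measurable_continuous_onI[OF cont_g])

text \<open>By the fundamental theorem, \<open>m\<close> is the mean over \<open>{0..1}\<close> of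
  the derivative \<open>f\<close> along the segment. Expanding the integral of
  \<open>(f - m)^2\<close>, which is nonnegative, bounds \<open>m^2\<close> by the mean of
  \<open>f^2\<close>.\<close>

lemma diff_square_le:
  "ennreal ((\<phi> (y + h) - \<phi> y)\<^sup>2) \<le>
     ennreal ((norm h)\<^sup>2) * (\<integral>\<^sup>+\<tau>. ennreal ((norm (g (y + \<tau> *\<^sub>R h)))\<^sup>2) * indicator {0..1} \<tau> \<partial>lborel)"
proof -
  define f where "f \<tau> = g (y + \<tau> *\<^sub>R h) \<bullet> h" for \<tau>
  define m where "m = \<phi> (y + h) - \<phi> y"
  have cf: "continuous_on A f" for A unfolding f_def
    by (intro continuous_intros continuous_on_compose2[OF cont_g]) auto
  have int: "integrable lborel (\<lambda>\<tau>. indicator {0..1} \<tau> *\<^sub>R f \<tau>)" "integrable lborel (\<lambda>\<tau>. indicator {0..1} \<tau> *\<^sub>R (f \<tau>)\<^sup>2)"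
    "integrable lborel (\<lambda>\<tau>. indicator {0..1::real} \<tau> *\<^sub>R (1::real))"
    by (intro borel_integrable_compact continuous_intros cf; simp)+
  have "(\<integral>\<tau>. indicator {0..1} \<tau> *\<^sub>R f \<tau> \<partial>lborel) = \<phi> (y + 1 *\<^sub>R h) - \<phi> (y + 0 *\<^sub>R h)"
  proof (rule integral_FTC_Icc)
    show "((\<lambda>\<tau>. \<phi> (y + \<tau> *\<^sub>R h)) has_vector_derivative f \<tau>) (at \<tau> within {0..1})" for \<tau>
    proof -
      have "((\<lambda>\<tau>. y + \<tau> *\<^sub>R h) has_derivative (\<lambda>t. t *\<^sub>R h)) (at \<tau> within {0..1})"
        by (auto intro!: derivative_eq_intros)
      from has_derivative_compose[OF this deriv]
      show ?thesis by (simp add: has_vector_derivative_def f_def)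
    qed
  qed (use cf in auto)
  then have m: "(\<integral>\<tau>. indicator {0..1} \<tau> *\<^sub>R f \<tau> \<partial>lborel) = m" by (simp add: m_def)
  have "0 \<le> (\<integral>\<tau>. indicator {0..1} \<tau> *\<^sub>R (f \<tau> - m)\<^sup>2 \<partial>lborel)"
    by (intro integral_nonneg_AE) auto
  also have "\<dots> = (\<integral>\<tau>. indicator {0..1} \<tau> *\<^sub>R (f \<tau>)\<^sup>2 - 2 * m * (indicator {0..1} \<tau> *\<^sub>R f \<tau>) + m\<^sup>2 * (indicator {0..1} \<tau> *\<^sub>R 1) \<partial>lborel)"
    by (intro Bochner_Integration.integral_cong) (auto simp: indicator_def power2_eq_square algebra_simps)
  also have "\<dots> = (\<integral>\<tau>. indicator {0..1} \<tau> *\<^sub>R (f \<tau>)\<^sup>2 \<partial>lborel) - 2 * m * m + m\<^sup>2 * (\<integral>\<tau>. indicator {0..1::real} \<tau> *\<^sub>R (1::real) \<partial>lborel)"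
    unfolding m[symmetric] using int by simp
  also have "(\<integral>\<tau>. indicator {0..1::real} \<tau> *\<^sub>R (1::real) \<partial>lborel) = 1" by simp
  finally have "m\<^sup>2 \<le> (\<integral>\<tau>. indicator {0..1} \<tau> *\<^sub>R (f \<tau>)\<^sup>2 \<partial>lborel)" by (simp add: power2_eq_square)
  then have "ennreal (m\<^sup>2) \<le> ennreal (\<integral>\<tau>. indicator {0..1} \<tau> *\<^sub>R (f \<tau>)\<^sup>2 \<partial>lborel)" by (rule ennreal_leI)
  also have "\<dots> = (\<integral>\<^sup>+\<tau>. ennreal (indicator {0..1} \<tau> *\<^sub>R (f \<tau>)\<^sup>2) \<partial>lborel)"
    by (rule nn_integral_eq_integral[symmetric, OF int(2)]) auto
  also have "\<dots> \<le> (\<integral>\<^sup>+\<tau>. ennreal ((norm h)\<^sup>2) * (ennreal ((norm (g (y + \<tau> *\<^sub>R h)))\<^sup>2) * indicator {0..1} \<tau>) \<partial>lborel)"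
  proof (intro nn_integral_mono)
    fix \<tau>
    have "\<bar>f \<tau>\<bar>\<^sup>2 \<le> (norm (g (y + \<tau> *\<^sub>R h)) * norm h)\<^sup>2"
      unfolding f_def by (intro power_mono Cauchy_Schwarz_ineq2) auto
    then show "ennreal (indicator {0..1} \<tau> *\<^sub>R (f \<tau>)\<^sup>2) \<le> ennreal ((norm h)\<^sup>2) * (ennreal ((norm (g (y + \<tau> *\<^sub>R h)))\<^sup>2) * indicator {0..1} \<tau>)"
      by (auto simp: indicator_def ennreal_mult'[symmetric] power_mult_distrib mult.commute intro!: ennreal_leI)
  qed
  also have "\<dots> = ennreal ((norm h)\<^sup>2) * (\<integral>\<^sup>+\<tau>. (ennreal ((norm (g (y + \<tau> *\<^sub>R h)))\<^sup>2) * indicator {0..1} \<tau>) \<partial>lborel)"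
    by (rule nn_integral_cmult) measurable
  finally show ?thesis by (simp add: m_def)
qed

end

section \<open>Comparability of the weights near the diagonal\<close>

text \<open>Let \<open>e\<close> be the larger endpoint weight. Then
  \<open>|x - y|^2 \<le> e^2 / 8\<close>, so \<open>|x - y| \<le> 36/100 * e\<close>, and since
  norms stay below 1 the squared norm varies by at most \<open>72/100 * e\<close>. All weights on
  the segment therefore lie between \<open>e / 4\<close> and \<open>2 e\<close>, which produces the
  factors 2 and 8 in the conclusions.\<close>

lemma near_segment:
  fixes x y :: "'a::euclidean_space"
  assumes x: "norm x < 1" and y: "norm y < 1" and q: "hyp_q x y \<le> 1/8" and \<tau>: "0 \<le> \<tau>" "\<tau> \<le> 1"
  defines "w \<equiv> y + \<tau> *\<^sub>R (x - y)"
  shows "norm w < 1" "norm (x - y) < 2 * (1 - (norm w)\<^sup>2)"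
    "(1 - (norm x)\<^sup>2) * (1 - (norm y)\<^sup>2) \<ge> ((1 - (norm w)\<^sup>2) / 8)\<^sup>2"
proof -
  define e where "e = max (1 - (norm x)\<^sup>2) (1 - (norm y)\<^sup>2)"
  obtain p where p: "p = x \<or> p = y" "e = 1 - (norm p)\<^sup>2"
    by (cases "1 - (norm x)\<^sup>2 \<le> 1 - (norm y)\<^sup>2") (auto simp: e_def max_def)
  have ex: "1 - (norm x)\<^sup>2 > 0" "1 - (norm y)\<^sup>2 > 0" using x y by (simp_all add: power_less_one_iff)
  have e0: "e > 0" using ex by (simp add: e_def)
  have "(norm (x - y))\<^sup>2 \<le> (1 - (norm x)\<^sup>2) * (1 - (norm y)\<^sup>2) / 8"
  proof -
    have P: "(1 - (norm x)\<^sup>2) * (1 - (norm y)\<^sup>2) > 0" using ex by simp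
    from q show ?thesis unfolding hyp_q_def pos_divide_le_eq[OF P] by simp
  qed
  also have "\<dots> \<le> e * e / 8" using ex by (intro divide_right_mono mult_mono) (auto simp: e_def)
  also have "\<dots> \<le> (36/100 * e)\<^sup>2" by (simp add: power2_eq_square)
  finally have h: "norm (x - y) \<le> 36/100 * e" using e0 by (auto dest!: power2_le_imp_le)
  have seg: "norm (y + t *\<^sub>R (x - y)) < 1 \<and> 1 - (norm (y + t *\<^sub>R (x - y)))\<^sup>2 \<ge> e / 4 \<and> 1 - (norm (y + t *\<^sub>R (x - y)))\<^sup>2 \<le> 2 * e"
    if t: "0 \<le> t" "t \<le> 1" for t
  proof -
    define z where "z = y + t *\<^sub>R (x - y)"
    have "z = (1 - t) *\<^sub>R y + t *\<^sub>R x" by (simp add: z_def algebra_simps)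
    then have "z \<in> ball 0 1" using convex_ball[of "0::'a" 1] x y t unfolding convex_alt by (simp add: dist_norm)
    then have z1: "norm z < 1" by simp
    have p1: "norm p < 1" using p x y by auto
    have "norm (z - p) \<le> norm (x - y)"
    proof -
      have "norm (z - y) \<le> norm (x - y)" using t by (simp add: z_def mult_left_le_one_le)
      moreover have "z - x = (1 - t) *\<^sub>R (y - x)" by (simp add: z_def algebra_simps)
      then have "norm (z - x) \<le> norm (x - y)" using t by (simp add: mult_left_le_one_le norm_minus_commute)
      ultimately show ?thesis using p by auto
    qed
    then have d: "\<bar>norm z - norm p\<bar> \<le> 36/100 * e" using h norm_triangle_ineq3[of z p] by linarith
    have "\<bar>(norm z)\<^sup>2 - (norm p)\<^sup>2\<bar> = \<bar>norm z - norm p\<bar> * (norm z + norm p)"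
    proof -
      have "(norm z)\<^sup>2 - (norm p)\<^sup>2 = (norm z - norm p) * (norm z + norm p)"
        by (simp add: algebra_simps power2_eq_square)
      then show ?thesis by (simp add: abs_mult)
    qed
    also have "\<dots> \<le> (36/100 * e) * 2" using d z1 p1 e0 by (intro mult_mono) auto
    finally have "\<bar>(norm z)\<^sup>2 - (norm p)\<^sup>2\<bar> \<le> 72/100 * e" by simp
    then show ?thesis using p(2) z1 e0 unfolding z_def[symmetric] abs_le_iff by auto
  qed
  show "norm w < 1" using seg[OF \<tau>] by (simp add: w_def)
  show "norm (x - y) < 2 * (1 - (norm w)\<^sup>2)" using seg[OF \<tau>] h e0 by (simp add: w_def)
  have "((1 - (norm w)\<^sup>2) / 8)\<^sup>2 \<le> (e / 4)\<^sup>2"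
    using seg[OF \<tau>] e0 by (intro power_mono) (auto simp: w_def)
  also have "\<dots> = (e / 4) * (e / 4)" by (simp add: power2_eq_square)
  also have "\<dots> \<le> (1 - (norm x)\<^sup>2) * (1 - (norm y)\<^sup>2)"
    using seg[of 0] seg[of 1] e0 by (intro mult_mono) auto
  finally show "(1 - (norm x)\<^sup>2) * (1 - (norm y)\<^sup>2) \<ge> ((1 - (norm w)\<^sup>2) / 8)\<^sup>2" .
qed

text \<open>The weight is moved to the point \<open>w\<close> at which the gradient is evaluated. In
  terms of \<open>h = |x - y|\<close> and the product \<open>P\<close> of the endpoint weights, the
  kernel gives \<open>P powr ((N + 2s) / 2)\<close> and the volumes \<open>P^(-N)\<close>. The
  resulting exponent \<open>-(N - 2s) / 2\<close> is negative, so the lower bound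
  \<open>(W / 8)^2\<close> for \<open>P\<close> is the one required.\<close>

lemma kernel_bound_near_le:
  fixes x y :: "'a::euclidean_space" and s :: real
  assumes x: "norm x < 1" and y: "norm y < 1" and q: "hyp_q x y \<le> 1/8" and \<tau>: "0 \<le> \<tau>" "\<tau> \<le> 1"
    and ne: "x \<noteq> y" and N: "N \<ge> 2" and s: "s < 1"
  defines "w \<equiv> y + \<tau> *\<^sub>R (x - y)"
  shows "kernel_bound N s (hyp_q x y) / ((1 - (norm x)\<^sup>2) ^ N * (1 - (norm y)\<^sup>2) ^ N) * (norm (x - y))\<^sup>2 \<le>
    8 powr (N - 2 * s) * norm (x - y) powr (- (N + 2 * s - 2)) * (1 - (norm w)\<^sup>2) powr (2 * s - N)"
proof -
  define P where "P = (1 - (norm x)\<^sup>2) * (1 - (norm y)\<^sup>2)"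
  define h where "h = norm (x - y)"
  define W where "W = 1 - (norm w)\<^sup>2"
  have ex: "1 - (norm x)\<^sup>2 > 0" "1 - (norm y)\<^sup>2 > 0" using x y by (simp_all add: power_less_one_iff)
  have P0: "P > 0" using ex by (simp add: P_def)
  have h0: "h > 0" using ne by (simp add: h_def)
  note ns = near_segment[OF x y q \<tau>, folded w_def, folded P_def W_def]
  have W0: "W > 0" using ns(1) by (simp add: W_def power_less_one_iff)
  have qe: "hyp_q x y = h\<^sup>2 / P" by (simp add: hyp_q_def h_def P_def)
  have h2: "h\<^sup>2 = h powr 2" using h0 by (simp add: powr_numeral)
  have "kernel_bound N s (hyp_q x y) = (h powr 2 / P) powr (- ((N + 2 * s) / 2))"
    using q by (simp add: kernel_bound_def qe h2)
  also have "\<dots> = h powr (- (N + 2 * s)) * P powr ((N + 2 * s) / 2)"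
  proof -
    have "(h powr 2) powr (- ((N + 2 * s) / 2)) = h powr (- (N + 2 * s))"
      unfolding powr_powr by (rule arg_cong[where f="\<lambda>u. h powr u"]) (simp add: field_simps)
    moreover have "P powr (- ((N + 2 * s) / 2)) = 1 / P powr ((N + 2 * s) / 2)" by (rule powr_minus_divide)
    ultimately show ?thesis using h0 P0 by (simp only: powr_divide) simp
  qed
  finally have k: "kernel_bound N s (hyp_q x y) = h powr (- (N + 2 * s)) * P powr ((N + 2 * s) / 2)" .
  have "kernel_bound N s (hyp_q x y) / ((1 - (norm x)\<^sup>2) ^ N * (1 - (norm y)\<^sup>2) ^ N) * h\<^sup>2
    = (h powr (- (N + 2 * s)) * h powr 2) * (P powr ((N + 2 * s) / 2) * P powr (- real N))"
    using P0 by (simp add: k h2 P_def[symmetric] power_mult_distrib[symmetric] powr_minus powr_realpow divide_simps)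
  also have "h powr (- (N + 2 * s)) * h powr 2 = h powr (- (N + 2 * s - 2))"
    unfolding powr_add[symmetric] by (rule arg_cong[where f="\<lambda>u. h powr u"]) simp
  also have "P powr ((N + 2 * s) / 2) * P powr (- real N) = P powr (- ((N - 2 * s) / 2))"
    unfolding powr_add[symmetric] by (rule arg_cong[where f="\<lambda>u. P powr u"]) (simp add: field_simps)
  finally have eq: "kernel_bound N s (hyp_q x y) / ((1 - (norm x)\<^sup>2) ^ N * (1 - (norm y)\<^sup>2) ^ N) * h\<^sup>2
    = h powr (- (N + 2 * s - 2)) * P powr (- ((N - 2 * s) / 2))" .
  have "P powr (- ((N - 2 * s) / 2)) \<le> ((W / 8)\<^sup>2) powr (- ((N - 2 * s) / 2))"
    using ns(3) W0 N s by (intro powr_mono2') auto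
  also have "((W / 8)\<^sup>2) powr (- ((N - 2 * s) / 2)) = (W / 8) powr (- (N - 2 * s))"
  proof -
    have "(W / 8)\<^sup>2 = (W / 8) powr 2" using W0 by (simp add: powr_numeral)
    then show ?thesis by (simp only: powr_powr) (rule arg_cong[where f="\<lambda>u. (W / 8) powr u"], simp add: field_simps)
  qed
  also have "\<dots> = 8 powr (N - 2 * s) * W powr (2 * s - N)"
  proof -
    have "(8::real) powr (- (N - 2 * s)) = 1 / 8 powr (N - 2 * s)" by (rule powr_minus_divide)
    then show ?thesis by (simp add: powr_divide)
  qed
  finally have "h powr (- (N + 2 * s - 2)) * P powr (- ((N - 2 * s) / 2)) \<le>
    h powr (- (N + 2 * s - 2)) * (8 powr (N - 2 * s) * W powr (2 * s - N))" by (intro mult_left_mono) auto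
  then show ?thesis using eq by (simp only: h_def W_def mult_ac)
qed

text \<open>Kernel majorant and both volume densities relative to Lebesgue measure, without the
  factor \<open>4^N\<close>.\<close>

definition kernel_weight :: "real \<Rightarrow> 'a::euclidean_space \<Rightarrow> 'a \<Rightarrow> real" where
  "kernel_weight s x y = kernel_bound DIM('a) s (hyp_q x y) / ((1 - (norm x)\<^sup>2) ^ DIM('a) * (1 - (norm y)\<^sup>2) ^ DIM('a))"

lemma kernel_weight_measurable [measurable (raw)]:
  assumes [measurable]: "f \<in> borel_measurable M" "g \<in> borel_measurable M"
  shows "(\<lambda>x. kernel_weight s (f x) (g x)) \<in> borel_measurable M"
  unfolding kernel_weight_def by measurable

lemma hyp_q_commute: "hyp_q x y = hyp_q y x"
  by (simp add: hyp_q_def norm_minus_commute mult.commute)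

lemma kernel_weight_commute: "kernel_weight s x y = kernel_weight s y x"
  by (simp add: kernel_weight_def hyp_q_commute[of x y] mult.commute)

lemma kernel_weight_nonneg: "norm x < 1 \<Longrightarrow> norm y < 1 \<Longrightarrow> kernel_weight s x y \<ge> 0"
  by (simp add: kernel_weight_def kernel_bound_nonneg less_imp_le power_less_one_iff)

context ball_C1
begin

text \<open>The metric is conformal, so \<open>|grad|^2 dV\<close> carries the power
  \<open>N - 2\<close> of \<open>2 / (1 - |x|^2)\<close>. Here and in \<open>mass\<close> the powers
  \<open>2^(N-2)\<close> and \<open>2^N\<close> are left out.\<close>

definition energy :: ennreal where
  "energy = (\<integral>\<^sup>+x. ennreal ((norm (g x))\<^sup>2 / (1 - (norm x)\<^sup>2) ^ (DIM('a) - 2)) * indicator (ball 0 1) x \<partial>lborel)"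

definition mass :: ennreal where
  "mass = (\<integral>\<^sup>+x. ennreal ((\<phi> x)\<^sup>2 / (1 - (norm x)\<^sup>2) ^ DIM('a)) * indicator (ball 0 1) x \<partial>lborel)"

text \<open>With \<open>h = x - y\<close>, the gradient is taken at \<open>w = y + \<tau> h\<close>.
  Integrating in \<open>y\<close> first, for fixed \<open>h\<close> and \<open>\<tau>\<close>, makes
  the passage to \<open>w\<close> a mere translation, without a Jacobian in \<open>\<tau>\<close>.
  Integrating in \<open>h\<close> last, for fixed \<open>w\<close>, converges because
  \<open>p = N + 2s - 2\<close> is below \<open>N\<close>.\<close>

lemma near_part_le:
  fixes s :: real
  assumes N: "DIM('a) \<ge> 2" and s: "0 < s" "s < 1"
  defines "C \<equiv> 8 powr (DIM('a) - 2 * s) * (DIM('a) / (2 - 2 * s) * measure lborel (ball (0::'a) 1) * 2 powr (2 - 2 * s))"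
  shows "(\<integral>\<^sup>+y. \<integral>\<^sup>+x. ennreal ((\<phi> x - \<phi> y)\<^sup>2 * kernel_weight s x y) *
      (if norm x < 1 \<and> norm y < 1 \<and> hyp_q x y \<le> 1/8 then 1 else 0) \<partial>lborel \<partial>lborel) \<le> ennreal C * energy"
proof -
  let ?N = "DIM('a)"
  let ?S = "\<lambda>x y. ennreal ((\<phi> x - \<phi> y)\<^sup>2 * kernel_weight s x y) *
    (if norm x < 1 \<and> norm y < 1 \<and> hyp_q x y \<le> 1/8 then 1 else 0)"
  define p where "p = ?N + 2 * s - 2"
  define A where "A = 8 powr (?N - 2 * s)"
  \<comment> \<open>The restriction \<open>|h| < 2 (1 - |w|^2)\<close> retains from
    \<open>near_segment\<close> what is needed to integrate in \<open>h\<close>; all other traces of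
    \<open>x\<close> and \<open>y\<close> are dropped.\<close>
  define H where "H w h = ennreal (A * norm h powr (-p)) * ennreal ((norm (g w))\<^sup>2 * (1 - (norm w)\<^sup>2) powr (2 * s - ?N)) *
     (if norm w < 1 \<and> norm h < 2 * (1 - (norm w)\<^sup>2) then 1 else 0)" for w h :: 'a
  have H_measurable [measurable (raw)]: "(\<lambda>u. H (a u) (b u)) \<in> borel_measurable M"
    if [measurable]: "a \<in> borel_measurable M" "b \<in> borel_measurable M" for a b and M :: "'m measure"
    unfolding H_def by measurable
  have pw: "?S x y
    \<le> (\<integral>\<^sup>+\<tau>. H (y + \<tau> *\<^sub>R (x - y)) (x - y) * indicator {0..1} \<tau> \<partial>lborel)" for x y
  proof (cases "norm x < 1 \<and> norm y < 1 \<and> hyp_q x y \<le> 1/8 \<and> x \<noteq> y")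
    case False
    then show ?thesis by auto
  next
    case True
    then have x: "norm x < 1" and y: "norm y < 1" and q: "hyp_q x y \<le> 1/8" and ne: "x \<noteq> y" by auto
    have kw: "kernel_weight s x y \<ge> 0" using x y by (rule kernel_weight_nonneg)
    have "ennreal ((\<phi> x - \<phi> y)\<^sup>2 * kernel_weight s x y) = ennreal (kernel_weight s x y) * ennreal ((\<phi> (y + (x - y)) - \<phi> y)\<^sup>2)"
      using kw by (simp add: ennreal_mult'[symmetric] mult.commute)
    also have "\<dots> \<le> ennreal (kernel_weight s x y) * (ennreal ((norm (x - y))\<^sup>2) *
       (\<integral>\<^sup>+\<tau>. ennreal ((norm (g (y + \<tau> *\<^sub>R (x - y))))\<^sup>2) * indicator {0..1} \<tau> \<partial>lborel))"
      by (intro mult_left_mono diff_square_le) auto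
    also have "\<dots> = (\<integral>\<^sup>+\<tau>. ennreal (kernel_weight s x y * (norm (x - y))\<^sup>2) *
       (ennreal ((norm (g (y + \<tau> *\<^sub>R (x - y))))\<^sup>2) * indicator {0..1} \<tau>) \<partial>lborel)"
      using kw by (subst nn_integral_cmult) (auto simp: ennreal_mult' mult.assoc)
    also have "\<dots> \<le> (\<integral>\<^sup>+\<tau>. H (y + \<tau> *\<^sub>R (x - y)) (x - y) * indicator {0..1} \<tau> \<partial>lborel)"
    proof (intro nn_integral_mono)
      fix \<tau> :: real
      show "ennreal (kernel_weight s x y * (norm (x - y))\<^sup>2) * (ennreal ((norm (g (y + \<tau> *\<^sub>R (x - y))))\<^sup>2) * indicator {0..1} \<tau>)
        \<le> H (y + \<tau> *\<^sub>R (x - y)) (x - y) * indicator {0..1} \<tau>"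
      proof (cases "\<tau> \<in> {0..1}")
        case True
        then have \<tau>: "0 \<le> \<tau>" "\<tau> \<le> 1" by auto
        define w where "w = y + \<tau> *\<^sub>R (x - y)"
        have ns: "norm w < 1" "norm (x - y) < 2 * (1 - (norm w)\<^sup>2)"
          using near_segment[OF x y q \<tau>] by (auto simp: w_def)
        have "kernel_weight s x y * (norm (x - y))\<^sup>2 * (norm (g w))\<^sup>2 \<le>
          A * norm (x - y) powr (- p) * (1 - (norm w)\<^sup>2) powr (2 * s - ?N) * (norm (g w))\<^sup>2"
          unfolding kernel_weight_def A_def p_def w_def
          using kernel_bound_near_le[OF x y q \<tau> ne N s(2)] by (intro mult_right_mono) auto
        then show ?thesis using True ns kw
          by (simp add: H_def w_def[symmetric] ennreal_mult'[symmetric] A_def ennreal_leI mult_ac)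
      qed simp
    qed
    finally show ?thesis using True by simp
  qed
  have "(\<integral>\<^sup>+y. \<integral>\<^sup>+x. ?S x y \<partial>lborel \<partial>lborel)
    \<le> (\<integral>\<^sup>+y. \<integral>\<^sup>+x. \<integral>\<^sup>+\<tau>. H (y + \<tau> *\<^sub>R (x - y)) (x - y) * indicator {0..1} \<tau> \<partial>lborel \<partial>lborel \<partial>lborel)"
    by (intro nn_integral_mono pw)
  also have "\<dots> = (\<integral>\<^sup>+y. \<integral>\<^sup>+h. \<integral>\<^sup>+\<tau>. H (y + \<tau> *\<^sub>R h) h * indicator {0..1} \<tau> \<partial>lborel \<partial>lborel \<partial>lborel)"
  proof (rule nn_integral_cong)
    fix y :: 'a
    have "(\<lambda>x. \<integral>\<^sup>+\<tau>. H (y + \<tau> *\<^sub>R (x - y)) (x - y) * indicator {0..1} \<tau> \<partial>lborel) \<in> borel_measurable borel"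
      by measurable
    from nn_integral_lborel_translation[OF this, of y, symmetric]
    show "(\<integral>\<^sup>+x. \<integral>\<^sup>+\<tau>. H (y + \<tau> *\<^sub>R (x - y)) (x - y) * indicator {0..1} \<tau> \<partial>lborel \<partial>lborel) =
      (\<integral>\<^sup>+h. \<integral>\<^sup>+\<tau>. H (y + \<tau> *\<^sub>R h) h * indicator {0..1} \<tau> \<partial>lborel \<partial>lborel)" by simp
  qed
  also have "\<dots> = (\<integral>\<^sup>+h. \<integral>\<^sup>+y. \<integral>\<^sup>+\<tau>. H (y + \<tau> *\<^sub>R h) h * indicator {0..1} \<tau> \<partial>lborel \<partial>lborel \<partial>lborel)"
    by (rule lborel_pair.Fubini') measurable
  also have "\<dots> = (\<integral>\<^sup>+h. \<integral>\<^sup>+\<tau>. \<integral>\<^sup>+y. H (y + \<tau> *\<^sub>R h) h * indicator {0..1} \<tau> \<partial>lborel \<partial>lborel \<partial>lborel)"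
    by (intro nn_integral_cong lborel_pair.Fubini') measurable
  also have "\<dots> = (\<integral>\<^sup>+h. \<integral>\<^sup>+\<tau>. (\<integral>\<^sup>+w. H w h \<partial>lborel) * indicator {0..1::real} \<tau> \<partial>lborel \<partial>lborel)"
  proof (intro nn_integral_cong)
    fix h :: 'a and \<tau> :: real
    have "(\<integral>\<^sup>+y. H (y + \<tau> *\<^sub>R h) h * indicator {0..1} \<tau> \<partial>lborel) = (\<integral>\<^sup>+y. H (y + \<tau> *\<^sub>R h) h \<partial>lborel) * indicator {0..1} \<tau>"
      by (rule nn_integral_multc) measurable
    also have "(\<integral>\<^sup>+y. H (y + \<tau> *\<^sub>R h) h \<partial>lborel) = (\<integral>\<^sup>+w. H w h \<partial>lborel)"
      using nn_integral_lborel_translation[of "\<lambda>w. H w h" "\<tau> *\<^sub>R h"] by (simp add: add.commute)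
    finally show "(\<integral>\<^sup>+y. H (y + \<tau> *\<^sub>R h) h * indicator {0..1} \<tau> \<partial>lborel) = (\<integral>\<^sup>+w. H w h \<partial>lborel) * indicator {0..1} \<tau>" .
  qed
  \<comment> \<open>The inner integral no longer contains \<open>\<tau>\<close>, which runs over an
    interval of measure 1.\<close>
  also have "\<dots> = (\<integral>\<^sup>+h. \<integral>\<^sup>+w. H w h \<partial>lborel \<partial>lborel)"
    by (intro nn_integral_cong, subst nn_integral_cmult_indicator) auto
  also have "\<dots> = (\<integral>\<^sup>+w. \<integral>\<^sup>+h. H w h \<partial>lborel \<partial>lborel)"
    by (rule lborel_pair.Fubini') measurable
  also have "\<dots> \<le> (\<integral>\<^sup>+w. ennreal C * (ennreal ((norm (g w))\<^sup>2 / (1 - (norm w)\<^sup>2) ^ (?N - 2)) * indicator (ball 0 1) w) \<partial>lborel)"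
  proof (rule nn_integral_mono)
    fix w :: 'a
    show "(\<integral>\<^sup>+h. H w h \<partial>lborel) \<le> ennreal C * (ennreal ((norm (g w))\<^sup>2 / (1 - (norm w)\<^sup>2) ^ (?N - 2)) * indicator (ball 0 1) w)"
    proof (cases "norm w < 1")
      case False
      then show ?thesis by (simp add: H_def)
    next
      case True
      define W where "W = 1 - (norm w)\<^sup>2"
      have W: "W > 0" using True by (simp add: W_def power_less_one_iff)
      define B where "B = A * ((norm (g w))\<^sup>2 * W powr (2 * s - ?N))"
      have B: "B \<ge> 0" by (simp add: B_def A_def)
      have "(\<integral>\<^sup>+h. H w h \<partial>lborel) = (\<integral>\<^sup>+h. ennreal B * (ennreal (norm h powr (-p)) * indicator (ball (0::'a) (2 * W)) h) \<partial>lborel)"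
        using True by (intro nn_integral_cong)
          (auto simp: H_def B_def A_def W_def indicator_def ennreal_mult'[symmetric] mult_ac)
      also have "\<dots> = ennreal B * (\<integral>\<^sup>+h. (ennreal (norm h powr (-p)) * indicator (ball (0::'a) (2 * W)) h) \<partial>lborel)"
        by (rule nn_integral_cmult) measurable
      also have "\<dots> = ennreal B * ennreal (?N / (?N - p) * measure lborel (ball (0::'a) 1) * (2 * W) powr (?N - p))"
        using s W by (subst nn_integral_norm_powr_ball) (auto simp: p_def)
      also have "\<dots> = ennreal (B * (?N / (?N - p) * measure lborel (ball (0::'a) 1) * (2 * W) powr (?N - p)))"
        using B by (rule ennreal_mult'[symmetric])
      also have "B * (?N / (?N - p) * measure lborel (ball (0::'a) 1) * (2 * W) powr (?N - p)) =
        C * ((norm (g w))\<^sup>2 * (W powr (2 * s - ?N) * W powr (2 - 2 * s)))"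
        using W by (simp add: B_def C_def A_def p_def powr_mult)
      also have "W powr (2 * s - ?N) * W powr (2 - 2 * s) = 1 / W ^ (?N - 2)"
      proof -
        have "W powr (2 * s - ?N) * W powr (2 - 2 * s) = W powr (- real (?N - 2))"
          unfolding powr_add[symmetric] using N by (intro arg_cong[where f="\<lambda>u. W powr u"]) (simp add: of_nat_diff)
        then show ?thesis using W by (simp only: powr_minus_divide powr_realpow)
      qed
      finally show ?thesis using True s by (simp add: W_def C_def ennreal_mult'[symmetric])
    qed
  qed
  also have "\<dots> = ennreal C * energy"
    unfolding energy_def by (rule nn_integral_cmult) measurable
  finally show ?thesis .
qed

text \<open>No cancellation is used: \<open>(\<phi> x - \<phi> y)^2 \<le> 2 (\<phi> x)^2 + 2 (\<phi>
  y)^2\<close>. The symmetry of the weight makes both terms equal after Tonelli, whence the factor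
  4, and in one of them the kernel is integrated in \<open>x\<close> alone.\<close>

lemma far_part_le:
  fixes s C :: real
  assumes C: "\<And>y::'a. norm y < 1 \<Longrightarrow>
    (\<integral>\<^sup>+x. ennreal (kernel_bound DIM('a) s (hyp_q x y) / (1 - (norm x)\<^sup>2) ^ DIM('a)) *
       indicator {x \<in> ball 0 1. hyp_q x y > 1/8} x \<partial>lborel) \<le> ennreal C"
  shows "(\<integral>\<^sup>+y. \<integral>\<^sup>+x. ennreal ((\<phi> x - \<phi> y)\<^sup>2 * kernel_weight s x y) *
      (if norm x < 1 \<and> norm y < 1 \<and> hyp_q x y > 1/8 then 1 else 0) \<partial>lborel \<partial>lborel) \<le> ennreal C * (4 * mass)"
proof -
  let ?N = "DIM('a)"
  let ?K = "\<lambda>x y. ennreal (kernel_bound ?N s (hyp_q x y) / (1 - (norm x)\<^sup>2) ^ ?N) *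
    indicator {x \<in> ball 0 1. hyp_q x y > 1/8} x"
  let ?S = "\<lambda>x y. ennreal ((\<phi> x - \<phi> y)\<^sup>2 * kernel_weight s x y) *
    (if norm x < 1 \<and> norm y < 1 \<and> hyp_q x y > 1/8 then 1 else 0)"
  define T where "T x y = ennreal ((\<phi> y)\<^sup>2 * kernel_weight s x y) *
      (if norm x < 1 \<and> norm y < 1 \<and> hyp_q x y > 1/8 then 1 else 0)" for x y :: 'a
  have T_measurable [measurable (raw)]: "(\<lambda>u. T (a u) (b u)) \<in> borel_measurable M"
    if [measurable]: "a \<in> borel_measurable M" "b \<in> borel_measurable M" for a b and M :: "'m measure"
    unfolding T_def by measurable
  have "(\<integral>\<^sup>+y. \<integral>\<^sup>+x. ?S x y \<partial>lborel \<partial>lborel)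
    \<le> (\<integral>\<^sup>+y. \<integral>\<^sup>+x. 2 * (T x y + T y x) \<partial>lborel \<partial>lborel)"
  proof (intro nn_integral_mono)
    fix x y :: 'a
    show "?S x y \<le> 2 * (T x y + T y x)"
    proof (cases "norm x < 1 \<and> norm y < 1 \<and> hyp_q x y > 1/8")
      case True
      then have kw: "kernel_weight s x y \<ge> 0" by (intro kernel_weight_nonneg) auto
      have "(\<phi> x - \<phi> y)\<^sup>2 \<le> 2 * ((\<phi> y)\<^sup>2 + (\<phi> x)\<^sup>2)"
        using zero_le_power2[of "\<phi> x + \<phi> y"] by (simp add: power2_eq_square algebra_simps)
      then have "(\<phi> x - \<phi> y)\<^sup>2 * kernel_weight s x y \<le> 2 * ((\<phi> y)\<^sup>2 + (\<phi> x)\<^sup>2) * kernel_weight s x y"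
        using kw by (rule mult_right_mono)
      also have "\<dots> = 2 * ((\<phi> y)\<^sup>2 * kernel_weight s x y + (\<phi> x)\<^sup>2 * kernel_weight s x y)" by (simp add: algebra_simps)
      finally have "ennreal ((\<phi> x - \<phi> y)\<^sup>2 * kernel_weight s x y) \<le>
         ennreal (2 * ((\<phi> y)\<^sup>2 * kernel_weight s x y + (\<phi> x)\<^sup>2 * kernel_weight s x y))" by (rule ennreal_leI)
      also have "\<dots> = 2 * (ennreal ((\<phi> y)\<^sup>2 * kernel_weight s x y) + ennreal ((\<phi> x)\<^sup>2 * kernel_weight s x y))"
        using kw by (simp add: ennreal_mult' ennreal_plus)
      finally show ?thesis using True by (simp add: T_def hyp_q_commute[of y x] kernel_weight_commute[of s y x])
    qed auto
  qed
  also have "\<dots> = (\<integral>\<^sup>+y. 2 * ((\<integral>\<^sup>+x. T x y \<partial>lborel) + (\<integral>\<^sup>+x. T y x \<partial>lborel)) \<partial>lborel)"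
    by (intro nn_integral_cong, subst nn_integral_cmult, measurable, subst nn_integral_add) measurable
  also have "\<dots> = 2 * ((\<integral>\<^sup>+y. \<integral>\<^sup>+x. T x y \<partial>lborel \<partial>lborel) + (\<integral>\<^sup>+y. \<integral>\<^sup>+x. T y x \<partial>lborel \<partial>lborel))"
    by (subst nn_integral_cmult, measurable, subst nn_integral_add) measurable
  also have "(\<integral>\<^sup>+y. \<integral>\<^sup>+x. T y x \<partial>lborel \<partial>lborel) = (\<integral>\<^sup>+y. \<integral>\<^sup>+x. T x y \<partial>lborel \<partial>lborel)"
    by (rule lborel_pair.Fubini') measurable
  also have "(\<integral>\<^sup>+y. \<integral>\<^sup>+x. T x y \<partial>lborel \<partial>lborel) \<le>
    (\<integral>\<^sup>+y. ennreal C * (ennreal ((\<phi> y)\<^sup>2 / (1 - (norm y)\<^sup>2) ^ ?N) * indicator (ball 0 1) y) \<partial>lborel)"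
  proof (rule nn_integral_mono)
    fix y :: 'a
    show "(\<integral>\<^sup>+x. T x y \<partial>lborel) \<le> ennreal C * (ennreal ((\<phi> y)\<^sup>2 / (1 - (norm y)\<^sup>2) ^ ?N) * indicator (ball 0 1) y)"
    proof (cases "norm y < 1")
      case False
      then show ?thesis by (simp add: T_def)
    next
      case True
      then have e: "1 - (norm y)\<^sup>2 > 0" by (simp add: power_less_one_iff)
      have "(\<integral>\<^sup>+x. T x y \<partial>lborel) = (\<integral>\<^sup>+x. ennreal ((\<phi> y)\<^sup>2 / (1 - (norm y)\<^sup>2) ^ ?N) *
        (?K x y) \<partial>lborel)"
        using True e by (intro nn_integral_cong)
          (auto simp: T_def kernel_weight_def indicator_def ennreal_mult'[symmetric] mult_ac)
      also have "\<dots> = ennreal ((\<phi> y)\<^sup>2 / (1 - (norm y)\<^sup>2) ^ ?N) *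
        (\<integral>\<^sup>+x. (?K x y) \<partial>lborel)"
      proof (rule nn_integral_cmult)
        show "(\<lambda>x. ?K x y) \<in> borel_measurable lborel"
          by measurable
      qed
      also have "\<dots> \<le> ennreal ((\<phi> y)\<^sup>2 / (1 - (norm y)\<^sup>2) ^ ?N) * ennreal C"
        by (intro mult_left_mono C True) auto
      finally show ?thesis using True by (simp add: mult.commute)
    qed
  qed
  also have "\<dots> = ennreal C * mass"
    unfolding mass_def by (rule nn_integral_cmult) measurable
  finally have "(\<integral>\<^sup>+y. \<integral>\<^sup>+x. ?S x y \<partial>lborel \<partial>lborel) \<le> 2 * (ennreal C * mass + ennreal C * mass)"
    by (simp add: add_mono mult_left_mono)
  also have "\<dots> = ennreal C * (4 * mass)"
  proof -
    have "(4::ennreal) = 2 * 2" by simp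
    then show ?thesis by (simp only: mult_2[symmetric] mult.assoc mult.left_commute)
  qed
  finally show ?thesis .
qed

end

section \<open>The Poincare inequality\<close>

text \<open>Translation invariance annihilates the integrals of the difference quotients.\<close>

lemma integral_directional_derivative_eq_0:
  fixes \<psi> :: "'a::euclidean_space \<Rightarrow> real" and b :: 'a
  assumes deriv: "\<And>x. (\<psi> has_derivative D x) (at x)"
    and cont: "continuous_on UNIV (\<lambda>x. D x b)"
    and supp: "\<And>x. norm x \<ge> R \<Longrightarrow> \<psi> x = 0"
  shows "(\<integral>x. D x b \<partial>lborel) = 0"
proof -
  have cpsi: "continuous_on A \<psi>" for A
    using deriv by (meson continuous_at_imp_continuous_on has_derivative_continuous)
  have [measurable]: "\<psi> \<in> borel_measurable borel" "(\<lambda>x. D x b) \<in> borel_measurable borel"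
    by (auto intro!: borel_measurable_continuous_onI cpsi cont)
  have int: "integrable lborel \<psi>"
  proof -
    have "integrable lborel (\<lambda>x. indicator (cball 0 R) x *\<^sub>R \<psi> x)"
      by (intro borel_integrable_compact cpsi) simp
    also have "(\<lambda>x. indicator (cball 0 R) x *\<^sub>R \<psi> x) = \<psi>"
      using supp by (auto simp: indicator_def fun_eq_iff)
    finally show ?thesis .
  qed
  \<comment> \<open>Difference quotients with increments at most \<open>b\<close> vanish outside the
    ball of radius \<open>S\<close>. Inside it the mean value theorem evaluates \<open>D\<close>
    within radius \<open>S + norm b\<close>, which gives a constant majorant for dominated
    convergence.\<close>
  define S where "S = \<bar>R\<bar> + norm b"
  have "compact ((\<lambda>x. D x b) ` cball 0 (S + norm b))"
    by (intro compact_continuous_image continuous_on_subset[OF cont]) auto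
  then have "bounded ((\<lambda>x. D x b) ` cball 0 (S + norm b))" by (rule compact_imp_bounded)
  then obtain B where "\<forall>x\<in>cball 0 (S + norm b). \<bar>D x b\<bar> \<le> B"
    unfolding bounded_iff by auto
  then have B: "\<bar>D x b\<bar> \<le> B" if "norm x \<le> S + norm b" for x
    using that by simp
  have line: "((\<lambda>t. \<psi> (x + t *\<^sub>R b)) has_real_derivative D (x + t *\<^sub>R b) b) (at t)" for x t
  proof -
    have "((\<lambda>t. x + t *\<^sub>R b) has_derivative (\<lambda>u. u *\<^sub>R b)) (at t)" by (auto intro!: derivative_eq_intros)
    from has_derivative_compose[OF this deriv]
    have "((\<lambda>t. \<psi> (x + t *\<^sub>R b)) has_derivative (\<lambda>u. D (x + t *\<^sub>R b) (u *\<^sub>R b))) (at t)" .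
    moreover have "linear (D (x + t *\<^sub>R b))" using deriv has_derivative_linear by blast
    then have "(\<lambda>u. D (x + t *\<^sub>R b) (u *\<^sub>R b)) = (*) (D (x + t *\<^sub>R b) b)"
      by (simp add: fun_eq_iff linear_scale)
    ultimately show ?thesis by (simp only: has_field_derivative_def)
  qed
  define u where "u n x = real (Suc n) * (\<psi> (x + (1 / Suc n) *\<^sub>R b) - \<psi> x)" for n x
  have u0: "(\<integral>x. u n x \<partial>lborel) = 0" for n
  proof -
    define c where "c = (1 / Suc n) *\<^sub>R b"
    have d: "distr lborel borel ((+) c) = lborel" by (rule lborel_distr_plus)
    have "integrable lborel (\<lambda>x. \<psi> (c + x))"
      using int integrable_distr_eq[of "(+) c" lborel borel \<psi>] d by simp
    moreover have "(\<integral>x. \<psi> (c + x) \<partial>lborel) = (\<integral>x. \<psi> x \<partial>lborel)"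
      using integral_distr[of "(+) c" lborel borel \<psi>] d by simp
    ultimately have "integrable lborel (\<lambda>x. \<psi> ((1 / Suc n) *\<^sub>R b + x))"
      "(\<integral>x. \<psi> ((1 / Suc n) *\<^sub>R b + x) \<partial>lborel) = (\<integral>x. \<psi> x \<partial>lborel)" by (simp_all only: c_def)
    then show ?thesis using int unfolding u_def by (simp add: add.commute)
  qed
  have ub: "\<bar>u n x\<bar> \<le> indicator (cball 0 S) x *\<^sub>R B" for n x
  proof -
    obtain t where t: "0 < t" "t < 1 / Suc n" "\<psi> (x + (1 / Suc n) *\<^sub>R b) - \<psi> (x + 0 *\<^sub>R b) = (1 / Suc n - 0) * D (x + t *\<^sub>R b) b"
      using MVT2[of 0 "1 / real (Suc n)" "\<lambda>t. \<psi> (x + t *\<^sub>R b)" "\<lambda>t. D (x + t *\<^sub>R b) b"] line by auto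
    have t1: "t \<le> 1" using t(2) by (rule order.trans[OF less_imp_le]) simp
    have ue: "u n x = D (x + t *\<^sub>R b) b" using t(3) by (simp add: u_def)
    show ?thesis
    proof (cases "norm x \<le> S")
      case True
      have "norm (x + t *\<^sub>R b) \<le> S + norm b"
        using norm_triangle_ineq[of x "t *\<^sub>R b"] True t t1 mult_left_le_one_le[of "norm b" t] by simp
      then show ?thesis using True B ue by simp
    next
      case False
      have "norm x - norm ((1 / Suc n) *\<^sub>R b) \<le> norm (x + (1 / Suc n) *\<^sub>R b)" by (rule norm_diff_ineq)
      moreover have "norm ((1 / Suc n) *\<^sub>R b) \<le> norm b" by (simp add: divide_le_eq mult_le_cancel_left1)
      ultimately have "norm (x + (1 / Suc n) *\<^sub>R b) \<ge> R" "norm x \<ge> R" using False norm_ge_zero[of b] unfolding S_def by linarith+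
      then show ?thesis using False supp by (simp add: u_def)
    qed
  qed
  have "(\<lambda>n. \<integral>x. u n x \<partial>lborel) \<longlonglongrightarrow> (\<integral>x. D x b \<partial>lborel)"
  proof (rule integral_dominated_convergence[where w="\<lambda>x. indicator (cball 0 S) x *\<^sub>R B"])
    show "integrable lborel (\<lambda>x::'a. indicator (cball 0 S) x *\<^sub>R B)"
      by (intro borel_integrable_compact) auto
    show "AE x in lborel. (\<lambda>n. u n x) \<longlonglongrightarrow> D x b"
    proof (rule AE_I2)
      fix x
      have "((\<lambda>h. (\<psi> (x + (0 + h) *\<^sub>R b) - \<psi> (x + 0 *\<^sub>R b)) / h) \<longlongrightarrow> D (x + 0 *\<^sub>R b) b) (at 0)"
        using line[of x 0] unfolding DERIV_def .
      moreover have "filterlim (\<lambda>n. 1 / real (Suc n)) (at 0) sequentially"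
        unfolding filterlim_at using LIMSEQ_Suc[OF lim_1_over_n] by auto
      ultimately have "(\<lambda>n. (\<psi> (x + (0 + 1 / real (Suc n)) *\<^sub>R b) - \<psi> (x + 0 *\<^sub>R b)) / (1 / real (Suc n))) \<longlonglongrightarrow> D (x + 0 *\<^sub>R b) b"
        by (rule filterlim_compose)
      then show "(\<lambda>n. u n x) \<longlonglongrightarrow> D x b" by (simp add: u_def mult.commute)
    qed
    show "AE x in lborel. norm (u n x) \<le> indicator (cball 0 S) x *\<^sub>R B" for n
      using ub by auto
    show "u n \<in> borel_measurable lborel" for n unfolding u_def by measurable
  qed measurable
  then show ?thesis unfolding u0 by (simp add: LIMSEQ_const_iff)
qed

context ball_C1
begin

text \<open>Lets fractions with denominator \<open>1 - |x|^2\<close> count as globally continuous: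
  the denominator is positive on the ball of radius \<open>R\<close>, and beyond it the numerator
  vanishes.\<close>

lemma continuous_on_ball_fraction:
  fixes F :: "'a \<Rightarrow> real"
  assumes "continuous_on (cball 0 R) F" and "\<And>x. norm x \<ge> R \<Longrightarrow> F x = 0"
  shows "continuous_on UNIV F"
proof -
  have "continuous_on (cball 0 R \<union> - ball 0 R) F"
  proof (rule continuous_on_closed_Un)
    show "continuous_on (- ball 0 R) F"
      by (rule continuous_on_eq[of _ "\<lambda>_. 0"]) (use assms(2) in auto)
  qed (use assms in \<open>auto simp: closed_Compl\<close>)
  moreover have "cball 0 R \<union> - ball 0 R = (UNIV :: 'a set)" by auto
  ultimately show ?thesis by simp
qed

text \<open>Integrates the divergence of \<open>\<phi>\<^sup>2 X\<close> with \<open>X(x) = x (1 - |x|\<^sup>2)\<^sup>1\<^sup>-\<^sup>N\<close>, for which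
  \<open>div X \<ge> N (1 - |x|\<^sup>2)\<^sup>-\<^sup>N\<close>.\<close>

lemma poincare:
  assumes N: "DIM('a) \<ge> 2"
  shows "mass \<le> energy" "energy < \<infinity>"
proof -
  let ?N = "DIM('a)"
  define n where "n = ?N - 1"
  have n: "?N = Suc n" "n \<ge> 1" using N by (auto simp: n_def)
  define \<epsilon> where "\<epsilon> x = 1 - (norm x)\<^sup>2" for x :: 'a
  have \<epsilon>: "\<epsilon> x = 1 - x \<bullet> x" for x by (simp add: \<epsilon>_def power2_norm_eq_inner)
  have e0: "\<epsilon> x > 0" if "norm x < 1" for x using that by (simp add: \<epsilon>_def power_less_one_iff)
  have eR: "\<epsilon> x > 0" if "x \<in> cball 0 R" for x using that R by (intro e0) auto
  \<comment> \<open>The component of \<open>\<phi>^2 X\<close> in direction \<open>b\<close>;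
    \<open>D b\<close> is its derivative by the product rule.\<close>
  define \<psi> where "\<psi> b x = (\<phi> x)\<^sup>2 * (x \<bullet> b) / \<epsilon> x ^ n" for b x
  define D where "D b x h = 2 * \<phi> x * (g x \<bullet> h) * (x \<bullet> b) / \<epsilon> x ^ n + (\<phi> x)\<^sup>2 * (h \<bullet> b) / \<epsilon> x ^ n
     + (\<phi> x)\<^sup>2 * (x \<bullet> b) * (2 * n * (x \<bullet> h)) / \<epsilon> x ^ Suc n" for b x h
  have D: "(\<psi> b has_derivative D b x) (at x)" for b x
  proof (cases "norm x < 1")
    case True
    have e: "\<epsilon> x > 0" using e0[OF True] .
    have de: "(\<epsilon> has_derivative (\<lambda>h. - 2 * (x \<bullet> h))) (at x)"
      unfolding \<epsilon>[abs_def] by (auto intro!: derivative_eq_intros simp: inner_commute)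
    have d1: "((\<lambda>x. (\<phi> x)\<^sup>2) has_derivative (\<lambda>h. 2 * \<phi> x * (g x \<bullet> h))) (at x)"
      by (auto intro!: derivative_eq_intros deriv)
    have d2: "((\<lambda>x. x \<bullet> b) has_derivative (\<lambda>h. h \<bullet> b)) (at x)"
      by (auto intro!: derivative_eq_intros)
    have "((\<lambda>t. t ^ n) has_real_derivative n * \<epsilon> x ^ (n - 1)) (at (\<epsilon> x))"
      using DERIV_pow[of n "\<epsilon> x"] by simp
    from DERIV_inverse_fun[OF this]
    have "((\<lambda>t. inverse (t ^ n)) has_real_derivative - (n / \<epsilon> x ^ Suc n)) (at (\<epsilon> x))"
      by (rule DERIV_cong) (use e n in \<open>cases n; simp add: field_simps power2_eq_square\<close>)+
    from DERIV_compose_FDERIV[OF this de]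
    have d3: "((\<lambda>x. inverse (\<epsilon> x ^ n)) has_derivative (\<lambda>h. 2 * n * (x \<bullet> h) / \<epsilon> x ^ Suc n)) (at x)"
      by (rule has_derivative_eq_rhs) (simp add: fun_eq_iff)
    have "((\<lambda>x. (\<phi> x)\<^sup>2 * (x \<bullet> b) * inverse (\<epsilon> x ^ n)) has_derivative D b x) (at x)"
      by (rule has_derivative_eq_rhs[OF has_derivative_mult[OF has_derivative_mult[OF d1 d2] d3]])
         (simp add: fun_eq_iff D_def divide_inverse algebra_simps)
    then show ?thesis unfolding \<psi>_def[abs_def] by (simp add: divide_inverse)
  next
    case False
    \<comment> \<open>On the unit sphere the denominator vanishes, but since \<open>R < 1\<close>
      the function is identically 0 near such points.\<close>
    then have x: "x \<in> - cball 0 R" using R by simp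
    have "D b x = (\<lambda>_. 0)" using False R supp[of x] by (simp add: D_def fun_eq_iff)
    moreover have "(\<psi> b has_derivative (\<lambda>_. 0)) (at x)"
      by (rule has_derivative_transform_within_open[of "\<lambda>_. 0" _ _ _ "- cball 0 R"])
         (use x supp in \<open>auto simp: \<psi>_def\<close>)
    ultimately show ?thesis by simp
  qed
  have cD: "continuous_on UNIV (\<lambda>x. D b x h)" for b h
  proof (rule continuous_on_ball_fraction)
    have c: "continuous_on (cball 0 R) \<phi>" "continuous_on (cball 0 R) g"
      using cont cont_g by (auto intro: continuous_on_subset)
    show "continuous_on (cball 0 R) (\<lambda>x. D b x h)"
      unfolding D_def \<epsilon>_def[abs_def] using eR unfolding \<epsilon>_def
      by (intro continuous_intros c) (auto simp: less_imp_neq[THEN not_sym])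
  qed (auto simp: D_def supp)
  have int_comp: "integrable lborel F" if "continuous_on UNIV F" "\<And>x. norm x \<ge> R \<Longrightarrow> F x = 0" for F :: "'a \<Rightarrow> real"
  proof -
    have "integrable lborel (\<lambda>x. indicator (cball 0 R) x *\<^sub>R F x)"
      by (intro borel_integrable_compact continuous_on_subset[OF that(1)]) auto
    also have "(\<lambda>x. indicator (cball 0 R) x *\<^sub>R F x) = F"
      using that(2) by (auto simp: indicator_def fun_eq_iff)
    finally show ?thesis .
  qed
  have iD: "integrable lborel (\<lambda>x. D b x h)" for b h
    by (rule int_comp[OF cD]) (simp add: D_def supp)
  have I0: "(\<integral>x. D b x b \<partial>lborel) = 0" for b
    by (rule integral_directional_derivative_eq_0[OF D cD, of R]) (simp add: \<psi>_def supp)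
  \<comment> \<open>The divergence of \<open>\<phi>^2 X\<close>; its integral is 0.\<close>
  define J where "J x = (\<Sum>b\<in>Basis. D b x b)" for x
  have iJ: "integrable lborel J" "(\<integral>x. J x \<partial>lborel) = 0"
    unfolding J_def using iD I0 by auto
  have J: "J x = 2 * \<phi> x * (g x \<bullet> x) / \<epsilon> x ^ n + (\<phi> x)\<^sup>2 * ?N / \<epsilon> x ^ n + 2 * n * (\<phi> x)\<^sup>2 * (norm x)\<^sup>2 / \<epsilon> x ^ Suc n" for x
  proof -
    have "J x = 2 * \<phi> x / \<epsilon> x ^ n * (\<Sum>b\<in>Basis. (g x \<bullet> b) * (x \<bullet> b)) + (\<phi> x)\<^sup>2 / \<epsilon> x ^ n * (\<Sum>b\<in>(Basis::'a set). b \<bullet> b)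
      + 2 * n * (\<phi> x)\<^sup>2 / \<epsilon> x ^ Suc n * (\<Sum>b\<in>Basis. (x \<bullet> b) * (x \<bullet> b))"
      unfolding J_def D_def sum.distrib sum_distrib_left
      by (intro arg_cong2[where f="(+)"] sum.cong refl) (simp_all add: mult_ac)
    also have "(\<Sum>b\<in>(Basis::'a set). b \<bullet> b) = ?N" by simp
    also have "(\<Sum>b\<in>Basis. (g x \<bullet> b) * (x \<bullet> b)) = g x \<bullet> x" by (rule euclidean_inner[symmetric])
    also have "(\<Sum>b\<in>Basis. (x \<bullet> b) * (x \<bullet> b)) = (norm x)\<^sup>2" by (simp add: euclidean_inner[symmetric] power2_norm_eq_inner)
    finally show ?thesis by simp
  qed
  define U where "U x = (\<phi> x)\<^sup>2 / \<epsilon> x ^ ?N * indicator (ball 0 1) x" for x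
  define V where "V x = (norm (g x))\<^sup>2 / \<epsilon> x ^ (?N - 2) * indicator (ball 0 1) x" for x
  \<comment> \<open>Multiplied by \<open>e^N\<close>, the divergence term of \<open>J\<close>
    contributes at least \<open>2 \<phi>^2\<close>. The cross term \<open>2 |\<phi>| |g| e\<close>
    is absorbed by \<open>\<phi>^2 + |g|^2 e^2\<close>, so one \<open>\<phi>^2\<close>
    survives.\<close>
  have pt: "U x \<le> J x + V x" for x
  proof (cases "norm x < 1")
    case False
    then show ?thesis using R supp[of x] by (simp add: U_def V_def J)
  next
    case True
    define e where "e = \<epsilon> x"
    have e: "e > 0" using e0[OF True] by (simp add: e_def)
    have x2: "(norm x)\<^sup>2 = 1 - e" by (simp add: e_def \<epsilon>_def)
    define m where "m = n - 1"
    have m: "n = Suc m" "?N - 2 = m" "?N = Suc (Suc m)" using n by (auto simp: m_def)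
    have "\<bar>g x \<bullet> x\<bar> \<le> norm (g x) * norm x" by (rule Cauchy_Schwarz_ineq2)
    also have "\<dots> \<le> norm (g x)" using True by (simp add: mult_left_le)
    finally have gx: "\<bar>g x \<bullet> x\<bar> \<le> norm (g x)" .
    have "- (2 * \<phi> x * (g x \<bullet> x)) \<le> 2 * (\<bar>\<phi> x\<bar> * norm (g x))"
    proof -
      have "- (\<phi> x * (g x \<bullet> x)) \<le> \<bar>\<phi> x * (g x \<bullet> x)\<bar>" by simp
      also have "\<dots> \<le> \<bar>\<phi> x\<bar> * norm (g x)" unfolding abs_mult using gx by (intro mult_left_mono) auto
      finally show ?thesis by simp
    qed
    then have "- (2 * \<phi> x * (g x \<bullet> x)) * e \<le> 2 * (\<bar>\<phi> x\<bar> * norm (g x)) * e" using e by (intro mult_right_mono) auto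
    also have "\<dots> \<le> (\<phi> x)\<^sup>2 + (norm (g x))\<^sup>2 * e\<^sup>2"
      using zero_le_power2[of "\<bar>\<phi> x\<bar> - norm (g x) * e"] by (simp add: power2_eq_square algebra_simps)
    finally have c1: "- (2 * \<phi> x * (g x \<bullet> x)) * e \<le> (\<phi> x)\<^sup>2 + (norm (g x))\<^sup>2 * e\<^sup>2" .
    \<comment> \<open>This is \<open>e^N\<close> times \<open>div X\<close>. As
      \<open>n = N - 1\<close>, it equals \<open>N + (N - 2) (1 - e)\<close>, which is at least
      \<open>N\<close>.\<close>
    define k where "k = ?N * e + 2 * n * (1 - e)"
    have "2 * (\<phi> x)\<^sup>2 \<le> (\<phi> x)\<^sup>2 * k"
    proof -
      have "k = ?N + (2 * real n - ?N) * (1 - e)" by (simp add: k_def algebra_simps)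
      moreover have "(2 * real n - ?N) * (1 - e) \<ge> 0" using n by (simp add: x2[symmetric])
      ultimately have "k \<ge> 2" using N by linarith
      then show ?thesis using mult_left_mono[of 2 k "(\<phi> x)\<^sup>2"] by (simp add: mult.commute)
    qed
    moreover have "p \<le> a + r + q" if "- a \<le> p + q" "2 * p \<le> r" for a p q r :: real
      using that by linarith
    ultimately have "(\<phi> x)\<^sup>2 \<le> 2 * \<phi> x * (g x \<bullet> x) * e + (\<phi> x)\<^sup>2 * k + (norm (g x))\<^sup>2 * e\<^sup>2"
      using c1 by (simp only: mult_minus_left)
    then have "(\<phi> x)\<^sup>2 \<le> 2 * \<phi> x * (g x \<bullet> x) * e + (\<phi> x)\<^sup>2 * (?N * e + 2 * n * (1 - e)) + (norm (g x))\<^sup>2 * e\<^sup>2"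
      by (simp only: k_def)
    then have "(\<phi> x)\<^sup>2 / e ^ ?N \<le> (2 * \<phi> x * (g x \<bullet> x) * e + (\<phi> x)\<^sup>2 * (?N * e + 2 * n * (1 - e)) + (norm (g x))\<^sup>2 * e\<^sup>2) / e ^ ?N"
      using e by (intro divide_right_mono) auto
    also have "\<dots> = J x + (norm (g x))\<^sup>2 / e ^ (?N - 2)"
    proof -
      have e1: "e ^ ?N = e * e ^ n" and e2: "e ^ ?N = e\<^sup>2 * e ^ (?N - 2)" by (simp_all add: m power2_eq_square)
      have "2 * \<phi> x * (g x \<bullet> x) * e / e ^ ?N = 2 * \<phi> x * (g x \<bullet> x) / e ^ n"
        "(\<phi> x)\<^sup>2 * (?N * e) / e ^ ?N = (\<phi> x)\<^sup>2 * ?N / e ^ n" unfolding e1 using e by auto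
      moreover have "(norm (g x))\<^sup>2 * e\<^sup>2 / e ^ ?N = (norm (g x))\<^sup>2 / e ^ (?N - 2)" unfolding e2 using e by simp
      moreover have "(\<phi> x)\<^sup>2 * (2 * n * (1 - e)) / e ^ ?N = 2 * n * (\<phi> x)\<^sup>2 * (1 - e) / e ^ ?N" by (simp add: mult_ac)
      ultimately show ?thesis
        unfolding J e_def[symmetric] x2 n(1)[symmetric] by (simp only: add_divide_distrib distrib_left)
    qed
    finally show ?thesis using True by (simp add: U_def V_def e_def)
  qed
  have iU: "integrable lborel U"
  proof (rule int_comp)
    have c: "continuous_on (cball 0 R) \<phi>" using cont by (auto intro: continuous_on_subset)
    have "continuous_on (cball 0 R) (\<lambda>x. (\<phi> x)\<^sup>2 / \<epsilon> x ^ ?N)"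
      using eR unfolding \<epsilon>_def by (intro continuous_intros c) (auto simp: less_imp_neq[THEN not_sym])
    then have "continuous_on (cball 0 R) U"
      by (rule continuous_on_eq) (use R in \<open>auto simp: U_def\<close>)
    then show "continuous_on UNIV U"
      by (rule continuous_on_ball_fraction) (simp add: U_def supp)
  qed (simp add: U_def supp)
  have iV: "integrable lborel V"
  proof (rule int_comp)
    have c: "continuous_on (cball 0 R) g" using cont_g by (auto intro: continuous_on_subset)
    have "continuous_on (cball 0 R) (\<lambda>x. (norm (g x))\<^sup>2 / \<epsilon> x ^ (?N - 2))"
      using eR unfolding \<epsilon>_def by (intro continuous_intros c) (auto simp: less_imp_neq[THEN not_sym])
    then have "continuous_on (cball 0 R) V"
      by (rule continuous_on_eq) (use R in \<open>auto simp: V_def\<close>)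
    then show "continuous_on UNIV V"
      by (rule continuous_on_ball_fraction) (simp add: V_def supp)
  qed (simp add: V_def supp)
  have U0: "U x \<ge> 0" and V0: "V x \<ge> 0" for x
    using e0[of x] by (auto simp: U_def V_def indicator_def)
  have "(\<integral>x. U x \<partial>lborel) \<le> (\<integral>x. J x + V x \<partial>lborel)"
    using iU iV iJ pt by (intro integral_mono) auto
  also have "\<dots> = (\<integral>x. V x \<partial>lborel)" using iV iJ by simp
  finally have le: "ennreal (\<integral>x. U x \<partial>lborel) \<le> ennreal (\<integral>x. V x \<partial>lborel)" by (rule ennreal_leI)
  have U: "ennreal (\<integral>x. U x \<partial>lborel) = mass"
    unfolding nn_integral_eq_integral[OF iU AE_I2[OF U0], symmetric] mass_def
    by (intro nn_integral_cong) (auto simp: U_def \<epsilon>_def indicator_def)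
  have V: "ennreal (\<integral>x. V x \<partial>lborel) = energy"
    unfolding nn_integral_eq_integral[OF iV AE_I2[OF V0], symmetric] energy_def
    by (intro nn_integral_cong) (auto simp: V_def \<epsilon>_def indicator_def)
  show "mass \<le> energy" using le unfolding U V .
  show "energy < \<infinity>" unfolding V[symmetric] by simp
qed

end

section \<open>Test functions\<close>

text \<open>Compactness of the support inside the open ball provides the radius;
  \<open>euclid_grad\<close> represents the Frechet derivative with respect to the inner
  product.\<close>

lemma test_function_ball_C1:
  fixes \<phi> :: "'a::euclidean_space \<Rightarrow> real"
  assumes "\<phi> \<in> test_functions"
  shows "\<exists>R. ball_C1 \<phi> (euclid_grad \<phi>) R"
proof -
  define K where "K = closure {x. \<phi> x \<noteq> 0}"
  have smooth: "C_k k \<phi>" for k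
    using assms by (simp add: test_functions_def)
  have K: "compact K" "K \<subseteq> ball 0 1"
    using assms by (simp_all add: test_functions_def K_def)
  have diff: "\<phi> differentiable (at x)" for x using smooth[of 1] by simp
  have lin: "linear (frechet_derivative \<phi> (at x))" for x by (rule linear_frechet_derivative[OF diff])
  have grad: "euclid_grad \<phi> x \<bullet> h = frechet_derivative \<phi> (at x) h" for x h
  proof -
    have "frechet_derivative \<phi> (at x) h = frechet_derivative \<phi> (at x) (\<Sum>b\<in>Basis. (h \<bullet> b) *\<^sub>R b)"
      by (simp add: euclidean_representation)
    also have "\<dots> = (\<Sum>b\<in>Basis. (h \<bullet> b) * frechet_derivative \<phi> (at x) b)"
      by (simp add: linear_sum[OF lin] linear_scale[OF lin])
    finally show ?thesis unfolding euclid_grad_def inner_sum_left by (simp add: inner_commute mult.commute)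
  qed
  have deriv: "(\<phi> has_derivative (\<lambda>h. euclid_grad \<phi> x \<bullet> h)) (at x)" for x
    unfolding grad using diff by (simp add: frechet_derivative_works)
  have cont: "continuous_on UNIV (euclid_grad \<phi>)"
    unfolding euclid_grad_def[abs_def] using smooth[of 1] by (intro continuous_intros) auto
  have "\<exists>R. 0 < R \<and> R < 1 \<and> (\<forall>x\<in>K. norm x < R)"
  proof (cases "K = {}")
    case True
    then show ?thesis by (intro exI[of _ "1/2"]) auto
  next
    case False
    have "compact (norm ` K)" by (intro compact_continuous_image continuous_intros K)
    then obtain x where x: "x \<in> K" "\<And>y. y \<in> K \<Longrightarrow> norm y \<le> norm x"
      using compact_attains_sup[of "norm ` K"] False by auto
    then have x1: "norm x < 1" using K by auto
    \<comment> \<open>The midpoint between the largest norm on the support and 1 leaves strict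
      inequalities on both sides, so that both the function and its gradient vanish from radius
      \<open>R\<close> on.\<close>
    have "norm y < (1 + norm x) / 2" if "y \<in> K" for y using x(2)[OF that] x1 by argo
    moreover have "0 < (1 + norm x) / 2" "(1 + norm x) / 2 < 1" using x1 by (auto intro: add_pos_nonneg)
    ultimately show ?thesis by blast
  qed
  then obtain R where R: "0 < R" "R < 1" and KR: "\<And>x. x \<in> K \<Longrightarrow> norm x < R" by blast
  have z: "\<phi> x = 0" if "x \<notin> K" for x using that closure_subset[of "{x. \<phi> x \<noteq> 0}"] by (auto simp: K_def)
  have gz: "euclid_grad \<phi> x = 0" if "x \<notin> K" for x
  proof -
    have "(\<phi> has_derivative (\<lambda>_. 0)) (at x)"
      by (rule has_derivative_transform_within_open[of "\<lambda>_. 0" _ _ _ "- K"])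
         (use that z K(1) in \<open>auto simp: compact_imp_closed\<close>)
    then have "(\<lambda>h. euclid_grad \<phi> x \<bullet> h) = (\<lambda>_. 0)" using deriv has_derivative_unique by blast
    then show ?thesis by (metis inner_eq_zero_iff)
  qed
  have "ball_C1 \<phi> (euclid_grad \<phi>) R"
  proof
    show "\<phi> x = 0" "euclid_grad \<phi> x = 0" if "R \<le> norm x" for x
      using z[of x] gz[of x] KR[of x] that by force+
  qed (use deriv cont R in auto)
  then show ?thesis by blast
qed

section \<open>Hyperbolic volume as weighted Lebesgue measure\<close>

lemma space_hyp_vol [simp]: "space hyp_vol = ball 0 1"
  by (simp add: hyp_vol_def)

lemma borel_measurable_hyp_vol:
  "f \<in> borel_measurable borel \<Longrightarrow> f \<in> borel_measurable (hyp_vol :: 'a::euclidean_space measure)"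
  unfolding hyp_vol_def by (simp add: measurable_restrict_space1 measurable_completion)

text \<open>For Borel integrands the completion in \<open>hyp_vol\<close> is invisible; Tonelli,
  translations and polar coordinates are then available on \<open>lborel\<close>.\<close>

lemma nn_integral_hyp_vol:
  fixes F :: "'a::euclidean_space \<Rightarrow> ennreal"
  assumes F: "F \<in> borel_measurable borel"
  shows "(\<integral>\<^sup>+x. F x \<partial>hyp_vol) =
    (\<integral>\<^sup>+x. F x * ennreal ((2 / (1 - (norm x)\<^sup>2)) ^ DIM('a)) * indicator (ball 0 1) x \<partial>lborel)"
proof -
  have "(\<lambda>x::'a. ennreal ((2 / (1 - (norm x)\<^sup>2)) ^ DIM('a))) \<in> borel_measurable (lebesgue_on (ball 0 1))"
    by (intro measurable_restrict_space1 measurable_completion) measurable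
  moreover have "F \<in> borel_measurable (lebesgue_on (ball 0 1))"
    by (intro measurable_restrict_space1 measurable_completion) (use F in simp)
  ultimately have "(\<integral>\<^sup>+x. F x \<partial>hyp_vol) =
     (\<integral>\<^sup>+x. ennreal ((2 / (1 - (norm x)\<^sup>2)) ^ DIM('a)) * F x \<partial>lebesgue_on (ball 0 1))"
    unfolding hyp_vol_def by (rule nn_integral_density)
  also have "\<dots> = (\<integral>\<^sup>+x. F x * ennreal ((2 / (1 - (norm x)\<^sup>2)) ^ DIM('a)) * indicator (ball 0 1) x \<partial>lborel)"
    by (subst nn_integral_restrict_space) (auto simp: nn_integral_completion mult.commute)
  finally show ?thesis .
qed

lemma hyp_norm_raise_sq:
  assumes "norm x < 1"
  shows "(hyp_norm x (hyp_raise x v))\<^sup>2 = ((1 - (norm x)\<^sup>2) / 2)\<^sup>2 * (norm v)\<^sup>2"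
proof -
  have "1 - (norm x)\<^sup>2 > 0" using assms by (simp add: power_less_one_iff)
  then have "hyp_norm x (hyp_raise x v) = (1 - (norm x)\<^sup>2) / 2 * norm v"
    by (simp add: hyp_norm_def hyp_raise_def power2_eq_square)
  then show ?thesis by (simp only: power_mult_distrib)
qed

context ball_C1
begin

lemma dirichlet_eq_energy:
  assumes N: "DIM('a) \<ge> 2"
  shows "(\<integral>\<^sup>+x. ennreal ((hyp_norm x (hyp_raise x (g x)))\<^sup>2) \<partial>hyp_vol) = ennreal (2 ^ (DIM('a) - 2)) * energy"
proof -
  let ?N = "DIM('a)"
  have "(\<integral>\<^sup>+x. ennreal ((hyp_norm x (hyp_raise x (g x)))\<^sup>2) \<partial>hyp_vol) =
    (\<integral>\<^sup>+x. ennreal ((hyp_norm x (hyp_raise x (g x)))\<^sup>2) * ennreal ((2 / (1 - (norm x)\<^sup>2)) ^ ?N) * indicator (ball 0 1) x \<partial>lborel)"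
    by (rule nn_integral_hyp_vol) (unfold hyp_norm_def hyp_raise_def, measurable)
  also have "\<dots> = (\<integral>\<^sup>+x. ennreal (2 ^ (?N - 2)) * (ennreal ((norm (g x))\<^sup>2 / (1 - (norm x)\<^sup>2) ^ (?N - 2)) * indicator (ball 0 1) x) \<partial>lborel)"
  proof (rule nn_integral_cong)
    fix x :: 'a
    show "ennreal ((hyp_norm x (hyp_raise x (g x)))\<^sup>2) * ennreal ((2 / (1 - (norm x)\<^sup>2)) ^ ?N) * indicator (ball 0 1) x
      = ennreal (2 ^ (?N - 2)) * (ennreal ((norm (g x))\<^sup>2 / (1 - (norm x)\<^sup>2) ^ (?N - 2)) * indicator (ball 0 1) x)"
    proof (cases "norm x < 1")
      case True
      define e where "e = 1 - (norm x)\<^sup>2"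
      have e: "e > 0" using True by (simp add: e_def power_less_one_iff)
      have "(2 / e) ^ ?N = (2 / e)\<^sup>2 * (2 / e) ^ (?N - 2)" using N by (simp only: power_add[symmetric] le_add_diff_inverse)
      then have "(e / 2)\<^sup>2 * (norm (g x))\<^sup>2 * (2 / e) ^ ?N = ((e / 2)\<^sup>2 * (2 / e)\<^sup>2) * ((norm (g x))\<^sup>2 * (2 / e) ^ (?N - 2))" by simp
      also have "(e / 2)\<^sup>2 * (2 / e)\<^sup>2 = 1" using e by (simp add: power_mult_distrib[symmetric])
      finally have "(e / 2)\<^sup>2 * (norm (g x))\<^sup>2 * (2 / e) ^ ?N = 2 ^ (?N - 2) * ((norm (g x))\<^sup>2 / e ^ (?N - 2))"
        by (simp add: power_divide)
      then show ?thesis using True e unfolding hyp_norm_raise_sq[OF True] e_def[symmetric]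
        by (simp add: ennreal_mult'[symmetric])
    qed simp
  qed
  also have "\<dots> = ennreal (2 ^ (?N - 2)) * energy"
    unfolding energy_def by (rule nn_integral_cmult) measurable
  finally show ?thesis .
qed

lemma hyp_L2_eq_mass:
  "(\<integral>\<^sup>+x. ennreal ((\<phi> x)\<^sup>2) \<partial>hyp_vol) = ennreal (2 ^ DIM('a)) * mass"
proof -
  let ?N = "DIM('a)"
  have "(\<integral>\<^sup>+x. ennreal ((\<phi> x)\<^sup>2) \<partial>hyp_vol) =
    (\<integral>\<^sup>+x. ennreal ((\<phi> x)\<^sup>2) * ennreal ((2 / (1 - (norm x)\<^sup>2)) ^ ?N) * indicator (ball 0 1) x \<partial>lborel)"
    by (rule nn_integral_hyp_vol) measurable
  also have "\<dots> = (\<integral>\<^sup>+x. ennreal (2 ^ ?N) * (ennreal ((\<phi> x)\<^sup>2 / (1 - (norm x)\<^sup>2) ^ ?N) * indicator (ball 0 1) x) \<partial>lborel)"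
    by (intro nn_integral_cong) (auto simp: indicator_def ennreal_mult'[symmetric] power_divide mult_ac)
  also have "\<dots> = ennreal (2 ^ ?N) * mass"
    unfolding mass_def by (rule nn_integral_cmult) measurable
  finally show ?thesis .
qed

text \<open>Each of the two volumes contributes \<open>2^N\<close>, hence \<open>4^N\<close>; the
  rest is the splitting of pairs of points at \<open>q = 1/8\<close>.\<close>

lemma hyp_double_integral_eq:
  fixes c s :: real assumes c: "c \<ge> 0"
  shows "(\<integral>\<^sup>+y. \<integral>\<^sup>+x. ennreal ((\<phi> x - \<phi> y)\<^sup>2 * (c * kernel_bound DIM('a) s (hyp_q x y))) \<partial>hyp_vol \<partial>hyp_vol) =
    ennreal (c * 4 ^ DIM('a)) * (
     (\<integral>\<^sup>+y. \<integral>\<^sup>+x. ennreal ((\<phi> x - \<phi> y)\<^sup>2 * kernel_weight s x y) *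
      (if norm x < 1 \<and> norm y < 1 \<and> hyp_q x y \<le> 1/8 then 1 else 0) \<partial>lborel \<partial>lborel) +
     (\<integral>\<^sup>+y. \<integral>\<^sup>+x. ennreal ((\<phi> x - \<phi> y)\<^sup>2 * kernel_weight s x y) *
      (if norm x < 1 \<and> norm y < 1 \<and> hyp_q x y > 1/8 then 1 else 0) \<partial>lborel \<partial>lborel))"
proof -
  let ?N = "DIM('a)"
  let ?w = "\<lambda>x::'a. ennreal ((2 / (1 - (norm x)\<^sup>2)) ^ ?N)"
  let ?K = "\<lambda>x y::'a. ennreal ((\<phi> x - \<phi> y)\<^sup>2 * (c * kernel_bound ?N s (hyp_q x y)))"
  let ?n = "\<lambda>x y::'a. ennreal ((\<phi> x - \<phi> y)\<^sup>2 * kernel_weight s x y) *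
      (if norm x < 1 \<and> norm y < 1 \<and> hyp_q x y \<le> 1/8 then 1 else 0)"
  let ?f = "\<lambda>x y::'a. ennreal ((\<phi> x - \<phi> y)\<^sup>2 * kernel_weight s x y) *
      (if norm x < 1 \<and> norm y < 1 \<and> hyp_q x y > 1/8 then 1 else 0)"
  have "(\<integral>\<^sup>+y. \<integral>\<^sup>+x. ?K x y \<partial>hyp_vol \<partial>hyp_vol) =
    (\<integral>\<^sup>+y. (\<integral>\<^sup>+x. ?K x y * ?w x * indicator (ball 0 1) x \<partial>lborel) \<partial>hyp_vol)"
    by (intro nn_integral_cong nn_integral_hyp_vol) measurable
  also have "\<dots> = (\<integral>\<^sup>+y. (\<integral>\<^sup>+x. ?K x y * ?w x * indicator (ball 0 1) x \<partial>lborel) * ?w y * indicator (ball 0 1) y \<partial>lborel)"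
    by (rule nn_integral_hyp_vol) measurable
  also have "\<dots> = (\<integral>\<^sup>+y. (\<integral>\<^sup>+x. ?K x y * ?w x * indicator (ball 0 1) x * (?w y * indicator (ball 0 1) y) \<partial>lborel) \<partial>lborel)"
    by (intro nn_integral_cong, subst nn_integral_multc) (measurable, simp add: mult.assoc)
  also have "\<dots> = (\<integral>\<^sup>+y. (\<integral>\<^sup>+x. ennreal (c * 4 ^ ?N) * (?n x y + ?f x y) \<partial>lborel) \<partial>lborel)"
  proof (intro nn_integral_cong)
    fix x y :: 'a
    show "?K x y * ?w x * indicator (ball 0 1) x * (?w y * indicator (ball 0 1) y) = ennreal (c * 4 ^ ?N) * (?n x y + ?f x y)"
    proof (cases "norm x < 1 \<and> norm y < 1")
      case True
      have e: "1 - (norm x)\<^sup>2 > 0" "1 - (norm y)\<^sup>2 > 0" using True by (auto simp: power_less_one_iff)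
      have kw: "kernel_weight s x y \<ge> 0" using True by (intro kernel_weight_nonneg) auto
      have "(4::real) ^ ?N = 2 ^ ?N * 2 ^ ?N" by (simp add: power_mult_distrib[symmetric])
      then have "(\<phi> x - \<phi> y)\<^sup>2 * (c * kernel_bound ?N s (hyp_q x y)) * (2 / (1 - (norm x)\<^sup>2)) ^ ?N * (2 / (1 - (norm y)\<^sup>2)) ^ ?N
        = c * 4 ^ ?N * ((\<phi> x - \<phi> y)\<^sup>2 * kernel_weight s x y)"
        by (simp add: kernel_weight_def power_divide)
      moreover have "?n x y + ?f x y = ennreal ((\<phi> x - \<phi> y)\<^sup>2 * kernel_weight s x y)" using True by auto
      ultimately show ?thesis using True c e kw
        by (simp add: ennreal_mult'[symmetric] kernel_bound_nonneg mult.assoc)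
    qed auto
  qed
  also have "\<dots> = (\<integral>\<^sup>+y. ennreal (c * 4 ^ ?N) * ((\<integral>\<^sup>+x. ?n x y \<partial>lborel) + (\<integral>\<^sup>+x. ?f x y \<partial>lborel)) \<partial>lborel)"
    by (intro nn_integral_cong, subst nn_integral_cmult, measurable, subst nn_integral_add) measurable
  also have "\<dots> = ennreal (c * 4 ^ ?N) * (\<integral>\<^sup>+y. ((\<integral>\<^sup>+x. ?n x y \<partial>lborel) + (\<integral>\<^sup>+x. ?f x y \<partial>lborel)) \<partial>lborel)"
    by (rule nn_integral_cmult) measurable
  also have "(\<integral>\<^sup>+y. ((\<integral>\<^sup>+x. ?n x y \<partial>lborel) + (\<integral>\<^sup>+x. ?f x y \<partial>lborel)) \<partial>lborel) =
     (\<integral>\<^sup>+y. (\<integral>\<^sup>+x. ?n x y \<partial>lborel) \<partial>lborel) + (\<integral>\<^sup>+y. (\<integral>\<^sup>+x. ?f x y \<partial>lborel) \<partial>lborel)"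
    by (rule nn_integral_add) measurable
  finally show ?thesis .
qed

end

lemma test_function_seminorm_le:
  fixes c s :: real
  assumes N: "DIM('a::euclidean_space) \<ge> 2" and s: "0 < s" "s < 1" and c: "c \<ge> 0"
  shows "\<exists>C\<ge>0. \<forall>\<phi>\<in>(test_functions :: ('a \<Rightarrow> real) set).
    (\<integral>\<^sup>+y. \<integral>\<^sup>+x. ennreal ((\<phi> x - \<phi> y)\<^sup>2 * (c * kernel_bound DIM('a) s (hyp_q x y))) \<partial>hyp_vol \<partial>hyp_vol) \<le>
    ennreal C * (\<integral>\<^sup>+x. ennreal ((hyp_norm x (hyp_raise x (euclid_grad \<phi> x)))\<^sup>2) \<partial>hyp_vol)"
proof -
  let ?N = "DIM('a)"
  obtain C1 where C1: "C1 > 0" "\<And>y::'a. norm y < 1 \<Longrightarrow>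
    (\<integral>\<^sup>+x. ennreal (kernel_bound ?N s (hyp_q x y) / (1 - (norm x)\<^sup>2) ^ ?N) *
       indicator {x \<in> ball 0 1. hyp_q x y > 1/8} x \<partial>lborel) \<le> ennreal C1"
    using kernel_far_bound[OF N s(1)] by blast
  define C2 where "C2 = 8 powr (?N - 2 * s) * (?N / (2 - 2 * s) * measure lborel (ball (0::'a) 1) * 2 powr (2 - 2 * s))"
  have C2: "C2 \<ge> 0" using s by (simp add: C2_def)
  define C where "C = c * 4 ^ ?N * (C2 + 4 * C1)"
  have C: "C \<ge> 0" using C2 C1 c by (simp add: C_def)
  have "(\<integral>\<^sup>+y. \<integral>\<^sup>+x. ennreal ((\<phi> x - \<phi> y)\<^sup>2 * (c * kernel_bound ?N s (hyp_q x y))) \<partial>hyp_vol \<partial>hyp_vol) \<le>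
    ennreal C * (\<integral>\<^sup>+x. ennreal ((hyp_norm x (hyp_raise x (euclid_grad \<phi> x)))\<^sup>2) \<partial>hyp_vol)"
    if \<phi>: "\<phi> \<in> test_functions" for \<phi> :: "'a \<Rightarrow> real"
  proof -
    obtain R where "ball_C1 \<phi> (euclid_grad \<phi>) R" using test_function_ball_C1[OF \<phi>] by blast
    then interpret ball_C1 \<phi> "euclid_grad \<phi>" R .
    have "(\<integral>\<^sup>+y. \<integral>\<^sup>+x. ennreal ((\<phi> x - \<phi> y)\<^sup>2 * (c * kernel_bound ?N s (hyp_q x y))) \<partial>hyp_vol \<partial>hyp_vol) \<le>
       ennreal (c * 4 ^ ?N) * (ennreal C2 * energy + ennreal C1 * (4 * mass))"
      unfolding hyp_double_integral_eq[OF c] C2_def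
      by (intro mult_left_mono add_mono near_part_le N s far_part_le C1) auto
    also have "\<dots> \<le> ennreal (c * 4 ^ ?N) * (ennreal C2 * energy + ennreal C1 * (4 * energy))"
      by (intro mult_left_mono add_mono poincare N) auto
    also have "\<dots> = ennreal C * energy"
      using C1 C2 c by (simp add: C_def ennreal_mult' ennreal_plus distrib_left distrib_right mult_ac)
    \<comment> \<open>The Dirichlet integral is \<open>2^(N-2)\<close> times \<open>energy\<close>,
      and this factor is at least 1.\<close>
    also have "\<dots> \<le> ennreal C * (ennreal (2 ^ (?N - 2)) * energy)"
    proof (intro mult_left_mono)
      have "1 * energy \<le> ennreal (2 ^ (?N - 2)) * energy"
        by (intro mult_right_mono) (auto simp: ennreal_1[symmetric] simp del: ennreal_1 intro!: ennreal_leI)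
      then show "energy \<le> ennreal (2 ^ (?N - 2)) * energy" by simp
    qed auto
    also have "ennreal (2 ^ (?N - 2)) * energy = (\<integral>\<^sup>+x. ennreal ((hyp_norm x (hyp_raise x (euclid_grad \<phi> x)))\<^sup>2) \<partial>hyp_vol)"
      by (rule dirichlet_eq_energy[OF N, symmetric])
    finally show ?thesis .
  qed
  then show ?thesis using C by blast
qed

text \<open>The constant 4 is the quotient of the normalisations \<open>2^N\<close> of the L^2 norm
  and \<open>2^(N-2)\<close> of the Dirichlet integral.\<close>

lemma test_function_poincare:
  fixes \<phi> :: "'a::euclidean_space \<Rightarrow> real"
  assumes N: "DIM('a) \<ge> 2" and \<phi>: "\<phi> \<in> test_functions"
  shows "(\<integral>\<^sup>+x. ennreal ((\<phi> x)\<^sup>2) \<partial>hyp_vol) \<le>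
     4 * (\<integral>\<^sup>+x. ennreal ((hyp_norm x (hyp_raise x (euclid_grad \<phi> x)))\<^sup>2) \<partial>hyp_vol)"
    "(\<integral>\<^sup>+x. ennreal ((hyp_norm x (hyp_raise x (euclid_grad \<phi> x)))\<^sup>2) \<partial>hyp_vol) < \<infinity>"
proof -
  obtain R where "ball_C1 \<phi> (euclid_grad \<phi>) R" using test_function_ball_C1[OF \<phi>] by blast
  then interpret ball_C1 \<phi> "euclid_grad \<phi>" R .
  have "(2::real) ^ DIM('a) = 4 * 2 ^ (DIM('a) - 2)" using N
    by (metis le_add_diff_inverse numeral_Bit0_eq_double mult_2 power_add power2_eq_square numeral_times_numeral)
  then have "(\<integral>\<^sup>+x. ennreal ((\<phi> x)\<^sup>2) \<partial>hyp_vol) = ennreal (4 * 2 ^ (DIM('a) - 2)) * mass"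
    by (simp only: hyp_L2_eq_mass)
  also have "\<dots> \<le> ennreal (4 * 2 ^ (DIM('a) - 2)) * energy"
    by (intro mult_left_mono poincare N) auto
  also have "\<dots> = 4 * (ennreal (2 ^ (DIM('a) - 2)) * energy)"
    by (simp add: ennreal_mult' mult.assoc)
  finally show "(\<integral>\<^sup>+x. ennreal ((\<phi> x)\<^sup>2) \<partial>hyp_vol) \<le>
     4 * (\<integral>\<^sup>+x. ennreal ((hyp_norm x (hyp_raise x (euclid_grad \<phi> x)))\<^sup>2) \<partial>hyp_vol)"
    by (simp only: dirichlet_eq_energy[OF N])
  show "(\<integral>\<^sup>+x. ennreal ((hyp_norm x (hyp_raise x (euclid_grad \<phi> x)))\<^sup>2) \<partial>hyp_vol) < \<infinity>"
    using poincare(2)[OF N] by (simp add: dirichlet_eq_energy[OF N] ennreal_mult_less_top)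
qed

section \<open>Passage to the completion\<close>

text \<open>The representative is an arbitrary choice, and its definition provides integrability on
  compact sets only. Truncations to the closed balls of radius \<open>1 - 1 / (n + 1)\<close> are
  measurable and converge pointwise.\<close>

lemma weak_grad_measurable:
  fixes f :: "'a::euclidean_space \<Rightarrow> real"
  assumes "\<exists>g. has_weak_grad f g"
  shows "weak_grad f \<in> borel_measurable hyp_vol"
proof -
  have "has_weak_grad f (weak_grad f)" unfolding weak_grad_def by (rule someI_ex[OF assms])
  then have ai: "weak_grad f absolutely_integrable_on K" if "compact K" "K \<subseteq> ball 0 1" for K
    using that by (auto simp: has_weak_grad_def)
  define K where "K n = cball (0::'a) (1 - 1 / Suc n)" for n
  have meas: "(\<lambda>x. indicator (K n) x *\<^sub>R weak_grad f x) \<in> borel_measurable lebesgue" for n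
  proof -
    have "K n \<subseteq> ball 0 1"
    proof
      fix x assume "x \<in> K n"
      then have "norm x \<le> 1 - 1 / real (Suc n)" by (simp add: K_def)
      also have "\<dots> < 1" by simp
      finally show "x \<in> ball 0 1" by simp
    qed
    then have "weak_grad f absolutely_integrable_on K n" by (intro ai) (simp_all add: K_def)
    then show ?thesis by (auto simp: set_integrable_def)
  qed
  have "(\<lambda>x. indicator (ball 0 1) x *\<^sub>R weak_grad f x) \<in> borel_measurable lebesgue"
  proof (rule borel_measurable_LIMSEQ_metric[OF meas])
    fix x :: 'a
    show "(\<lambda>n. indicator (K n) x *\<^sub>R weak_grad f x) \<longlonglongrightarrow> indicator (ball 0 1) x *\<^sub>R weak_grad f x"
    proof (cases "norm x < 1")
      case True
      have "(\<lambda>n. 1 - 1 / real (Suc n)) \<longlonglongrightarrow> 1 - 0"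
        by (intro tendsto_diff tendsto_const LIMSEQ_Suc[OF lim_1_over_n])
      then have "\<forall>\<^sub>F n in sequentially. norm x < 1 - 1 / real (Suc n)"
        using True by (intro order_tendstoD(1)[of _ "1 - 0"]) auto
      then have "\<forall>\<^sub>F n in sequentially. indicator (K n) x *\<^sub>R weak_grad f x = indicator (ball 0 1) x *\<^sub>R weak_grad f x"
        by eventually_elim (use True in \<open>auto simp: K_def\<close>)
      then show ?thesis by (rule tendsto_eventually)
    next
      case False
      have "x \<notin> K n" for n
      proof -
        have "1 - 1 / real (Suc n) < 1" by simp
        then have "1 - 1 / real (Suc n) < norm x" using False by linarith
        then show ?thesis by (simp add: K_def)
      qed
      then show ?thesis using False by simp
    qed
  qed
  then have "weak_grad f \<in> borel_measurable (lebesgue_on (ball 0 1))"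
    by (subst borel_measurable_restrict_space_iff) auto
  then show ?thesis by (simp add: hyp_vol_def)
qed

text \<open>The squared differences tend to 0 in L^1, so the theorem on almost everywhere convergent
  subsequences for L^1 applies to them.\<close>

lemma L2_AE_subseq:
  fixes f :: "'b \<Rightarrow> real" and \<phi> :: "nat \<Rightarrow> 'b \<Rightarrow> real"
  assumes [measurable]: "f \<in> borel_measurable M" "\<And>n. \<phi> n \<in> borel_measurable M"
    and lim: "(\<lambda>n. \<integral>\<^sup>+x. ennreal ((\<phi> n x - f x)\<^sup>2) \<partial>M) \<longlonglongrightarrow> 0"
  shows "\<exists>r :: nat \<Rightarrow> nat. strict_mono r \<and> (AE x in M. (\<lambda>n. \<phi> (r n) x) \<longlonglongrightarrow> f x)"
proof -
  have "\<forall>\<^sub>F n in sequentially. (\<integral>\<^sup>+x. ennreal ((\<phi> n x - f x)\<^sup>2) \<partial>M) < 1"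
    using order_tendstoD(2)[OF lim, of 1] by simp
  then obtain n0 where n0: "\<And>n. n \<ge> n0 \<Longrightarrow> (\<integral>\<^sup>+x. ennreal ((\<phi> n x - f x)\<^sup>2) \<partial>M) < 1"
    unfolding eventually_sequentially by auto
  \<comment> \<open>The shift by \<open>n0\<close> discards the initial terms, whose integral may be
    infinite.\<close>
  define u where "u n = (\<lambda>x. (\<phi> (n + n0) x - f x)\<^sup>2)" for n
  have int: "integrable M (u n)" for n
  proof (rule integrableI_nonneg)
    have "(\<integral>\<^sup>+x. ennreal ((\<phi> (n + n0) x - f x)\<^sup>2) \<partial>M) < 1" by (rule n0) simp
    also have "(1::ennreal) < \<infinity>" by simp
    finally show "(\<integral>\<^sup>+x. ennreal (u n x) \<partial>M) < \<infinity>" by (simp add: u_def)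
    show "u n \<in> borel_measurable M" unfolding u_def by measurable
  qed (simp add: u_def)
  have eq: "ennreal (\<integral>x. norm (u n x) \<partial>M) = (\<integral>\<^sup>+x. ennreal ((\<phi> (n + n0) x - f x)\<^sup>2) \<partial>M)" for n
    using nn_integral_eq_integral[OF int[of n]] by (simp add: u_def)
  have "(\<lambda>n. ennreal (\<integral>x. norm (u n x) \<partial>M)) \<longlonglongrightarrow> 0"
    unfolding eq using lim by (rule LIMSEQ_ignore_initial_segment)
  then have "(\<lambda>n. \<integral>x. norm (u n x) \<partial>M) \<longlonglongrightarrow> 0"
    by (subst (asm) ennreal_tendsto_0_iff) auto
  then obtain r where r: "strict_mono r" "AE x in M. (\<lambda>n. u (r n) x) \<longlonglongrightarrow> 0"
    using tendsto_L1_AE_subseq[of M u, OF int] by blast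
  have "AE x in M. (\<lambda>n. \<phi> (r n + n0) x) \<longlonglongrightarrow> f x"
    using r(2)
  proof eventually_elim
    case (elim x)
    have "(\<lambda>n. sqrt (u (r n) x)) \<longlonglongrightarrow> sqrt 0" by (rule tendsto_real_sqrt[OF elim])
    then have "(\<lambda>n. \<bar>\<phi> (r n + n0) x - f x\<bar>) \<longlonglongrightarrow> 0" by (simp add: u_def)
    then have "(\<lambda>n. \<phi> (r n + n0) x - f x) \<longlonglongrightarrow> 0" by (rule tendsto_rabs_zero_cancel)
    then show ?case by (simp add: LIM_zero_iff)
  qed
  moreover have "strict_mono (\<lambda>n. r n + n0)" using r(1) by (auto simp: strict_mono_def)
  ultimately show ?thesis by (intro exI[of _ "\<lambda>n. r n + n0"]) auto
qed

text \<open>Fatou's lemma twice, in \<open>x\<close> for almost every fixed \<open>y\<close> and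
  then in \<open>y\<close>. Measurability is asked of the approximants; the limit enters only
  through almost everywhere monotonicity, which suits an \<open>f\<close> measurable only for the
  completed measure.\<close>

lemma double_integral_Fatou:
  fixes f :: "'b \<Rightarrow> real" and \<phi> :: "nat \<Rightarrow> 'b \<Rightarrow> real" and W :: "'b \<Rightarrow> 'b \<Rightarrow> real"
  assumes ae: "AE x in M. (\<lambda>n. \<phi> n x) \<longlonglongrightarrow> f x"
    and inner: "\<And>n y. (\<lambda>x. ennreal ((\<phi> n x - \<phi> n y)\<^sup>2 * W x y)) \<in> borel_measurable M"
    and outer: "\<And>n. (\<lambda>y. \<integral>\<^sup>+x. ennreal ((\<phi> n x - \<phi> n y)\<^sup>2 * W x y) \<partial>M) \<in> borel_measurable M"
  shows "(\<integral>\<^sup>+y. \<integral>\<^sup>+x. ennreal ((f x - f y)\<^sup>2 * W x y) \<partial>M \<partial>M) \<le>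
    liminf (\<lambda>n. \<integral>\<^sup>+y. \<integral>\<^sup>+x. ennreal ((\<phi> n x - \<phi> n y)\<^sup>2 * W x y) \<partial>M \<partial>M)"
proof -
  let ?S = "\<lambda>n x y. ennreal ((\<phi> n x - \<phi> n y)\<^sup>2 * W x y)"
  let ?T = "\<lambda>x y. ennreal ((f x - f y)\<^sup>2 * W x y)"
  have "(\<integral>\<^sup>+x. ?T x y \<partial>M) \<le>
     liminf (\<lambda>n. \<integral>\<^sup>+x. ?S n x y \<partial>M)" if y: "(\<lambda>n. \<phi> n y) \<longlonglongrightarrow> f y" for y
  proof -
    have "(\<integral>\<^sup>+x. ?T x y \<partial>M) \<le>
      (\<integral>\<^sup>+x. liminf (\<lambda>n. ?S n x y) \<partial>M)"
    proof (rule nn_integral_mono_AE, use ae in eventually_elim)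
      case (elim x)
      have "(\<lambda>n. ?S n x y) \<longlonglongrightarrow> ?T x y"
        by (intro tendsto_intros elim y)
      then show ?case by (simp add: lim_imp_Liminf)
    qed
    also have "\<dots> \<le> liminf (\<lambda>n. \<integral>\<^sup>+x. ?S n x y \<partial>M)"
      by (rule nn_integral_liminf[OF inner])
    finally show ?thesis .
  qed
  then have "(\<integral>\<^sup>+y. \<integral>\<^sup>+x. ?T x y \<partial>M \<partial>M) \<le>
    (\<integral>\<^sup>+y. liminf (\<lambda>n. \<integral>\<^sup>+x. ?S n x y \<partial>M) \<partial>M)"
    using ae by (intro nn_integral_mono_AE) (auto elim!: eventually_mono)
  also have "\<dots> \<le> liminf (\<lambda>n. \<integral>\<^sup>+y. \<integral>\<^sup>+x. ?S n x y \<partial>M \<partial>M)"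
    by (rule nn_integral_liminf[OF outer])
  finally show ?thesis .
qed

lemma nn_integral_norm_sq_le:
  fixes a b :: "'b \<Rightarrow> 'c::euclidean_space"
  assumes [measurable]: "a \<in> borel_measurable M" "b \<in> borel_measurable M"
  shows "(\<integral>\<^sup>+x. ennreal ((norm (b x))\<^sup>2) \<partial>M) \<le>
    2 * (\<integral>\<^sup>+x. ennreal ((norm (a x - b x))\<^sup>2) \<partial>M) + 2 * (\<integral>\<^sup>+x. ennreal ((norm (a x))\<^sup>2) \<partial>M)"
proof -
  have "(\<integral>\<^sup>+x. ennreal ((norm (b x))\<^sup>2) \<partial>M) \<le>
    (\<integral>\<^sup>+x. 2 * ennreal ((norm (a x - b x))\<^sup>2) + 2 * ennreal ((norm (a x))\<^sup>2) \<partial>M)"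
  proof (intro nn_integral_mono)
    fix x
    have "norm (b x) \<le> norm (a x - b x) + norm (a x)"
      using norm_triangle_ineq4[of "a x" "a x - b x"] by simp
    then have "(norm (b x))\<^sup>2 \<le> (norm (a x - b x) + norm (a x))\<^sup>2" by (intro power_mono) auto
    also have "\<dots> \<le> 2 * (norm (a x - b x))\<^sup>2 + 2 * (norm (a x))\<^sup>2"
      using zero_le_power2[of "norm (a x - b x) - norm (a x)"] by (simp add: power2_eq_square algebra_simps)
    finally have "ennreal ((norm (b x))\<^sup>2) \<le> ennreal (2 * (norm (a x - b x))\<^sup>2 + 2 * (norm (a x))\<^sup>2)" by (rule ennreal_leI)
    then show "ennreal ((norm (b x))\<^sup>2) \<le> 2 * ennreal ((norm (a x - b x))\<^sup>2) + 2 * ennreal ((norm (a x))\<^sup>2)"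
      by (simp add: ennreal_mult')
  qed
  also have "\<dots> = (\<integral>\<^sup>+x. 2 * ennreal ((norm (a x - b x))\<^sup>2) \<partial>M) + (\<integral>\<^sup>+x. 2 * ennreal ((norm (a x))\<^sup>2) \<partial>M)"
    by (rule nn_integral_add) measurable
  also have "\<dots> = 2 * (\<integral>\<^sup>+x. ennreal ((norm (a x - b x))\<^sup>2) \<partial>M) + 2 * (\<integral>\<^sup>+x. ennreal ((norm (a x))\<^sup>2) \<partial>M)"
    by (intro arg_cong2[where f="(+)"] nn_integral_cmult) measurable
  finally show ?thesis .
qed

text \<open>Here the kernel gives way to its majorant. On the diagonal, where the kernel is not
  controlled, the factor \<open>(f x - f y)^2\<close> vanishes.\<close>

lemma frac_seminorm_sq_le_bound:
  fixes f :: "'a::euclidean_space \<Rightarrow> real" and s c :: real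
  assumes c: "c > 0" and ker: "\<And>\<rho> q. \<lbrakk>0 < \<rho>; cosh \<rho> = 1 + 2 * q\<rbrakk> \<Longrightarrow> frac_kernel DIM('a) s \<rho> \<le> c * kernel_bound DIM('a) s q"
  shows "frac_seminorm_sq s f \<le>
    (\<integral>\<^sup>+y. \<integral>\<^sup>+x. ennreal ((f x - f y)\<^sup>2 * (c * kernel_bound DIM('a) s (hyp_q x y))) \<partial>hyp_vol \<partial>hyp_vol)"
  unfolding frac_seminorm_sq_def
proof (intro nn_integral_mono ennreal_leI)
  fix x y :: 'a assume "y \<in> space hyp_vol" "x \<in> space hyp_vol"
  then have xy: "x \<in> ball 0 1" "y \<in> ball 0 1" by auto
  show "\<bar>f x - f y\<bar>\<^sup>2 * frac_kernel DIM('a) s (hyp_dist x y) \<le> (f x - f y)\<^sup>2 * (c * kernel_bound DIM('a) s (hyp_q x y))"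
  proof (cases "x = y")
    case False
    show ?thesis unfolding power2_abs
      by (intro mult_left_mono ker cosh_hyp_dist xy False) auto
  qed simp
qed

text \<open>The three bounds rest on one approximating sequence. Comparing Dirichlet integrals of
  \<open>f\<close> and \<open>\<phi> n\<close> in either direction costs a factor 2 and an error
  \<open>2 d n\<close> that disappears in the limit.\<close>

lemma hyp_H1_bounds:
  fixes s :: real
  assumes N: "DIM('a::euclidean_space) \<ge> 2" and s: "0 < s" "s < 1"
  shows "\<exists>C>0. \<forall>f\<in>(hyp_H1 :: ('a \<Rightarrow> real) set). frac_seminorm_sq s f \<le> ennreal C * hyp_dirichlet f"
    and "\<And>f :: 'a \<Rightarrow> real. f \<in> hyp_H1 \<Longrightarrow> (\<integral>\<^sup>+x. ennreal ((f x)\<^sup>2) \<partial>hyp_vol) \<le> 16 * hyp_dirichlet f"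
    and "\<And>f :: 'a \<Rightarrow> real. f \<in> hyp_H1 \<Longrightarrow> hyp_dirichlet f < \<infinity>"
proof -
  let ?N = "DIM('a)"
  let ?D = "\<lambda>\<phi>::'a \<Rightarrow> real. \<integral>\<^sup>+x. ennreal ((hyp_norm x (hyp_raise x (euclid_grad \<phi> x)))\<^sup>2) \<partial>hyp_vol"
  have approx: "\<exists>\<phi> d. (\<forall>n. \<phi> n \<in> test_functions) \<and> (\<lambda>n. \<integral>\<^sup>+x. ennreal ((\<phi> n x - f x)\<^sup>2) \<partial>hyp_vol) \<longlonglongrightarrow> 0 \<and>
      d \<longlonglongrightarrow> 0 \<and> (\<forall>n. ?D (\<phi> n) \<le> 2 * d n + 2 * hyp_dirichlet f) \<and> (\<forall>n. hyp_dirichlet f \<le> 2 * d n + 2 * ?D (\<phi> n)) \<and>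
      f \<in> borel_measurable hyp_vol \<and> (\<forall>n. \<phi> n \<in> borel_measurable borel)"
    if f: "f \<in> hyp_H1" for f :: "'a \<Rightarrow> real"
  proof -
    obtain \<phi> where \<phi>: "\<And>n::nat. \<phi> n \<in> test_functions" and l2: "(\<lambda>n. \<integral>\<^sup>+x. ennreal ((\<phi> n x - f x)\<^sup>2) \<partial>hyp_vol) \<longlonglongrightarrow> 0"
      and g2: "(\<lambda>n. \<integral>\<^sup>+x. ennreal ((hyp_norm x (hyp_raise x (euclid_grad (\<phi> n) x) - hyp_grad f x))\<^sup>2) \<partial>hyp_vol) \<longlonglongrightarrow> 0"
      and wg: "\<exists>g. has_weak_grad f g" and fm: "f \<in> borel_measurable hyp_vol"
      using f unfolding hyp_H1_def hyp_L2_def by blast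
    define d where "d n = (\<integral>\<^sup>+x. ennreal ((hyp_norm x (hyp_raise x (euclid_grad (\<phi> n) x) - hyp_grad f x))\<^sup>2) \<partial>hyp_vol)" for n
    have [measurable]: "\<phi> n \<in> borel_measurable borel" "euclid_grad (\<phi> n) \<in> borel_measurable borel" for n
    proof -
      obtain R where "ball_C1 (\<phi> n) (euclid_grad (\<phi> n)) R" using test_function_ball_C1[OF \<phi>] by blast
      then interpret ball_C1 "\<phi> n" "euclid_grad (\<phi> n)" R .
      show "\<phi> n \<in> borel_measurable borel" "euclid_grad (\<phi> n) \<in> borel_measurable borel" by measurable
    qed
    \<comment> \<open>Scaling by \<open>2 / (1 - |x|^2)\<close> turns hyperbolic lengths into
      Euclidean ones, so the quadratic triangle inequality for vector fields applies to the
      gradients.\<close>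
    define a where "a n x = (2 / (1 - (norm x)\<^sup>2)) *\<^sub>R hyp_raise x (euclid_grad (\<phi> n) x)" for n x
    define b where "b x = (2 / (1 - (norm x)\<^sup>2)) *\<^sub>R hyp_grad f x" for x
    have am: "a n \<in> borel_measurable hyp_vol" for n
      by (rule borel_measurable_hyp_vol) (unfold a_def hyp_raise_def, measurable)
    have bm: "b \<in> borel_measurable hyp_vol"
    proof -
      have [measurable]: "weak_grad f \<in> borel_measurable hyp_vol" by (rule weak_grad_measurable[OF wg])
      have [measurable]: "(\<lambda>x::'a. (2 / (1 - (norm x)\<^sup>2))) \<in> borel_measurable hyp_vol"
        "(\<lambda>x::'a. ((1 - (norm x)\<^sup>2) / 2)\<^sup>2) \<in> borel_measurable hyp_vol"
        by (rule borel_measurable_hyp_vol, measurable)+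
      show ?thesis unfolding b_def hyp_grad_def hyp_raise_def by measurable
    qed
    have nrm: "(hyp_norm x v)\<^sup>2 = (norm ((2 / (1 - (norm x)\<^sup>2)) *\<^sub>R v))\<^sup>2" for x v :: 'a
      by (simp only: hyp_norm_def norm_scaleR power_mult_distrib real_norm_def power2_abs)
    have ea: "?D (\<phi> n) = (\<integral>\<^sup>+x. ennreal ((norm (a n x))\<^sup>2) \<partial>hyp_vol)" for n
      unfolding nrm a_def ..
    have eb: "hyp_dirichlet f = (\<integral>\<^sup>+x. ennreal ((norm (b x))\<^sup>2) \<partial>hyp_vol)"
      unfolding nrm b_def hyp_dirichlet_def ..
    have ed: "d n = (\<integral>\<^sup>+x. ennreal ((norm (a n x - b x))\<^sup>2) \<partial>hyp_vol)" for n
      unfolding nrm a_def b_def d_def scaleR_diff_right[symmetric] ..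
    have "hyp_dirichlet f \<le> 2 * d n + 2 * ?D (\<phi> n)" for n
      unfolding ea eb ed by (rule nn_integral_norm_sq_le[OF am bm])
    moreover have "?D (\<phi> n) \<le> 2 * d n + 2 * hyp_dirichlet f" for n
      using nn_integral_norm_sq_le[OF bm am, of n] unfolding ea eb ed by (simp add: norm_minus_commute)
    moreover have "d \<longlonglongrightarrow> 0" using g2 unfolding d_def .
    ultimately show ?thesis using \<phi> l2 fm by (intro exI[of _ \<phi>] exI[of _ d]) auto
  qed
  show fin: "hyp_dirichlet f < \<infinity>" if f: "f \<in> hyp_H1" for f :: "'a \<Rightarrow> real"
  proof -
    obtain \<phi> d where \<phi>: "\<And>n. \<phi> n \<in> test_functions" and d: "d \<longlonglongrightarrow> 0"
      and le: "\<And>n::nat. hyp_dirichlet f \<le> 2 * d n + 2 * ?D (\<phi> n)" using approx[OF f] by auto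
    have "\<forall>\<^sub>F n in sequentially. d n < 1" using order_tendstoD(2)[OF d, of 1] by simp
    then obtain n where "d n < 1" unfolding eventually_sequentially by auto
    then have "d n < \<infinity>" by (rule order.strict_trans) simp
    moreover have "?D (\<phi> n) < \<infinity>" by (rule test_function_poincare(2)[OF N \<phi>])
    ultimately have "2 * d n + 2 * ?D (\<phi> n) < \<infinity>" by (simp add: ennreal_mult_less_top)
    then show ?thesis using le[of n] by (rule order_le_less_trans[rotated])
  qed
  show "(\<integral>\<^sup>+x. ennreal ((f x)\<^sup>2) \<partial>hyp_vol) \<le> 16 * hyp_dirichlet f" if f: "f \<in> hyp_H1" for f :: "'a \<Rightarrow> real"
  proof -
    obtain \<phi> d where \<phi>: "\<And>n. \<phi> n \<in> test_functions" and d: "d \<longlonglongrightarrow> 0"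
      and l2: "(\<lambda>n. \<integral>\<^sup>+x. ennreal ((\<phi> n x - f x)\<^sup>2) \<partial>hyp_vol) \<longlonglongrightarrow> 0"
      and le: "\<And>n::nat. ?D (\<phi> n) \<le> 2 * d n + 2 * hyp_dirichlet f"
      and fm: "f \<in> borel_measurable hyp_vol" and pm: "\<And>n. \<phi> n \<in> borel_measurable borel" using approx[OF f] by auto
    let ?l = "\<lambda>n. \<integral>\<^sup>+x. ennreal ((\<phi> n x - f x)\<^sup>2) \<partial>hyp_vol"
    \<comment> \<open>The number 16 is 2 * 4 * 2: the quadratic triangle inequality for
      \<open>f\<close>, the Poincare constant, and the same inequality for the gradients.\<close>
    have "(\<integral>\<^sup>+x. ennreal ((f x)\<^sup>2) \<partial>hyp_vol) \<le> 2 * ?l n + 2 * (4 * (2 * d n + 2 * hyp_dirichlet f))" for n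
    proof -
      have "(\<integral>\<^sup>+x. ennreal ((f x)\<^sup>2) \<partial>hyp_vol) \<le> 2 * ?l n + 2 * (\<integral>\<^sup>+x. ennreal ((\<phi> n x)\<^sup>2) \<partial>hyp_vol)"
        using nn_integral_norm_sq_le[OF borel_measurable_hyp_vol[OF pm] fm, of n] by simp
      also have "\<dots> \<le> 2 * ?l n + 2 * (4 * ?D (\<phi> n))"
        by (intro add_left_mono mult_left_mono test_function_poincare(1) N \<phi>) auto
      also have "\<dots> \<le> 2 * ?l n + 2 * (4 * (2 * d n + 2 * hyp_dirichlet f))"
        by (intro add_left_mono mult_left_mono le) auto
      finally show ?thesis .
    qed
    moreover have "(\<lambda>n. 2 * ?l n + 2 * (4 * (2 * d n + 2 * hyp_dirichlet f))) \<longlonglongrightarrow> 2 * 0 + 2 * (4 * (2 * 0 + 2 * hyp_dirichlet f))"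
      by (intro tendsto_add ennreal_tendsto_cmult tendsto_const l2 d) auto
    ultimately have "(\<integral>\<^sup>+x. ennreal ((f x)\<^sup>2) \<partial>hyp_vol) \<le> 2 * 0 + 2 * (4 * (2 * 0 + 2 * hyp_dirichlet f))"
      by (intro LIMSEQ_le_const) auto
    then show ?thesis by (simp add: mult.assoc[symmetric])
  qed
  obtain c where c: "c > 0" and ker: "\<And>\<rho> q. \<lbrakk>0 < \<rho>; cosh \<rho> = 1 + 2 * q\<rbrakk> \<Longrightarrow> frac_kernel ?N s \<rho> \<le> c * kernel_bound ?N s q"
    using frac_kernel_le[OF N s(1)] by blast
  let ?S = "\<lambda>\<phi> x y. ennreal ((\<phi> x - \<phi> y)\<^sup>2 * (c * kernel_bound ?N s (hyp_q x y)))"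
  let ?E = "\<lambda>\<phi>::'a \<Rightarrow> real. \<integral>\<^sup>+y. \<integral>\<^sup>+x. ennreal ((\<phi> x - \<phi> y)\<^sup>2 * (c * kernel_bound ?N s (hyp_q x y))) \<partial>hyp_vol \<partial>hyp_vol"
  obtain C where C: "C \<ge> 0" and test: "\<And>\<phi>. \<phi> \<in> test_functions \<Longrightarrow> ?E \<phi> \<le> ennreal C * ?D \<phi>"
    using test_function_seminorm_le[OF N s, of c] c by auto
  have "frac_seminorm_sq s f \<le> ennreal (2 * C + 1) * hyp_dirichlet f" if f: "f \<in> hyp_H1" for f :: "'a \<Rightarrow> real"
  proof -
    obtain \<phi> d where \<phi>: "\<And>n. \<phi> n \<in> test_functions" and d: "d \<longlonglongrightarrow> 0"
      and l2: "(\<lambda>n. \<integral>\<^sup>+x. ennreal ((\<phi> n x - f x)\<^sup>2) \<partial>hyp_vol) \<longlonglongrightarrow> 0"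
      and le: "\<And>n::nat. ?D (\<phi> n) \<le> 2 * d n + 2 * hyp_dirichlet f"
      and fm: "f \<in> borel_measurable hyp_vol" and pm: "\<And>n. \<phi> n \<in> borel_measurable borel" using approx[OF f] by auto
    obtain r :: "nat \<Rightarrow> nat" where r: "strict_mono r" "AE x in hyp_vol. (\<lambda>n. \<phi> (r n) x) \<longlonglongrightarrow> f x"
      using L2_AE_subseq[OF fm borel_measurable_hyp_vol[OF pm] l2] by blast
    have "frac_seminorm_sq s f \<le> ?E f" by (rule frac_seminorm_sq_le_bound[OF c ker])
    also have "?E f \<le> liminf (\<lambda>n. ?E (\<phi> (r n)))"
    proof (rule double_integral_Fatou[OF r(2)])
      fix n
      note pm[measurable]
      show "(\<lambda>x. ?S (\<phi> (r n)) x y) \<in> borel_measurable hyp_vol" for y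
        by (rule borel_measurable_hyp_vol) measurable
      \<comment> \<open>Rewriting the inner integral over \<open>lborel\<close>, which is
        sigma-finite and fits the Borel integrand, makes its dependence on \<open>y\<close>
        measurable.\<close>
      have "(\<integral>\<^sup>+x. ?S (\<phi> (r n)) x y \<partial>hyp_vol) =
        (\<integral>\<^sup>+x. ?S (\<phi> (r n)) x y *
          ennreal ((2 / (1 - (norm x)\<^sup>2)) ^ ?N) * indicator (ball 0 1) x \<partial>lborel)" for y
        by (rule nn_integral_hyp_vol) measurable
      then show "(\<lambda>y. \<integral>\<^sup>+x. ?S (\<phi> (r n)) x y \<partial>hyp_vol) \<in> borel_measurable hyp_vol"
        by (intro borel_measurable_hyp_vol) (simp only:, measurable)
    qed
    also have "\<dots> \<le> liminf (\<lambda>n. ennreal C * (2 * d (r n) + 2 * hyp_dirichlet f))"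
    proof (intro Liminf_mono always_eventually allI)
      fix n
      have "?E (\<phi> (r n)) \<le> ennreal C * ?D (\<phi> (r n))" by (rule test[OF \<phi>])
      also have "\<dots> \<le> ennreal C * (2 * d (r n) + 2 * hyp_dirichlet f)" by (intro mult_left_mono le) auto
      finally show "?E (\<phi> (r n)) \<le> ennreal C * (2 * d (r n) + 2 * hyp_dirichlet f)" .
    qed
    also have "\<dots> = ennreal C * (2 * 0 + 2 * hyp_dirichlet f)"
      using LIMSEQ_subseq_LIMSEQ[OF d r(1)]
      by (intro lim_imp_Liminf ennreal_tendsto_cmult tendsto_add tendsto_const) (auto simp: o_def)
    also have "\<dots> = ennreal (2 * C) * hyp_dirichlet f" using C by (simp add: ennreal_mult' mult_ac)
    also have "\<dots> \<le> ennreal (2 * C + 1) * hyp_dirichlet f" by (intro mult_right_mono ennreal_leI) auto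
    finally show ?thesis .
  qed
  moreover have "2 * C + 1 > 0" using C by simp
  ultimately show "\<exists>C>0. \<forall>f\<in>(hyp_H1 :: ('a \<Rightarrow> real) set). frac_seminorm_sq s f \<le> ennreal C * hyp_dirichlet f" by blast
qed

theorem theorem2p1:
  fixes s :: real
  assumes "DIM('a::euclidean_space) \<ge> 2" and "0 < s" and "s < 1"
  shows "(\<exists>C::real. C > 0 \<and>
            (\<forall>f \<in> (hyp_H1 :: ('a \<Rightarrow> real) set).
               frac_seminorm_sq s f \<le> ennreal C *
                 (\<integral>\<^sup>+x. ennreal ((hyp_norm x (hyp_grad f x))\<^sup>2) \<partial>hyp_vol))) \<and>
         (hyp_H1 :: ('a \<Rightarrow> real) set) \<subseteq> hyp_Hs s \<and>
         (\<exists>C::real. C > 0 \<and>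
            (\<forall>f \<in> (hyp_H1 :: ('a \<Rightarrow> real) set). hyp_Hs_norm s f \<le> C * hyp_H1_norm f))"
proof -
  note bounds = hyp_H1_bounds[OF assms]
  obtain C where C: "C > 0" "\<And>f::'a \<Rightarrow> real. f \<in> hyp_H1 \<Longrightarrow> frac_seminorm_sq s f \<le> ennreal C * hyp_dirichlet f"
    using bounds(1) by blast
  have fin: "frac_seminorm_sq s f < \<infinity>" if "f \<in> hyp_H1" for f :: "'a \<Rightarrow> real"
    using C(2)[OF that] bounds(3)[OF that] by (auto intro: order_le_less_trans simp: ennreal_mult_less_top)
  have "hyp_Hs_norm s f \<le> sqrt (16 + C) * hyp_H1_norm f" if f: "f \<in> hyp_H1" for f :: "'a \<Rightarrow> real"
  proof -
    define D where "D = enn2real (hyp_dirichlet f)"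
    \<comment> \<open>Since \<open>enn2real\<close> sends infinity to 0, finiteness of the Dirichlet
      integral is what makes the real-valued norm faithful.\<close>
    have D: "hyp_dirichlet f = ennreal D" "D \<ge> 0" using bounds(3)[OF f] by (simp_all add: D_def)
    have "enn2real (frac_seminorm_sq s f) \<le> enn2real (ennreal (C * D))"
      using C(2)[OF f] C(1) D by (intro enn2real_mono) (auto simp: ennreal_mult'[symmetric])
    then have 1: "enn2real (frac_seminorm_sq s f) \<le> C * D" using C(1) D by simp
    have "f \<in> borel_measurable hyp_vol" using f by (simp add: hyp_H1_def hyp_L2_def)
    then have "(\<integral>x. \<bar>f x\<bar>\<^sup>2 \<partial>hyp_vol) = enn2real (\<integral>\<^sup>+x. ennreal (\<bar>f x\<bar>\<^sup>2) \<partial>hyp_vol)"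
      by (intro integral_eq_nn_integral) auto
    also have "\<dots> \<le> enn2real (ennreal (16 * D))"
      using bounds(2)[OF f] D by (intro enn2real_mono) (auto simp: ennreal_mult' ennreal_mult_less_top)
    finally have 2: "(\<integral>x. \<bar>f x\<bar>\<^sup>2 \<partial>hyp_vol) \<le> 16 * D" using D by simp
    have "hyp_Hs_norm s f \<le> sqrt ((16 + C) * D)"
      unfolding hyp_Hs_norm_def using 1 2 by (intro real_sqrt_le_mono) (simp add: distrib_right)
    then show ?thesis by (simp add: hyp_H1_norm_def D_def real_sqrt_mult)
  qed
  moreover have "sqrt (16 + C) > 0" using C by simp
  moreover have "(hyp_H1 :: ('a \<Rightarrow> real) set) \<subseteq> hyp_Hs s"
    using fin by (auto simp: hyp_Hs_def hyp_H1_def)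
  ultimately show ?thesis using C unfolding hyp_dirichlet_def by blast
qed

end
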